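(* Let $k\ge1$, $\alpha\in(0,1]$ and $\beta\in[0,1]\cup\{\infty\}$. The pairing $\mathcal X^k\times\Omega^k_{\alpha,\beta}\to\mathbb R$, $(X,A)\mapsto A(X)$, extends continuously to a map $\mathcal B^k_{\alpha,\beta}\times\Omega^k_{\alpha,\beta}\to\mathbb R$.
   Context: Distances and diameters are Euclidean; $\mathrm{Vol}^k$ is $k$-dimensional Hausdorff measure. A $k$-simplex is the convex hull of affinely independent $v_0,\dots,v_k\in\mathbb R^d$; its boundary faces are the $(k-1)$-simplices spanned by $k$ of its vertices. An oriented $k$-simplex $[v_0,\dots,v_k]$ is a simplex with an ordering of vertices modulo even permutations; $-\sigma$ has the opposite orientation; orientations of simplices in the same $k$-plane can be compared. $\mathfrak X^k$ is the set of oriented $k$-simplices in $\mathbb R^d$, $\mathfrak X^k_{\le1}$ those with diameter $\le1$. A subdivision of $\sigma$ is a finite set of $k$-simplices oriented as $\sigma$, with pairwise intersections of zero $\mathrm{Vol}^k$, with union $\sigma$. Chains: $\mathcal X^k$ is the free $\mathbb Z$-module on $\mathfrak X^k$ modulo identifying the formal negative of $\sigma$ with the oppositely oriented simplex and identifying $\sigma$ with $\sum_{\tau\in\mathcal K}\tau$ for every subdivision $\mathcal K$ of $\sigma$. The boundary $\partial:\mathcal X^{k+1}\to\mathcal X^k$ is induced by $\partial[v_0,\dots,v_{k+1}]=\sum_i(-1)^i[v_0,\dots,\hat v_i,\dots,v_{k+1}]$. Mass: for a $k$-simplex $\sigma$, $h_\sigma:=\min_{F}\max_{x\in\sigma}d(x,\langle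 F\rangle)$ (min over boundary faces $F$, $\langle F\rangle$ the affine hull of $F$), $\mathbf m^k_\alpha(\sigma):=\max_F\mathrm{Vol}^{k-1}(F)\,h_\sigma^\alpha$ for $\alpha\in(0,1]$, $\mathbf m^k_0(\sigma):=1$, $\mathbf m^k_\infty(\sigma):=0$. Cochains: $\Omega^k$ is the set of additive maps $A:\mathcal X^k\to\mathbb R$ such that $(v_0,\dots,v_k)\mapsto A([v_0,\dots,v_k])$ is Borel measurable; $(\partial A)(\tau):=A(\partial\tau)$. Put $\|A\|_\alpha:=\sup_{\sigma\in\mathfrak X^k_{\le1}}|A(\sigma)|/\mathbf m^k_\alpha(\sigma)$, and $\|A\|_\infty:=+\infty$ if $A\ne0$, $\|0\|_\infty:=0$ (for every degree). $\|A\|_{\alpha,\beta}:=\|A\|_\alpha+\|\partial A\|_\beta$ and $\Omega^k_{\alpha,\beta}:=\{A\in\Omega^k:\|A\|_{\alpha,\beta}<\infty\}$. Flat norm: for $X\in\mathcal X^k$, $|X|_{\alpha;k}:=\inf\{\sum_j|c_j|\mathbf m^k_\alpha(\sigma_j): X=\sum_jc_j\sigma_j,\ c_j\in\mathbb Z,\ \sigma_j\in\mathfrak X^k_{\le1}\}$ (finite sums), and $|X|_{(\alpha,\beta)}:=\inf_{Z\in\mathcal X^{k+1}}\{|X-\partial Z|_{\alpha;k}+|Z|_{\beta;k+1}\}$. $\mathcal B^k_{\alpha,\beta}$ is the completion of the $\mathbb Z$-module $\mathcal X^k$ with respect to the (pseudo-)metric $|X-Y|_{(\alpha,\beta)}$.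 *)

theory Defs
  imports
    "HOL-Analysis.Analysis"
    "HOL-Algebra.Free_Abelian_Groups"
    "HOL-Algebra.Generated_Groups"
    "Jordan_Normal_Form.Determinant"
begin

section \<open>Hausdorff measure\<close>

text \<open>The normalising factor makes the \<open>k\<close>-dimensional measure agree with Lebesgue measure
  on \<open>k\<close>-dimensional Euclidean space. Empty covering sets have weight \<open>0\<close> also for \<open>k = 0\<close>.\<close>

definition hausdorff_measure :: "nat \<Rightarrow> 'a::metric_space set \<Rightarrow> ennreal" where
  "hausdorff_measure k S =
    (SUP \<delta>\<in>{0<..}.
      INF C\<in>{C :: nat \<Rightarrow> 'a set. S \<subseteq> (\<Union>i. C i) \<and> (\<forall>i. bounded (C i) \<and> diameter (C i) \<le> \<delta>)}.
        suminf (\<lambda>i. if C i = {} then 0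
          else ennreal (unit_ball_vol (real k) * (diameter (C i) / 2) ^ k)))"

section \<open>Oriented simplices and subdivisions\<close>

type_synonym 'a osimplex = "'a list set"

definition ordered_simplices :: "nat \<Rightarrow> 'a::euclidean_space list set" where
  "ordered_simplices k =
    {vs. length vs = Suc k \<and> distinct vs \<and> \<not> affine_dependent (set vs)}"

definition oriented :: "'a list \<Rightarrow> 'a osimplex" where
  "oriented vs = {permute_list p vs |p. p permutes {..<length vs} \<and> evenperm p}"

definition oriented_simplices :: "nat \<Rightarrow> 'a::euclidean_space osimplex set" where
  "oriented_simplices k = oriented ` ordered_simplices k"

definition vertices :: "'a osimplex \<Rightarrow> 'a set" where
  "vertices \<sigma> = (\<Union>vs\<in>\<sigma>. set vs)"

definition body :: "'a::euclidean_space osimplex \<Rightarrow> 'a set" where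
  "body \<sigma> = convex hull (vertices \<sigma>)"

definition small_simplices :: "nat \<Rightarrow> 'a::euclidean_space osimplex set" where
  "small_simplices k = {\<sigma> \<in> oriented_simplices k. diameter (body \<sigma>) \<le> 1}"

text \<open>Two ordered \<open>k\<close>-simplices in the same \<open>k\<close>-plane have the same orientation if the change
  of basis between their edge vectors at the first vertex has positive determinant.\<close>

definition same_orientation :: "nat \<Rightarrow> 'a::euclidean_space list \<Rightarrow> 'a list \<Rightarrow> bool" where
  "same_orientation k vs ws \<longleftrightarrow>
    affine hull (set vs) = affine hull (set ws) \<and>
    (\<exists>M :: real mat. M \<in> carrier_mat k k \<and> 0 < Determinant.det M \<and>
      (\<forall>j<k. ws ! Suc j - ws ! 0 = (\<Sum>i<k. (M $$ (i, j)) *\<^sub>R (vs ! Suc i - vs ! 0))))"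

definition oriented_as :: "nat \<Rightarrow> 'a::euclidean_space osimplex \<Rightarrow> 'a osimplex \<Rightarrow> bool" where
  "oriented_as k \<tau> \<sigma> \<longleftrightarrow> (\<exists>ws\<in>\<tau>. \<exists>vs\<in>\<sigma>. same_orientation k vs ws)"

definition subdivision :: "nat \<Rightarrow> 'a::euclidean_space osimplex \<Rightarrow> 'a osimplex set \<Rightarrow> bool" where
  "subdivision k \<sigma> K \<longleftrightarrow>
    finite K \<and> K \<subseteq> oriented_simplices k \<and>
    (\<forall>\<tau>\<in>K. oriented_as k \<tau> \<sigma>) \<and>
    (\<forall>\<tau>\<in>K. \<forall>\<tau>'\<in>K. \<tau> \<noteq> \<tau>' \<longrightarrow> hausdorff_measure k (body \<tau> \<inter> body \<tau>') = 0) \<and>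
    (\<Union>\<tau>\<in>K. body \<tau>) = body \<sigma>"

section \<open>Chains and the boundary\<close>

type_synonym 'a chain = "('a osimplex \<Rightarrow>\<^sub>0 int) set"

abbreviation free_chains :: "nat \<Rightarrow> ('a::euclidean_space osimplex \<Rightarrow>\<^sub>0 int) monoid" where
  "free_chains k \<equiv> free_Abelian_group (oriented_simplices k)"

definition relators :: "nat \<Rightarrow> ('a::euclidean_space osimplex \<Rightarrow>\<^sub>0 int) set" where
  "relators k =
    {frag_of (oriented vs) + frag_of (oriented (permute_list p vs)) |vs p.
       vs \<in> ordered_simplices k \<and> p permutes {..<Suc k} \<and> \<not> evenperm p} \<union>
    {frag_of \<sigma> - (\<Sum>\<tau>\<in>K. frag_of \<tau>) |\<sigma> K. \<sigma> \<in> oriented_simplices k \<and> subdivision k \<sigma> K}"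

definition chain_relations :: "nat \<Rightarrow> ('a::euclidean_space osimplex \<Rightarrow>\<^sub>0 int) set" where
  "chain_relations k = generate (free_chains k) (relators k)"

text \<open>The group of chains, in multiplicative notation. Its elements are cosets, so for a chain
  \<open>X\<close> the formal sums representing \<open>X\<close> are exactly the elements of \<open>X\<close>.\<close>

definition chain_group :: "nat \<Rightarrow> 'a::euclidean_space chain monoid" where
  "chain_group k = free_chains k Mod chain_relations k"

definition chain_class :: "nat \<Rightarrow> ('a::euclidean_space osimplex \<Rightarrow>\<^sub>0 int) \<Rightarrow> 'a chain" where
  "chain_class k c = chain_relations k #>\<^bsub>free_chains k\<^esub> c"

definition chain_diff :: "nat \<Rightarrow> 'a::euclidean_space chain \<Rightarrow> 'a chain \<Rightarrow> 'a chain" where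
  "chain_diff k X Y = X \<otimes>\<^bsub>chain_group k\<^esub> inv\<^bsub>chain_group k\<^esub> Y"

definition formal_boundary :: "'a list \<Rightarrow> 'a osimplex \<Rightarrow>\<^sub>0 int" where
  "formal_boundary vs =
    (\<Sum>i<length vs. frag_cmul ((- 1) ^ i) (frag_of (oriented (take i vs @ drop (Suc i) vs))))"

text \<open>The boundary homomorphism from degree \<open>Suc k\<close> to degree \<open>k\<close>. It is unique because the
  simplices generate. The formal boundary depends on the ordering of the vertices even among
  orderings of the same orientation; only its class does not. The existence of the homomorphism (compatibility with subdivisions)
  is a geometric fact that is not proved in this theory.\<close>

definition boundary :: "nat \<Rightarrow> 'a::euclidean_space chain \<Rightarrow> 'a chain" where
  "boundary k = (THE f. f \<in> hom (chain_group (Suc k)) (chain_group k) \<and>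
     f \<in> extensional (carrier (chain_group (Suc k))) \<and>
     (\<forall>vs\<in>ordered_simplices (Suc k).
        f (chain_class (Suc k) (frag_of (oriented vs))) = chain_class k (formal_boundary vs)))"

section \<open>Mass\<close>

definition boundary_faces :: "'a::euclidean_space osimplex \<Rightarrow> 'a set set" where
  "boundary_faces \<sigma> = {convex hull (vertices \<sigma> - {v}) |v. v \<in> vertices \<sigma>}"

definition height :: "'a::euclidean_space osimplex \<Rightarrow> real" where
  "height \<sigma> = (MIN F\<in>boundary_faces \<sigma>. SUP x\<in>body \<sigma>. infdist x (affine hull F))"

definition simplex_mass :: "nat \<Rightarrow> ereal \<Rightarrow> 'a::euclidean_space osimplex \<Rightarrow> ennreal" where
  "simplex_mass k \<alpha> \<sigma> =
    (if \<alpha> = 0 then 1 else if \<alpha> = \<infinity> then 0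
     else MAX F\<in>boundary_faces \<sigma>.
       hausdorff_measure (k - 1) F * ennreal (height \<sigma> powr real_of_ereal \<alpha>))"

section \<open>Cochains\<close>

type_synonym 'a cochain = "'a chain \<Rightarrow> real"

definition cochains :: "nat \<Rightarrow> 'a::euclidean_space cochain set" where
  "cochains k = {A \<in> extensional (carrier (chain_group k)).
     (\<forall>X\<in>carrier (chain_group k). \<forall>Y\<in>carrier (chain_group k).
        A (X \<otimes>\<^bsub>chain_group k\<^esub> Y) = A X + A Y) \<and>
     (\<lambda>v. A (chain_class k (frag_of (oriented (map v [0..<Suc k])))))
       \<in> borel_measurable (restrict_space (\<Pi>\<^sub>M i\<in>{..k}. borel)
           {v. map v [0..<Suc k] \<in> ordered_simplices k})}"

definition coboundary :: "nat \<Rightarrow> 'a::euclidean_space cochain \<Rightarrow> 'a cochain" where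
  "coboundary k A = (\<lambda>Z\<in>carrier (chain_group (Suc k)). A (boundary k Z))"

definition cochain_norm :: "nat \<Rightarrow> ereal \<Rightarrow> 'a::euclidean_space cochain \<Rightarrow> ennreal" where
  "cochain_norm k \<alpha> A =
    (if \<alpha> = \<infinity> then (if \<forall>X\<in>carrier (chain_group k). A X = 0 then 0 else \<infinity>)
     else SUP \<sigma>\<in>small_simplices k.
       ennreal \<bar>A (chain_class k (frag_of \<sigma>))\<bar> / simplex_mass k \<alpha> \<sigma>)"

definition cochain_norm2 :: "nat \<Rightarrow> ereal \<Rightarrow> ereal \<Rightarrow> 'a::euclidean_space cochain \<Rightarrow> ennreal" where
  "cochain_norm2 k \<alpha> \<beta> A = cochain_norm k \<alpha> A + cochain_norm (Suc k) \<beta> (coboundary k A)"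

definition bounded_cochains :: "nat \<Rightarrow> ereal \<Rightarrow> ereal \<Rightarrow> 'a::euclidean_space cochain set" where
  "bounded_cochains k \<alpha> \<beta> = {A \<in> cochains k. cochain_norm2 k \<alpha> \<beta> A < \<infinity>}"

definition cochain_dist ::
    "nat \<Rightarrow> ereal \<Rightarrow> ereal \<Rightarrow> 'a::euclidean_space cochain \<Rightarrow> 'a cochain \<Rightarrow> ennreal" where
  "cochain_dist k \<alpha> \<beta> A B =
    cochain_norm2 k \<alpha> \<beta> (\<lambda>X\<in>carrier (chain_group k). A X - B X)"

section \<open>The flat norm\<close>

text \<open>Collecting repeated simplices in a formal sum does not increase its mass, so the infimum may
  be taken over the reduced representatives \<open>c \<in> X\<close>.\<close>

definition chain_mass :: "nat \<Rightarrow> ereal \<Rightarrow> 'a::euclidean_space chain \<Rightarrow> ennreal" where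
  "chain_mass k \<alpha> X =
    (INF c\<in>{c \<in> X. Poly_Mapping.keys c \<subseteq> small_simplices k}.
      \<Sum>\<sigma>\<in>Poly_Mapping.keys c.
        ennreal (real_of_int \<bar>Poly_Mapping.lookup c \<sigma>\<bar>) * simplex_mass k \<alpha> \<sigma>)"

definition flat_norm :: "nat \<Rightarrow> ereal \<Rightarrow> ereal \<Rightarrow> 'a::euclidean_space chain \<Rightarrow> ennreal" where
  "flat_norm k \<alpha> \<beta> X =
    (INF Z\<in>carrier (chain_group (Suc k)).
      chain_mass k \<alpha> (chain_diff k X (boundary k Z)) + chain_mass (Suc k) \<beta> Z)"

definition flat_dist ::
    "nat \<Rightarrow> ereal \<Rightarrow> ereal \<Rightarrow> 'a::euclidean_space chain \<Rightarrow> 'a chain \<Rightarrow> ennreal" where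
  "flat_dist k \<alpha> \<beta> X Y = flat_norm k \<alpha> \<beta> (chain_diff k X Y)"

section \<open>Topology and completion of a pseudo-metric\<close>

text \<open>Distances are \<open>ennreal\<close>-valued, and distance zero does not imply equality, so the
  library's metric spaces do not apply directly.\<close>

definition dist_topology :: "'b set \<Rightarrow> ('b \<Rightarrow> 'b \<Rightarrow> ennreal) \<Rightarrow> 'b topology" where
  "dist_topology M d =
    topology (\<lambda>U. U \<subseteq> M \<and> (\<forall>x\<in>U. \<exists>e>0. \<forall>y\<in>M. d x y < e \<longrightarrow> y \<in> U))"

lemma openin_dist_topology:
  "openin (dist_topology M d) U \<longleftrightarrow> U \<subseteq> M \<and> (\<forall>x\<in>U. \<exists>e>0. \<forall>y\<in>M. d x y < e \<longrightarrow> y \<in> U)"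
proof -
  have "istopology (\<lambda>U. U \<subseteq> M \<and> (\<forall>x\<in>U. \<exists>e>0. \<forall>y\<in>M. d x y < e \<longrightarrow> y \<in> U))"
    unfolding istopology_def
  proof (intro conjI allI impI ballI)
    fix S T x
    assume S: "S \<subseteq> M \<and> (\<forall>x\<in>S. \<exists>e>0. \<forall>y\<in>M. d x y < e \<longrightarrow> y \<in> S)"
      and T: "T \<subseteq> M \<and> (\<forall>x\<in>T. \<exists>e>0. \<forall>y\<in>M. d x y < e \<longrightarrow> y \<in> T)" and x: "x \<in> S \<inter> T"
    obtain e where e: "e > 0" "\<forall>y\<in>M. d x y < e \<longrightarrow> y \<in> S" using S x by blast
    obtain e' where e': "e' > 0" "\<forall>y\<in>M. d x y < e' \<longrightarrow> y \<in> T" using T x by blast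
    show "\<exists>e>0. \<forall>y\<in>M. d x y < e \<longrightarrow> y \<in> S \<inter> T"
      using e e' by (intro exI[of _ "min e e'"]) auto
  next
    fix \<K> x
    assume K: "\<forall>S\<in>\<K>. S \<subseteq> M \<and> (\<forall>x\<in>S. \<exists>e>0. \<forall>y\<in>M. d x y < e \<longrightarrow> y \<in> S)" and x: "x \<in> \<Union>\<K>"
    then obtain S where S: "S \<in> \<K>" "x \<in> S" by blast
    then obtain e where "e > 0" "\<forall>y\<in>M. d x y < e \<longrightarrow> y \<in> S" using K by blast
    with S show "\<exists>e>0. \<forall>y\<in>M. d x y < e \<longrightarrow> y \<in> \<Union>\<K>" by blast
  qed auto
  then show ?thesis
    unfolding dist_topology_def by (simp add: topology_inverse')
qed

definition cauchy_seqs :: "'b set \<Rightarrow> ('b \<Rightarrow> 'b \<Rightarrow> ennreal) \<Rightarrow> (nat \<Rightarrow> 'b) set" where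
  "cauchy_seqs M d = {s. range s \<subseteq> M \<and> (\<forall>e>0. \<exists>N. \<forall>m\<ge>N. \<forall>n\<ge>N. d (s m) (s n) < e)}"

definition cauchy_rel :: "'b set \<Rightarrow> ('b \<Rightarrow> 'b \<Rightarrow> ennreal) \<Rightarrow> ((nat \<Rightarrow> 'b) \<times> (nat \<Rightarrow> 'b)) set" where
  "cauchy_rel M d = {(s, t). s \<in> cauchy_seqs M d \<and> t \<in> cauchy_seqs M d \<and>
     (\<lambda>n. d (s n) (t n)) \<longlonglongrightarrow> 0}"

definition completion :: "'b set \<Rightarrow> ('b \<Rightarrow> 'b \<Rightarrow> ennreal) \<Rightarrow> (nat \<Rightarrow> 'b) set set" where
  "completion M d = cauchy_seqs M d // cauchy_rel M d"

definition completion_dist ::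
    "('b \<Rightarrow> 'b \<Rightarrow> ennreal) \<Rightarrow> (nat \<Rightarrow> 'b) set \<Rightarrow> (nat \<Rightarrow> 'b) set \<Rightarrow> ennreal" where
  "completion_dist d P Q = (THE l. \<forall>s\<in>P. \<forall>t\<in>Q. (\<lambda>n. d (s n) (t n)) \<longlonglongrightarrow> l)"

definition completion_embed ::
    "'b set \<Rightarrow> ('b \<Rightarrow> 'b \<Rightarrow> ennreal) \<Rightarrow> 'b \<Rightarrow> (nat \<Rightarrow> 'b) set" where
  "completion_embed M d x = cauchy_rel M d `` {\<lambda>_. x}"

definition flat_completion_topology ::
    "nat \<Rightarrow> ereal \<Rightarrow> ereal \<Rightarrow> (nat \<Rightarrow> 'a::euclidean_space chain) set topology" where
  "flat_completion_topology k \<alpha> \<beta> =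
    dist_topology (completion (carrier (chain_group k)) (flat_dist k \<alpha> \<beta>))
      (completion_dist (flat_dist k \<alpha> \<beta>))"

definition cochain_topology ::
    "nat \<Rightarrow> ereal \<Rightarrow> ereal \<Rightarrow> 'a::euclidean_space cochain topology" where
  "cochain_topology k \<alpha> \<beta> = dist_topology (bounded_cochains k \<alpha> \<beta>) (cochain_dist k \<alpha> \<beta>)"

end

theory Submission
  imports Defs
begin

text \<open>Since \<open>A X = A (X - \<partial>Z) + (\<partial>A) Z\<close> for every \<open>Z\<close>, a cochain is bounded on \<open>X\<close> by the product of
  its norm with the flat norm of \<open>X\<close>. Flat norms are finite, because every simplex can be bisected into
  small ones, so the pairing is locally Lipschitz in both arguments and extends to the completion.

  The estimate requires that \<open>\<partial>\<close> exists. Bisecting an edge is a subdivision for which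
  compatibility with \<open>\<partial>\<close> is immediate. Modulo these bisections (and orientation and degenerate
  simplices), a chain in an \<open>n\<close>-plane whose signed indicator vanishes at generic points is
  null: it is the cone over its boundary, and the part of its boundary in a
  hyperplane \<open>H\<close> again has vanishing indicator, being the jump of the indicator across \<open>H\<close>. By induction on
  the dimension, the boundary of any subdivision relation is a consequence of bisections.\<close>

section \<open>Orientation determinants\<close>

text \<open>The defining relations of chains admit arbitrary finite subdivisions, whose pieces need
  not meet face to face: a facet of one piece can be covered by parts of facets of several others,
  so the boundary of a subdivision relator is not visibly a combination of relators. Signed
  indicators at generic points do not see how pieces meet, and the exceptional sets are finitely
  many planes of lower dimension, a condition that survives the passage to facets. Coning from a
  point of the plane produces degenerate simplices, so the induction runs in the free group on
  vertex lists and returns to oriented simplices only afterwards. Hausdorff measure enters in three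
  ways: positivity on overlapping interiors makes a generic point lie in one piece only, vanishing
  on simplices of lower dimension makes a bisection a subdivision, and finiteness on faces keeps
  masses finite. The constants of joint continuity are local: near a pair \<open>(P, A)\<close> they
  come from the norm of \<open>A\<close> and from a bound for the flat norm along a Cauchy sequence
  representing \<open>P\<close>.\<close>

definition facet :: "nat \<Rightarrow> 'a list \<Rightarrow> 'a list" where
  "facet i ws = take i ws @ drop (Suc i) ws"

lemma length_facet [simp]: "i < length ws \<Longrightarrow> length (facet i ws) = length ws - 1"
  by (simp add: facet_def)

lemma nth_facet:
  "i < length ws \<Longrightarrow> j < length ws - 1 \<Longrightarrow> facet i ws ! j = ws ! (if j < i then j else Suc j)"
  by (auto simp: facet_def nth_append min_def)

lemma set_facet:
  assumes "i < length ws"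
  shows "set (facet i ws) = {ws ! j |j. j < length ws \<and> j \<noteq> i}"
proof -
  have "set (facet i ws) = {facet i ws ! j |j. j < length ws - 1}"
    using assms by (simp add: set_conv_nth)
  also have "\<dots> = {ws ! j |j. j < length ws \<and> j \<noteq> i}"
  proof (rule equalityI; rule subsetI)
    fix x assume "x \<in> {facet i ws ! j |j. j < length ws - 1}"
    then obtain j where "x = facet i ws ! j" "j < length ws - 1" by blast
    then show "x \<in> {ws ! j |j. j < length ws \<and> j \<noteq> i}"
      using assms by (intro CollectI exI[of _ "if j < i then j else Suc j"]) (auto simp: nth_facet)
  next
    fix x assume "x \<in> {ws ! j |j. j < length ws \<and> j \<noteq> i}"
    then obtain j where "x = ws ! j" "j < length ws" "j \<noteq> i" by blast
    then show "x \<in> {facet i ws ! j |j. j < length ws - 1}"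
      using assms by (intro CollectI exI[of _ "if j < i then j else j - 1"]) (auto simp: nth_facet)
  qed
  finally show ?thesis .
qed

text \<open>Each row holds the homogeneous coordinates of a vertex under the functionals in
  \<open>B\<close>; the determinant is a factorial times the signed volume of the image of the
  simplex. If the functionals are dependent on the plane of the simplex, it is 0 for all simplices
  of that plane.\<close>

definition orient_mat :: "'a::euclidean_space list \<Rightarrow> 'a list \<Rightarrow> real mat" where
  "orient_mat B ws = Matrix.mat (Suc (length B)) (Suc (length B))
     (\<lambda>(i, j). if j = 0 then 1 else inner (ws ! i) (B ! (j - 1)))"

definition orient_det :: "'a::euclidean_space list \<Rightarrow> 'a list \<Rightarrow> real" where
  "orient_det B ws = Determinant.det (orient_mat B ws)"

lemma orient_mat_carrier [simp]:
  "orient_mat B ws \<in> carrier_mat (Suc (length B)) (Suc (length B))"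
  by (simp add: orient_mat_def)

lemma orient_mat_dim [simp]:
  "dim_row (orient_mat B ws) = Suc (length B)" "dim_col (orient_mat B ws) = Suc (length B)"
  by (simp_all add: orient_mat_def)

lemma orient_det_permute:
  assumes "p permutes {..<Suc (length B)}" "length ws = Suc (length B)"
  shows "orient_det B (permute_list p ws) = sign p * orient_det B ws"
proof -
  have p: "p permutes {0..<Suc (length B)}"
    using assms(1) by (simp add: lessThan_atLeast0)
  have lt: "p i < Suc (length B)" if "i < Suc (length B)" for i
    using permutes_in_image[OF assms(1), of i] that by simp
  have "orient_mat B (permute_list p ws)
      = Matrix.mat (Suc (length B)) (Suc (length B)) (\<lambda>(i, j). orient_mat B ws $$ (p i, j))"
    using assms by (intro eq_matI) (auto simp: orient_mat_def lt permute_list_nth)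
  then show ?thesis
    unfolding orient_det_def
    using det_permute_rows[OF orient_mat_carrier p, of ws] by simp
qed

text \<open>The coefficients sum to 1, so the column of ones is kept and row \<open>i\<close>
  becomes a combination of rows \<open>i\<close> and \<open>j\<close>. The part along row
  \<open>j\<close> does not change the determinant.\<close>

lemma orient_det_split:
  assumes ws: "length ws = Suc (length B)" and i: "i < length ws" and j: "j < length ws" "i \<noteq> j"
  shows "orient_det B (ws[i := (1 - t) *\<^sub>R ws ! i + t *\<^sub>R ws ! j]) = (1 - t) * orient_det B ws"
proof -
  let ?n = "Suc (length B)"
  have "orient_mat B (ws[i := (1 - t) *\<^sub>R ws ! i + t *\<^sub>R ws ! j])
     = addrow t i j (multrow i (1 - t) (orient_mat B ws))"
    using assms
    by (intro eq_matI)
       (auto simp: orient_mat_def nth_list_update inner_add_left mat_addrow_def mat_multrow_def)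
  then show ?thesis
    unfolding orient_det_def using assms
    by (simp add: det_addrow[of _ ?n] det_multrow[of _ ?n])
qed

text \<open>After subtracting \<open>c\<close> times the column of ones, the column of
  \<open>b\<close> has its only nonzero entry in row \<open>i\<close>. Expansion along it leaves the
  matrix of the facet; this column has index 1, whence the minus sign.\<close>

lemma orient_det_Cons:
  assumes ws: "length ws = length B + 2" and i: "i < length ws"
    and c: "\<And>j. j < length ws \<Longrightarrow> j \<noteq> i \<Longrightarrow> inner b (ws ! j) = c"
  shows "orient_det (b # B) ws = - ((- 1) ^ i * (inner b (ws ! i) - c) * orient_det B (facet i ws))"
proof -
  let ?n = "length B + 2"
  let ?A = "addcol (- c) 1 0 (orient_mat (b # B) ws)"
  have A: "?A \<in> carrier_mat ?n ?n" using orient_mat_carrier[of "b # B" ws] by auto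
  have ent: "?A $$ (j, 1) = (if j = i then inner b (ws ! i) - c else 0)" if "j < ?n" for j
    using that ws c[of j] by (auto simp: mat_addcol_def orient_mat_def inner_commute)
  have del: "mat_delete ?A i 1 = orient_mat B (facet i ws)"
    using i ws
    by (intro eq_matI) (auto simp: orient_mat_def mat_delete_def mat_addcol_def nth_facet)
  have "orient_det (b # B) ws = Determinant.det ?A"
    unfolding orient_det_def by (subst det_addcol[of 0 ?n]) auto
  also have "\<dots> = (\<Sum>j<?n. ?A $$ (j, 1) * cofactor ?A j 1)"
    by (rule laplace_expansion_column[OF A]) simp
  also have "\<dots> = (\<Sum>j<?n. if j = i then (inner b (ws ! i) - c) * cofactor ?A i 1 else 0)"
    by (rule sum.cong) (auto simp only: ent lessThan_iff mult_zero_left split: if_split)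
  also have "\<dots> = (inner b (ws ! i) - c) * cofactor ?A i 1"
    using i ws by simp
  also have "cofactor ?A i 1 = - ((- 1) ^ i * orient_det B (facet i ws))"
    unfolding cofactor_def del orient_det_def by simp
  finally show ?thesis by (simp add: algebra_simps)
qed

definition edge_mat :: "'a::euclidean_space list \<Rightarrow> 'a list \<Rightarrow> real mat" where
  "edge_mat B ws = Matrix.mat (length B) (length B)
     (\<lambda>(i, j). inner (ws ! Suc i - ws ! 0) (B ! j))"

text \<open>Subtracting the first row from the others is the factorisation \<open>L * U\<close> with
  \<open>L\<close> unipotent. The first column of \<open>U\<close> is a unit vector and the
  remaining block is the edge matrix.\<close>

lemma orient_det_edges: "orient_det B ws = Determinant.det (edge_mat B ws)"
proof -
  let ?k = "length B" and ?n = "Suc (length B)"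
  define L :: "real mat" where "L = Matrix.mat ?n ?n (\<lambda>(i, j). if j = 0 \<or> i = j then 1 else 0)"
  define U :: "real mat" where "U = Matrix.mat ?n ?n
     (\<lambda>(i, j). if i = 0 then orient_mat B ws $$ (0, j) else
        if j = 0 then 0 else inner (ws ! i - ws ! 0) (B ! (j - 1)))"
  have L: "L \<in> carrier_mat ?n ?n" and U: "U \<in> carrier_mat ?n ?n" by (simp_all add: L_def U_def)
  have "orient_mat B ws = L * U"
  proof (intro eq_matI)
    fix i j assume "i < dim_row (L * U)" "j < dim_col (L * U)"
    then have ij: "i < ?n" "j < ?n" using L U by auto
    have "(L * U) $$ (i, j) = (\<Sum>l\<in>{0..<?n}. L $$ (i, l) * U $$ (l, j))"
      using ij L U by (simp add: scalar_prod_def L_def U_def)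
    also have "\<dots> = (\<Sum>l\<in>{0..<?n}. (if l = 0 then U $$ (0, j) else 0) + (if l = i \<and> i \<noteq> 0 then U $$ (i, j) else 0))"
      using ij by (intro sum.cong) (auto simp: L_def)
    also have "\<dots> = U $$ (0, j) + (if i \<noteq> 0 then U $$ (i, j) else 0)"
      using ij by (auto simp: sum.distrib simp del: sum.atLeastLessThan_Suc sum.op_ivl_Suc)
    finally show "orient_mat B ws $$ (i, j) = (L * U) $$ (i, j)"
      using ij by (auto simp: U_def orient_mat_def inner_diff_left)
  qed (auto simp: L_def U_def)
  moreover have "Determinant.det L = 1"
  proof -
    have "diag_mat L = replicate ?n 1"
      by (auto simp: diag_mat_def L_def simp del: upt_Suc replicate_Suc intro!: nth_equalityI)
    moreover have "Determinant.det L = prod_list (diag_mat L)"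
      by (rule det_lower_triangular[OF _ L]) (auto simp: L_def)
    ultimately show ?thesis by simp
  qed
  moreover have "Determinant.det U = Determinant.det (edge_mat B ws)"
  proof -
    have "Determinant.det U = (\<Sum>i<?n. U $$ (i, 0) * cofactor U i 0)"
      by (rule laplace_expansion_column[OF U]) simp
    also have "\<dots> = (\<Sum>i<?n. if i = 0 then cofactor U 0 0 else 0)"
      by (rule sum.cong) (auto simp: U_def orient_mat_def)
    also have "\<dots> = Determinant.det (mat_delete U 0 0)" by (simp add: cofactor_def)
    also have "mat_delete U 0 0 = edge_mat B ws"
      by (intro eq_matI) (auto simp: mat_delete_def U_def edge_mat_def)
    finally show ?thesis .
  qed
  ultimately show ?thesis unfolding orient_det_def by (simp add: det_mult[OF L U])
qed

text \<open>The edge matrices differ by the factor \<open>transpose_mat M\<close>, the same for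
  every \<open>B\<close>; one change of basis therefore compares the signs for all \<open>B\<close>
  at once.\<close>

lemma orient_det_change_of_basis:
  assumes M: "M \<in> carrier_mat (length B) (length B)"
    and e: "\<And>j. j < length B \<Longrightarrow>
      ws ! Suc j - ws ! 0 = (\<Sum>i<length B. (M $$ (i, j)) *\<^sub>R (vs ! Suc i - vs ! 0))"
  shows "orient_det B ws = Determinant.det M * orient_det B vs"
proof -
  let ?k = "length B"
  have E: "edge_mat B v \<in> carrier_mat ?k ?k" for v :: "'a list" by (simp add: edge_mat_def)
  have "edge_mat B ws = transpose_mat M * edge_mat B vs"
  proof (intro eq_matI)
    fix i j assume "i < dim_row (transpose_mat M * edge_mat B vs)"
      "j < dim_col (transpose_mat M * edge_mat B vs)"
    then have ij: "i < ?k" "j < ?k" using M by (auto simp: edge_mat_def)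
    have "edge_mat B ws $$ (i, j) = inner (\<Sum>l<?k. (M $$ (l, i)) *\<^sub>R (vs ! Suc l - vs ! 0)) (B ! j)"
      using ij e[of i] by (simp add: edge_mat_def)
    also have "\<dots> = (\<Sum>l<?k. M $$ (l, i) * inner (vs ! Suc l - vs ! 0) (B ! j))"
      by (simp add: inner_sum_left)
    also have "\<dots> = (transpose_mat M * edge_mat B vs) $$ (i, j)"
      using ij M by (auto simp: scalar_prod_def edge_mat_def lessThan_atLeast0)
    finally show "edge_mat B ws $$ (i, j) = (transpose_mat M * edge_mat B vs) $$ (i, j)" .
  qed (use M in \<open>auto simp: edge_mat_def\<close>)
  then show ?thesis
    unfolding orient_det_edges using M E[of vs]
    by (simp add: det_mult[of _ ?k] det_transpose)
qed

section \<open>Barycentric coordinates\<close>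

lemma affine_hull_image:
  fixes f :: "'i \<Rightarrow> 'a::real_vector"
  assumes "finite A" "inj_on f A"
  shows "affine hull (f ` A) = {\<Sum>i\<in>A. u i *\<^sub>R f i |u. sum u A = 1}"
proof (rule equalityI; rule subsetI)
  fix x assume "x \<in> affine hull (f ` A)"
  then obtain u where "sum u (f ` A) = 1" "(\<Sum>v\<in>f ` A. u v *\<^sub>R v) = x"
    using affine_hull_finite[of "f ` A"] assms(1) by auto
  then show "x \<in> {\<Sum>i\<in>A. u i *\<^sub>R f i |u. sum u A = 1}"
    using assms(2) by (intro CollectI exI[of _ "u \<circ> f"]) (simp add: sum.reindex)
next
  fix x assume "x \<in> {\<Sum>i\<in>A. u i *\<^sub>R f i |u. sum u A = 1}"
  then obtain u where u: "sum u A = 1" "x = (\<Sum>i\<in>A. u i *\<^sub>R f i)" by blast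
  have "(\<Sum>v\<in>f ` A. u (the_inv_into A f v) *\<^sub>R v) = x" "(\<Sum>v\<in>f ` A. u (the_inv_into A f v)) = 1"
    using u assms(2) by (simp_all add: sum.reindex the_inv_into_f_f)
  then show "x \<in> affine hull (f ` A)"
    using affine_hull_finite[of "f ` A"] assms(1) by auto
qed

lemma convex_hull_image:
  fixes f :: "'i \<Rightarrow> 'a::real_vector"
  assumes "finite A" "inj_on f A"
  shows "convex hull (f ` A) = {\<Sum>i\<in>A. u i *\<^sub>R f i |u. sum u A = 1 \<and> (\<forall>i\<in>A. 0 \<le> u i)}"
proof (rule equalityI; rule subsetI)
  fix x assume "x \<in> convex hull (f ` A)"
  then obtain u where "\<forall>v\<in>f ` A. 0 \<le> u v" "sum u (f ` A) = 1" "(\<Sum>v\<in>f ` A. u v *\<^sub>R v) = x"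
    using convex_hull_finite[of "f ` A"] assms(1) by auto
  then show "x \<in> {\<Sum>i\<in>A. u i *\<^sub>R f i |u. sum u A = 1 \<and> (\<forall>i\<in>A. 0 \<le> u i)}"
    using assms(2) by (intro CollectI exI[of _ "u \<circ> f"]) (simp add: sum.reindex)
next
  fix x assume "x \<in> {\<Sum>i\<in>A. u i *\<^sub>R f i |u. sum u A = 1 \<and> (\<forall>i\<in>A. 0 \<le> u i)}"
  then obtain u where u: "sum u A = 1" "\<forall>i\<in>A. 0 \<le> u i" "x = (\<Sum>i\<in>A. u i *\<^sub>R f i)" by blast
  have "(\<Sum>v\<in>f ` A. u (the_inv_into A f v) *\<^sub>R v) = x" "(\<Sum>v\<in>f ` A. u (the_inv_into A f v)) = 1"
    "\<forall>v\<in>f ` A. 0 \<le> u (the_inv_into A f v)"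
    using u assms(2) by (simp_all add: sum.reindex the_inv_into_f_f)
  then show "x \<in> convex hull (f ` A)"
    using convex_hull_finite[of "f ` A"] assms(1) by auto
qed

lemma length_ordered_simplex: "w \<in> ordered_simplices n \<Longrightarrow> length w = Suc n"
  by (simp add: ordered_simplices_def)

lemma inj_on_nth_ordered_simplex:
  "w \<in> ordered_simplices n \<Longrightarrow> A \<subseteq> {..n} \<Longrightarrow> inj_on ((!) w) A"
  by (rule inj_on_nth) (auto simp: ordered_simplices_def)

lemma set_conv_image_nth: "length w = Suc n \<Longrightarrow> set w = (!) w ` {..n}"
  by (auto simp: set_conv_nth less_Suc_eq_le)

lemma set_facet_conv_image: "length w = Suc n \<Longrightarrow> i \<le> n \<Longrightarrow> set (facet i w) = (!) w ` ({..n} - {i})"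
  by (auto simp: set_facet less_Suc_eq_le)

text \<open>The edges at \<open>w ! 0\<close> are independent, so functionals dual to them exist;
  the adjoint writes them as inner products. The coordinate of index 0 is 1 minus the sum of the
  others.\<close>

lemma barycentric_exists:
  fixes w :: "'a::euclidean_space list"
  assumes w: "w \<in> ordered_simplices n"
  obtains c :: "nat \<Rightarrow> real" and g :: "nat \<Rightarrow> 'a"
  where "\<And>i j. i \<le> n \<Longrightarrow> j \<le> n \<Longrightarrow> c i + inner (g i) (w ! j) = (if i = j then 1 else 0)"
proof -
  define S where "S = (\<lambda>x. - (w ! 0) + x) ` (set w - {w ! 0})"
  have len: "length w = Suc n" and dist: "distinct w" and aff: "\<not> affine_dependent (set w)"
    using w by (auto simp: ordered_simplices_def)
  have "w ! 0 \<in> set w" using len by simp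
  then have "\<not> affine_dependent (insert (w ! 0) (set w - {w ! 0}))"
    using aff by (simp add: insert_absorb)
  then have S: "independent S"
    unfolding S_def by (subst (asm) affine_dependent_iff_dependent) auto
  have "\<exists>h. \<forall>j\<le>n. inner h (w ! j - w ! 0) = (if i = j then 1 else 0)" if "i \<in> {1..n}" for i
  proof -
    obtain f :: "'a \<Rightarrow> real" where f: "linear f"
      "\<forall>x\<in>S. f x = (if x = w ! i - w ! 0 then 1 else 0)"
      using linear_independent_extend[OF S, of "\<lambda>x. if x = w ! i - w ! 0 then 1 else 0"] by blast
    have *: "inner (adjoint f 1) x = f x" for x
      using adjoint_works[OF f(1), of x 1] by (simp add: inner_commute)
    have "inner (adjoint f 1) (w ! j - w ! 0) = (if i = j then 1 else 0)" if "j \<le> n" for j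
    proof (cases "j = 0")
      case True
      then show ?thesis using \<open>i \<in> {1..n}\<close> by simp
    next
      case False
      then have "w ! j \<noteq> w ! 0" using dist len that by (simp add: nth_eq_iff_index_eq)
      then have "w ! j - w ! 0 \<in> S" using that len by (auto simp: S_def)
      moreover have "w ! j = w ! i \<longleftrightarrow> i = j"
        using dist len that \<open>i \<in> {1..n}\<close> by (auto simp: nth_eq_iff_index_eq)
      ultimately show ?thesis using f(2) * by auto
    qed
    then show ?thesis by blast
  qed
  then obtain h where h: "\<And>i j. i \<in> {1..n} \<Longrightarrow> j \<le> n \<Longrightarrow> inner (h i) (w ! j - w ! 0) = (if i = j then 1 else 0)"
    by metis
  define c where "c i = (if i = 0 then 1 + (\<Sum>l=1..n. inner (h l) (w ! 0)) else - inner (h i) (w ! 0))" for i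
  define g where "g i = (if i = 0 then - (\<Sum>l=1..n. h l) else h i)" for i
  show thesis
  proof
    fix i j assume ij: "i \<le> n" "j \<le> n"
    show "c i + inner (g i) (w ! j) = (if i = j then 1 else 0)"
    proof (cases "i = 0")
      case True
      have "c i + inner (g i) (w ! j) = 1 - (\<Sum>l=1..n. inner (h l) (w ! j - w ! 0))"
        using True by (simp add: c_def g_def inner_sum_left inner_diff_right sum_subtractf)
      also have "(\<Sum>l=1..n. inner (h l) (w ! j - w ! 0)) = (\<Sum>l=1..n. if l = j then 1 else 0)"
        using ij by (intro sum.cong) (auto simp: h)
      also have "\<dots> = (if j = 0 then 0 else 1)" using ij by auto
      finally show ?thesis using True by auto
    next
      case False
      then show ?thesis using h[of i j] ij by (simp add: c_def g_def inner_diff_right)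
    qed
  qed
qed

text \<open>The coordinates are affine functions on the whole space, fixed only up to choice off the
  plane of \<open>w\<close>. The affine form is demanded for every index, which spares side
  conditions.\<close>

definition bary :: "'a::euclidean_space list \<Rightarrow> nat \<Rightarrow> 'a \<Rightarrow> real" where
  "bary w = (SOME b. (\<exists>c g. \<forall>i x. b i x = c i + inner (g i) x) \<and>
     (\<forall>i<length w. \<forall>j<length w. b i (w ! j) = (if i = j then 1 else 0)))"

context
  fixes w :: "'a::euclidean_space list" and n :: nat
  assumes w: "w \<in> ordered_simplices n"
begin

lemma bary_spec:
  "(\<exists>c g. \<forall>i x. bary w i x = c i + inner (g i) x) \<and>
     (\<forall>i<length w. \<forall>j<length w. bary w i (w ! j) = (if i = j then 1 else 0))"
proof -
  obtain c :: "nat \<Rightarrow> real" and g :: "nat \<Rightarrow> 'a"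
    where cg: "\<And>i j. i \<le> n \<Longrightarrow> j \<le> n \<Longrightarrow> c i + inner (g i) (w ! j) = (if i = j then 1 else 0)"
    using barycentric_exists[OF w] by blast
  show ?thesis
    unfolding bary_def
    by (rule someI[of _ "\<lambda>i x. c i + inner (g i) x"]) (use cg length_ordered_simplex[OF w] in auto)
qed

lemma bary_form: obtains c g where "\<And>i x. bary w i x = c i + inner (g i) x"
  using bary_spec by blast

lemma bary_vertex: "i \<le> n \<Longrightarrow> j \<le> n \<Longrightarrow> bary w i (w ! j) = (if i = j then 1 else 0)"
  using bary_spec length_ordered_simplex[OF w] by simp

lemma continuous_on_bary [continuous_intros]:
  "continuous_on A f \<Longrightarrow> continuous_on A (\<lambda>x. bary w i (f x))"
proof -
  assume f: "continuous_on A f"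
  obtain c g where cg: "\<And>i x. bary w i x = c i + inner (g i) x" using bary_form by blast
  show ?thesis unfolding cg using f by (intro continuous_intros)
qed

lemma bary_affine_combination:
  assumes "sum u A = 1"
  shows "bary w i (\<Sum>j\<in>A. u j *\<^sub>R x j) = (\<Sum>j\<in>A. u j * bary w i (x j))"
proof -
  obtain c g where cg: "\<And>i x. bary w i x = c i + inner (g i) x" using bary_form by blast
  have "(\<Sum>j\<in>A. u j * bary w i (x j)) = c i * sum u A + inner (g i) (\<Sum>j\<in>A. u j *\<^sub>R x j)"
    by (simp add: cg inner_sum_right distrib_left sum.distrib sum_distrib_left mult.commute)
  then show ?thesis using assms by (simp add: cg)
qed

lemma bary_line: "bary w i ((1 - t) *\<^sub>R x + t *\<^sub>R y) = (1 - t) * bary w i x + t * bary w i y"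
proof -
  obtain c g where cg: "\<And>i x. bary w i x = c i + inner (g i) x" using bary_form by blast
  show ?thesis by (simp add: cg inner_add_right algebra_simps)
qed

lemma bary_combination:
  assumes "sum u {..n} = 1" "i \<le> n"
  shows "bary w i (\<Sum>j\<le>n. u j *\<^sub>R w ! j) = u i"
proof -
  have "(\<Sum>j\<le>n. u j * bary w i (w ! j)) = (\<Sum>j\<le>n. if j = i then u i else 0)"
    using assms by (intro sum.cong) (auto simp: bary_vertex)
  then show ?thesis using assms by (simp add: bary_affine_combination)
qed

lemma affine_hull_bary:
  assumes "x \<in> affine hull set w"
  shows "(\<Sum>i\<le>n. bary w i x) = 1" "(\<Sum>i\<le>n. bary w i x *\<^sub>R w ! i) = x"
proof -
  obtain u where u: "sum u {..n} = 1" "x = (\<Sum>i\<le>n. u i *\<^sub>R w ! i)"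
    using assms affine_hull_image[OF finite_atMost inj_on_nth_ordered_simplex[OF w order_refl]]
    by (auto simp: set_conv_image_nth[OF length_ordered_simplex[OF w]])
  have "bary w i x = u i" if "i \<le> n" for i using u bary_combination that by simp
  then show "(\<Sum>i\<le>n. bary w i x) = 1" "(\<Sum>i\<le>n. bary w i x *\<^sub>R w ! i) = x"
    using u by (auto simp del: sum.atMost_Suc)
qed

lemma combination_in_affine_hull:
  assumes "sum u {..n} = 1"
  shows "(\<Sum>j\<le>n. u j *\<^sub>R w ! j) \<in> affine hull set w"
  using assms affine_hull_image[OF finite_atMost inj_on_nth_ordered_simplex[OF w order_refl]]
  by (auto simp: set_conv_image_nth[OF length_ordered_simplex[OF w]])

lemma mem_convex_hull_iff_bary:
  "x \<in> convex hull set w \<longleftrightarrow> x \<in> affine hull set w \<and> (\<forall>i\<le>n. 0 \<le> bary w i x)"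
proof -
  have "x \<in> convex hull set w \<longleftrightarrow> (\<exists>u. x = (\<Sum>i\<le>n. u i *\<^sub>R w ! i) \<and> sum u {..n} = 1 \<and> (\<forall>i\<le>n. 0 \<le> u i))"
    using convex_hull_image[OF finite_atMost inj_on_nth_ordered_simplex[OF w order_refl]]
    by (auto simp: set_conv_image_nth[OF length_ordered_simplex[OF w]])
  also have "\<dots> \<longleftrightarrow> x \<in> affine hull set w \<and> (\<forall>i\<le>n. 0 \<le> bary w i x)"
  proof
    assume "\<exists>u. x = (\<Sum>i\<le>n. u i *\<^sub>R w ! i) \<and> sum u {..n} = 1 \<and> (\<forall>i\<le>n. 0 \<le> u i)"
    then obtain u where u: "x = (\<Sum>i\<le>n. u i *\<^sub>R w ! i)" "sum u {..n} = 1" "\<forall>i\<le>n. 0 \<le> u i"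
      by blast
    then show "x \<in> affine hull set w \<and> (\<forall>i\<le>n. 0 \<le> bary w i x)"
      using combination_in_affine_hull[of u] bary_combination[of u] by auto
  next
    assume x: "x \<in> affine hull set w \<and> (\<forall>i\<le>n. 0 \<le> bary w i x)"
    then show "\<exists>u. x = (\<Sum>i\<le>n. u i *\<^sub>R w ! i) \<and> sum u {..n} = 1 \<and> (\<forall>i\<le>n. 0 \<le> u i)"
      using affine_hull_bary[of x] by (intro exI[of _ "\<lambda>i. bary w i x"]) simp
  qed
  finally show ?thesis .
qed

lemma mem_affine_hull_facet_iff:
  assumes "i \<le> n"
  shows "x \<in> affine hull set (facet i w) \<longleftrightarrow> x \<in> affine hull set w \<and> bary w i x = 0"
proof -
  have *: "affine hull set (facet i w) = {\<Sum>j\<in>{..n} - {i}. u j *\<^sub>R w ! j |u. sum u ({..n} - {i}) = 1}"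
    using affine_hull_image[of "{..n} - {i}" "(!) w"] inj_on_nth_ordered_simplex[OF w]
    by (simp add: set_facet_conv_image[OF length_ordered_simplex[OF w] assms])
  show ?thesis
  proof
    assume "x \<in> affine hull set (facet i w)"
    then obtain u where u: "x = (\<Sum>j\<in>{..n} - {i}. u j *\<^sub>R w ! j)" "sum u ({..n} - {i}) = 1"
      using * by auto
    let ?u = "u(i := 0)"
    have "sum ?u {..n} = 1" "x = (\<Sum>j\<le>n. ?u j *\<^sub>R w ! j)"
      using u assms by (simp_all add: sum.remove[of _ i])
    then show "x \<in> affine hull set w \<and> bary w i x = 0"
      using combination_in_affine_hull bary_combination[of ?u i] assms by auto
  next
    assume x: "x \<in> affine hull set w \<and> bary w i x = 0"
    have s: "(\<Sum>j\<in>{..n} - {i}. bary w j x) = 1" "x = (\<Sum>j\<in>{..n} - {i}. bary w j x *\<^sub>R w ! j)"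
      using affine_hull_bary[of x] x assms by (simp_all add: sum.remove[of _ i])
    show "x \<in> affine hull set (facet i w)" unfolding *
      by (intro CollectI exI[of _ "\<lambda>j. bary w j x"]) (use s in auto)
  qed
qed

lemma mem_convex_hull_facet_iff:
  assumes "i \<le> n"
  shows "x \<in> convex hull set (facet i w) \<longleftrightarrow>
    x \<in> affine hull set w \<and> bary w i x = 0 \<and> (\<forall>j\<le>n. 0 \<le> bary w j x)"
proof -
  have *: "convex hull set (facet i w) =
    {\<Sum>j\<in>{..n} - {i}. u j *\<^sub>R w ! j |u. sum u ({..n} - {i}) = 1 \<and> (\<forall>j\<in>{..n} - {i}. 0 \<le> u j)}"
    using convex_hull_image[of "{..n} - {i}" "(!) w"] inj_on_nth_ordered_simplex[OF w]
    by (simp add: set_facet_conv_image[OF length_ordered_simplex[OF w] assms])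
  show ?thesis
  proof
    assume "x \<in> convex hull set (facet i w)"
    moreover have "set (facet i w) \<subseteq> set w"
      by (auto simp: facet_def dest: in_set_takeD in_set_dropD)
    ultimately have "x \<in> convex hull set w" "x \<in> affine hull set (facet i w)"
      using hull_mono[of "set (facet i w)" "set w" convex]
        convex_hull_subset_affine_hull[of "set (facet i w)"] by auto
    then show "x \<in> affine hull set w \<and> bary w i x = 0 \<and> (\<forall>j\<le>n. 0 \<le> bary w j x)"
      using mem_affine_hull_facet_iff[OF assms, of x] mem_convex_hull_iff_bary by simp
  next
    assume x: "x \<in> affine hull set w \<and> bary w i x = 0 \<and> (\<forall>j\<le>n. 0 \<le> bary w j x)"
    have s: "(\<Sum>j\<in>{..n} - {i}. bary w j x) = 1" "x = (\<Sum>j\<in>{..n} - {i}. bary w j x *\<^sub>R w ! j)"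
      using affine_hull_bary[of x] x assms by (simp_all add: sum.remove[of _ i])
    show "x \<in> convex hull set (facet i w)" unfolding *
      by (intro CollectI exI[of _ "\<lambda>j. bary w j x"]) (use s x in auto)
  qed
qed

lemma aff_dim_ordered_simplex: "aff_dim (set w) = int n"
  using w aff_dim_affine_independent[of "set w"] by (auto simp: ordered_simplices_def distinct_card)

lemma facet_ordered_simplex: "0 < n \<Longrightarrow> i \<le> n \<Longrightarrow> facet i w \<in> ordered_simplices (n - 1)"
proof -
  assume "0 < n" "i \<le> n"
  moreover have "set (facet i w) \<subseteq> set w"
    by (auto simp: facet_def dest: in_set_takeD in_set_dropD)
  moreover have "distinct (facet i w)"
    using w \<open>i \<le> n\<close> by (auto simp: ordered_simplices_def distinct_conv_nth nth_facet)
  ultimately show ?thesis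
    using w affine_independent_subset[of "set w" "set (facet i w)"]
    by (auto simp: ordered_simplices_def)
qed

end

text \<open>Affine independence by positions instead of by points absorbs distinctness: two equal
  entries are a dependency with coefficients 1 and -1. Conversely, applying a barycentric coordinate
  to a dependency isolates one coefficient.\<close>

lemma ordered_simplices_iff:
  fixes w :: "'a::euclidean_space list"
  shows "w \<in> ordered_simplices n \<longleftrightarrow> length w = Suc n \<and>
    (\<forall>u. (\<Sum>i\<le>n. u i) = 0 \<and> (\<Sum>i\<le>n. u i *\<^sub>R w ! i) = 0 \<longrightarrow> (\<forall>i\<le>n. u i = 0))"
proof
  assume w: "w \<in> ordered_simplices n"
  have "u i = 0" if u: "(\<Sum>i\<le>n. u i) = 0" "(\<Sum>i\<le>n. u i *\<^sub>R w ! i) = 0" and i: "i \<le> n" for u i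
  proof -
    obtain c g where cg: "\<And>i x. bary w i x = c i + inner (g i) x" using bary_form[OF w] by blast
    have "(\<Sum>j\<le>n. u j * bary w i (w ! j)) = (\<Sum>j\<le>n. if j = i then u i else 0)"
      using i by (intro sum.cong) (auto simp: bary_vertex[OF w])
    also have "\<dots> = u i" using i by simp
    also have "(\<Sum>j\<le>n. u j * bary w i (w ! j)) = c i * sum u {..n} + inner (g i) (\<Sum>j\<le>n. u j *\<^sub>R w ! j)"
      by (simp add: cg inner_sum_right distrib_left sum.distrib sum_distrib_left mult.commute)
    finally show ?thesis using u by simp
  qed
  then show "length w = Suc n \<and>
    (\<forall>u. (\<Sum>i\<le>n. u i) = 0 \<and> (\<Sum>i\<le>n. u i *\<^sub>R w ! i) = 0 \<longrightarrow> (\<forall>i\<le>n. u i = 0))"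
    using length_ordered_simplex[OF w] by blast
next
  assume a: "length w = Suc n \<and>
    (\<forall>u. (\<Sum>i\<le>n. u i) = 0 \<and> (\<Sum>i\<le>n. u i *\<^sub>R w ! i) = 0 \<longrightarrow> (\<forall>i\<le>n. u i = 0))"
  have dist: "distinct w"
  proof (rule ccontr)
    assume "\<not> distinct w"
    then obtain i j where ij: "i \<le> n" "j \<le> n" "i \<noteq> j" "w ! i = w ! j"
      using a by (auto simp: distinct_conv_nth less_Suc_eq_le)
    define u :: "nat \<Rightarrow> real" where "u l = (if l = i then 1 else 0) - (if l = j then 1 else 0)" for l
    have "(\<Sum>l\<le>n. u l) = 0" using ij by (simp add: u_def sum_subtractf)
    moreover have "(\<Sum>l\<le>n. u l *\<^sub>R w ! l) = (\<Sum>l\<le>n. (if l = i then w ! i else 0) - (if l = j then w ! j else 0))"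
      by (intro sum.cong) (auto simp: u_def)
    moreover have "\<dots> = 0" using ij by (simp add: sum_subtractf)
    ultimately have "\<forall>i\<le>n. u i = 0" using a by metis
    then show False using ij by (auto simp: u_def)
  qed
  have inj: "inj_on ((!) w) {..n}" using a dist by (auto intro: inj_on_nth)
  have "\<not> affine_dependent (set w)"
  proof
    assume "affine_dependent (set w)"
    then obtain U where U: "sum U (set w) = 0" "\<exists>v\<in>set w. U v \<noteq> 0" "(\<Sum>v\<in>set w. U v *\<^sub>R v) = 0"
      using affine_dependent_explicit_finite[of "set w"] by auto
    have "(\<Sum>i\<le>n. U (w ! i)) = 0" "(\<Sum>i\<le>n. U (w ! i) *\<^sub>R w ! i) = 0"
      using U inj a by (simp_all add: set_conv_image_nth sum.reindex)
    then have "\<forall>i\<le>n. U (w ! i) = 0" using a by blast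
    then show False using U(2) a by (auto simp: set_conv_nth less_Suc_eq_le)
  qed
  then show "w \<in> ordered_simplices n" using a dist by (simp add: ordered_simplices_def)
qed

text \<open>Exchange argument: expanding \<open>x\<close> in barycentric coordinates turns a
  dependency of the new list into one of \<open>w\<close>, whose coefficient at \<open>i\<close> is
  a multiple of \<open>bary w i x\<close>. The hulls agree by dimension.\<close>

lemma ordered_simplex_update:
  assumes w: "w \<in> ordered_simplices n" and i: "i \<le> n"
    and x: "x \<in> affine hull set w" "bary w i x \<noteq> 0"
  shows "w[i := x] \<in> ordered_simplices n" "affine hull set (w[i := x]) = affine hull set w"
proof -
  have len: "length w = Suc n" by (rule length_ordered_simplex[OF w])
  have "\<forall>l\<le>n. u l = 0" if u: "(\<Sum>l\<le>n. u l) = 0" "(\<Sum>l\<le>n. u l *\<^sub>R w[i := x] ! l) = 0" for u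
  proof -
    define v where "v l = (if l = i then 0 else u l) + u i * bary w l x" for l
    have "(\<Sum>l\<le>n. v l) = (\<Sum>l\<le>n. if l = i then 0 else u l) + u i * (\<Sum>l\<le>n. bary w l x)"
      by (simp add: v_def sum.distrib sum_distrib_left)
    also have "\<dots> = (\<Sum>l\<le>n. u l)"
      using i by (simp add: affine_hull_bary[OF w x(1)] sum.remove[of _ i])
    finally have 1: "(\<Sum>l\<le>n. v l) = 0" using u by simp
    have "(\<Sum>l\<le>n. v l *\<^sub>R w ! l) = (\<Sum>l\<le>n. (if l = i then 0 else u l) *\<^sub>R w ! l) + u i *\<^sub>R (\<Sum>l\<le>n. bary w l x *\<^sub>R w ! l)"
      by (simp add: v_def sum.distrib scaleR_sum_right scaleR_add_left)
    also have "\<dots> = (\<Sum>l\<le>n. u l *\<^sub>R w[i := x] ! l)"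
      using i len by (simp add: affine_hull_bary[OF w x(1)] sum.remove[of _ i])
    finally have 2: "(\<Sum>l\<le>n. v l *\<^sub>R w ! l) = 0" using u by simp
    have v: "\<forall>l\<le>n. v l = 0" using 1 2 w unfolding ordered_simplices_iff by blast
    then have "u i = 0" using i x(2) by (auto simp: v_def)
    then show ?thesis using v by (auto simp: v_def split: if_splits)
  qed
  then show *: "w[i := x] \<in> ordered_simplices n"
    unfolding ordered_simplices_iff using len by auto
  have "set (w[i := x]) \<subseteq> affine hull set w"
    using x(1) hull_subset[of "set w"] set_update_subset_insert[of w i x] by auto
  then have "affine hull set (w[i := x]) \<subseteq> affine hull set w"
    by (simp add: hull_minimal)
  then show "affine hull set (w[i := x]) = affine hull set w"
    using aff_dim_ordered_simplex[OF w] aff_dim_ordered_simplex[OF *] len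
      aff_dim_affine_hull[of "set w"] aff_dim_affine_hull[of "set (w[i := x])"]
    by (intro affine_dim_equal) auto
qed

section \<open>Null chains and cones\<close>

text \<open>Vertex lists serve as generators so that boundary and cone are given by formulas on a
  basis. Splitting is imposed on degenerate lists as well, because facets and cones of a list may be
  degenerate without this being known.\<close>

inductive_set null_chains :: "nat \<Rightarrow> ('a::euclidean_space list \<Rightarrow>\<^sub>0 int) set" for n where
  zero: "0 \<in> null_chains n"
| degenerate: "length w = Suc n \<Longrightarrow> w \<notin> ordered_simplices n \<Longrightarrow> frag_of w \<in> null_chains n"
| swap: "length w = Suc n \<Longrightarrow> i < j \<Longrightarrow> j \<le> n \<Longrightarrow>
    frag_of w + frag_of (w[i := w ! j, j := w ! i]) \<in> null_chains n"
| split: "length w = Suc n \<Longrightarrow> i \<le> n \<Longrightarrow> j \<le> n \<Longrightarrow> i \<noteq> j \<Longrightarrow> 0 < t \<Longrightarrow> t < 1 \<Longrightarrow>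
    m = (1 - t) *\<^sub>R w ! i + t *\<^sub>R w ! j \<Longrightarrow>
    frag_of w - frag_of (w[i := m]) - frag_of (w[j := m]) \<in> null_chains n"
| diff: "a \<in> null_chains n \<Longrightarrow> b \<in> null_chains n \<Longrightarrow> a - b \<in> null_chains n"

lemma null_chains_minus: "a \<in> null_chains n \<Longrightarrow> - a \<in> null_chains n"
  using null_chains.diff[OF null_chains.zero, of a n] by simp

lemma null_chains_add: "a \<in> null_chains n \<Longrightarrow> b \<in> null_chains n \<Longrightarrow> a + b \<in> null_chains n"
  using null_chains.diff[OF _ null_chains_minus, of a n b] by simp

lemma null_chains_sum: "(\<And>x. x \<in> A \<Longrightarrow> f x \<in> null_chains n) \<Longrightarrow> sum f A \<in> null_chains n"
  by (induction A rule: infinite_finite_induct) (auto intro: null_chains.zero null_chains_add)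

lemma null_chains_cmul:
  assumes "a \<in> null_chains n"
  shows "frag_cmul c a \<in> null_chains n"
proof -
  have *: "frag_cmul (int m) a \<in> null_chains n" for m
    by (induction m) (auto simp: frag_cmul_distrib intro: assms null_chains.zero null_chains_add)
  show ?thesis
  proof (cases c)
    case (nonneg m)
    then show ?thesis using * by simp
  next
    case (neg m)
    then show ?thesis using null_chains_minus[OF *[of "Suc m"]] by simp
  qed
qed

lemma frag_cmul_diff_right: "frag_cmul c (a - b) = frag_cmul c a - frag_cmul c b"
  by (intro poly_mapping_eqI) (simp add: lookup_minus right_diff_distrib)

section \<open>Boundaries of affinely dependent lists\<close>

definition list_boundary :: "'a list \<Rightarrow> 'a list \<Rightarrow>\<^sub>0 int" where
  "list_boundary w = (\<Sum>i<length w. frag_cmul ((- 1) ^ i) (frag_of (facet i w)))"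

text \<open>Omitting either of two equal entries gives the same list up to moving one entry past
  \<open>j - i - 1\<close> others, and the signs are then opposite. The induction performs one
  adjacent swap at a time.\<close>

lemma facet_pair_cancel:
  assumes "length w = Suc (Suc n)" "i < j" "j < length w" "w ! i = w ! j"
  shows "frag_cmul ((- 1) ^ i) (frag_of (facet i w)) + frag_cmul ((- 1) ^ j) (frag_of (facet j w))
    \<in> null_chains n"
  using assms
proof (induction "j - Suc i" arbitrary: j w)
  case 0
  then have j: "j = Suc i" by simp
  have "facet i w = facet j w"
    using 0 j by (intro nth_equalityI) (auto simp: nth_facet less_Suc_eq)
  then show ?case using j null_chains.zero by (simp flip: frag_cmul_distrib)
next
  case (Suc d)
  then obtain j' where j: "j = Suc j'" "i < j'"
    using Suc.hyps(2) by (cases j) auto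
  \<comment> \<open>The swap brings the equal entry one position closer to \<open>i\<close>;
    deleting it there leaves the same list as deleting it at \<open>j\<close> from
    \<open>w\<close>.\<close>
  define w' where "w' = w[j' := w ! j, j := w ! j']"
  have len: "length w' = Suc (Suc n)" using Suc by (simp add: w'_def)
  have IH: "frag_cmul ((- 1) ^ i) (frag_of (facet i w')) + frag_cmul ((- 1) ^ j') (frag_of (facet j' w'))
    \<in> null_chains n"
    by (rule Suc.hyps(1)) (use Suc j len in \<open>auto simp: w'_def\<close>)
  obtain j'' where j'': "j' = Suc j''" using j by (cases j') auto
  have "facet j' w' = facet j w"
    using Suc j len by (intro nth_equalityI) (auto simp: nth_facet w'_def nth_list_update)
  moreover have "facet i w' = (facet i w)[j'' := facet i w ! j', j' := facet i w ! j'']"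
    using Suc j j'' len by (intro nth_equalityI) (auto simp: nth_facet w'_def nth_list_update)
  moreover have "frag_of (facet i w) + frag_of ((facet i w)[j'' := facet i w ! j', j' := facet i w ! j''])
      \<in> null_chains n"
    by (rule null_chains.swap) (use Suc j j'' in auto)
  ultimately have "frag_cmul ((- 1) ^ i) (frag_of (facet i w) + frag_of (facet i w')) -
     (frag_cmul ((- 1) ^ i) (frag_of (facet i w')) + frag_cmul ((- 1) ^ j') (frag_of (facet j w))) \<in> null_chains n"
    using IH by (auto intro: null_chains.diff null_chains_cmul)
  then show ?case
    by (simp add: j frag_cmul_distrib2 flip: minus_frag_cmul)
qed

lemma facet_update_same: "facet i (w[i := x]) = facet i w"
  by (simp add: facet_def)

lemma facet_update:
  assumes "i < length w" "l < length w" "i \<noteq> l"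
  shows "facet l (w[i := x]) = (facet l w)[(if i < l then i else i - 1) := x]"
  using assms by (intro nth_equalityI) (auto simp: nth_facet nth_list_update)

lemma sum_two:
  fixes f :: "nat \<Rightarrow> 'b::comm_monoid_add"
  assumes "a \<le> n" "b \<le> n" "a \<noteq> b"
  shows "sum f {..n} = f a + f b + sum f ({..n} - {a, b})"
proof -
  have "sum f {..n} = f a + sum f ({..n} - {a})" using assms by (intro sum.remove) auto
  also have "sum f ({..n} - {a}) = f b + sum f ({..n} - {a} - {b})" using assms by (intro sum.remove) auto
  also have "{..n} - {a} - {b} = {..n} - {a, b}" by auto
  finally show ?thesis by (simp add: add.assoc)
qed

text \<open>If the vertices satisfy an affine dependency with at least three terms, two coefficients
  have the same sign, and splitting the edge between the two vertices at their barycentre leaves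
  two dependencies with fewer terms.\<close>

lemma list_boundary_degenerate:
  assumes "length w = Suc (Suc n)"
    and "sum u {..Suc n} = 0" "(\<Sum>i\<le>Suc n. u i *\<^sub>R w ! i) = 0" "i0 \<le> Suc n" "u i0 \<noteq> 0"
  shows "list_boundary w \<in> null_chains n"
  using assms
proof (induction "card {i\<in>{..Suc n}. u i \<noteq> 0}" arbitrary: u w i0 rule: less_induct)
  case less
  let ?N = "{..Suc n}"
  note len = less.prems(1)
  define S where "S = {i\<in>?N. u i \<noteq> 0}"
  have S: "finite S" "i0 \<in> S" using less.prems by (auto simp: S_def)
  have "sum u S = sum u ?N" by (rule sum.mono_neutral_left) (auto simp: S_def)
  then have sumS: "sum u S = 0" using less.prems(2) by simp
  show ?case
  proof (cases "\<exists>i\<in>S. \<exists>j\<in>S. i \<noteq> j \<and> 0 < u i * u j")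
    case True
    then obtain i' j' where "i' \<in> S" "j' \<in> S" "i' \<noteq> j'" "0 < u i' * u j'" by blast
    then obtain i j where ij: "i \<le> Suc n" "j \<le> Suc n" "u i \<noteq> 0" "u j \<noteq> 0" "i < j" "0 < u i * u j"
      by (rule_tac that[of "min i' j'" "max i' j'"]) (auto simp: S_def min_def max_def mult.commute)
    define t where "t = u j / (u i + u j)"
    have pos: "0 < u i \<and> 0 < u j \<or> u i < 0 \<and> u j < 0"
      using ij(6) by (simp add: zero_less_mult_iff)
    then have uij: "u i + u j \<noteq> 0" by linarith
    then have omt: "1 - t = u i / (u i + u j)" unfolding t_def by (simp add: diff_divide_eq_iff)
    have t: "0 < t" using pos unfolding t_def by (auto simp: zero_less_divide_iff)
    have "0 < 1 - t" using pos unfolding omt by (auto simp: zero_less_divide_iff)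
    then have t1: "t < 1" by simp
    define q where "q = (1 - t) *\<^sub>R w ! i + t *\<^sub>R w ! j"
    have "(u i + u j) * (1 - t) = u i" "(u i + u j) * t = u j"
      using uij unfolding omt by (simp_all add: t_def)
    then have q: "(u i + u j) *\<^sub>R q = u i *\<^sub>R w ! i + u j *\<^sub>R w ! j"
      unfolding q_def scaleR_add_right scaleR_scaleR by simp
    have step: "list_boundary (w[a := q]) \<in> null_chains n"
      if a: "a \<le> Suc n" "u a \<noteq> 0" and b: "b \<le> Suc n" "u b \<noteq> 0" and ab: "a \<noteq> b" "u a + u b \<noteq> 0"
        and qab: "(u a + u b) *\<^sub>R q = u a *\<^sub>R w ! a + u b *\<^sub>R w ! b" for a b
    proof -
      \<comment> \<open>The weight \<open>u a + u b\<close> is moved to the barycentre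
        \<open>q\<close> at position \<open>a\<close>, and position \<open>b\<close> leaves the
        support.\<close>
      define v where "v = u(a := u a + u b, b := 0)"
      have v: "v a = u a + u b" "v b = 0" "\<And>l. l \<noteq> a \<Longrightarrow> l \<noteq> b \<Longrightarrow> v l = u l"
        using ab by (simp_all add: v_def)
      have "{l \<in> ?N. v l \<noteq> 0} \<subseteq> S - {b}"
      proof
        fix l assume "l \<in> {l \<in> ?N. v l \<noteq> 0}"
        then show "l \<in> S - {b}" using v a(2) by (cases "l = a"; cases "l = b") (simp_all add: S_def)
      qed
      moreover have "b \<in> S" using b by (simp add: S_def)
      ultimately have vS: "{l \<in> ?N. v l \<noteq> 0} \<subset> S" by blast
      have "sum v ?N = sum u ?N"
        unfolding sum_two[OF a(1) b(1) ab(1), of v] sum_two[OF a(1) b(1) ab(1), of u]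
        by (simp add: v cong: sum.cong_simp)
      then have 1: "sum v ?N = 0" using less.prems(2) by simp
      have "(\<Sum>l\<in>?N - {a, b}. v l *\<^sub>R w[a := q] ! l) = (\<Sum>l\<in>?N - {a, b}. u l *\<^sub>R w ! l)"
        by (rule sum.cong) (simp_all add: v)
      moreover have "w[a := q] ! a = q" using a len by simp
      ultimately have "(\<Sum>l\<le>Suc n. v l *\<^sub>R w[a := q] ! l) = (\<Sum>l\<le>Suc n. u l *\<^sub>R w ! l)"
        unfolding sum_two[OF a(1) b(1) ab(1), of "\<lambda>l. v l *\<^sub>R w[a := q] ! l"]
          sum_two[OF a(1) b(1) ab(1), of "\<lambda>l. u l *\<^sub>R w ! l"]
        by (simp add: v qab)
      then have 2: "(\<Sum>l\<le>Suc n. v l *\<^sub>R w[a := q] ! l) = 0" using less.prems(3) by simp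
      show ?thesis
      proof (rule less.hyps[OF _ _ 1 2 a(1)])
        show "card {l \<in> ?N. v l \<noteq> 0} < card {l \<in> ?N. u l \<noteq> 0}"
          using psubset_card_mono[OF S(1) vS] by (simp add: S_def)
        show "length (w[a := q]) = Suc (Suc n)" using len by simp
        show "v a \<noteq> 0" using v ab by simp
      qed
    qed
    have steps: "list_boundary (w[i := q]) \<in> null_chains n" "list_boundary (w[j := q]) \<in> null_chains n"
      using step[of i j] step[of j i] ij uij q by (simp_all add: add.commute)
    note split = sum_two[OF ij(1,2) less_imp_neq[OF ij(5)]]
    \<comment> \<open>The two halves share a new facet, which appears in them as facets
      \<open>j\<close> of \<open>?w1\<close> and \<open>i\<close> of \<open>?w2\<close>. Both are
      facets of \<open>?w3\<close>, a list with the equal entries \<open>q\<close>, so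
      \<open>facet_pair_cancel\<close> removes them.\<close>
    let ?w1 = "w[i := q]" and ?w2 = "w[j := q]" and ?w3 = "w[i := q, j := q]"
    let ?F = "\<lambda>w l. frag_cmul ((- 1) ^ l) (frag_of (facet l w))"
    have bd: "list_boundary v = ?F v i + ?F v j + (\<Sum>l\<in>?N - {i, j}. ?F v l)" if "length v = Suc (Suc n)" for v
      unfolding list_boundary_def using that split[of "?F v"] by (simp add: lessThan_Suc_atMost)
    have "list_boundary w - list_boundary ?w1 - list_boundary ?w2
      = (\<Sum>l\<in>?N - {i, j}. ?F w l - ?F ?w1 l - ?F ?w2 l) - (?F ?w3 i + ?F ?w3 j)"
    proof -
      have "facet i ?w3 = facet i ?w2" "facet j ?w3 = facet j ?w1" "facet i ?w1 = facet i w" "facet j ?w2 = facet j w"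
        using ij list_update_swap[of i j w q q] by (simp_all add: facet_update_same) (metis facet_update_same)
      then show ?thesis using len by (simp add: bd sum_subtractf sum.distrib algebra_simps)
    qed
    moreover have "?F w l - ?F ?w1 l - ?F ?w2 l \<in> null_chains n" if l: "l \<in> ?N - {i, j}" for l
    proof -
      let ?i = "if i < l then i else i - 1" and ?j = "if j < l then j else j - 1"
      have "frag_of (facet l w) - frag_of ((facet l w)[?i := q]) - frag_of ((facet l w)[?j := q]) \<in> null_chains n"
        by (rule null_chains.split[OF _ _ _ _ t t1]) (use l ij len in \<open>auto simp: nth_facet q_def\<close>)
      then have "frag_cmul ((- 1) ^ l) (frag_of (facet l w) - frag_of (facet l ?w1) - frag_of (facet l ?w2)) \<in> null_chains n"
        using l ij len by (intro null_chains_cmul) (simp add: facet_update)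
      then show ?thesis by (simp only: frag_cmul_diff_right)
    qed
    moreover have "?F ?w3 i + ?F ?w3 j \<in> null_chains n"
      by (rule facet_pair_cancel) (use ij len in auto)
    ultimately have "list_boundary w - list_boundary ?w1 - list_boundary ?w2 \<in> null_chains n"
      by (auto intro: null_chains.diff null_chains_sum)
    then have "list_boundary w - list_boundary ?w1 - list_boundary ?w2 + list_boundary ?w1 + list_boundary ?w2 \<in> null_chains n"
      using steps by (intro null_chains_add)
    then show ?thesis by simp
  next
    case False
    \<comment> \<open>There is now at most one positive and one negative coefficient. Since they sum
      to zero, exactly one of each occurs, and the two vertices coincide.\<close>
    have u0: "u i0 \<noteq> 0" by fact
    have "\<exists>j\<in>S. j \<noteq> i0 \<and> u j * u i0 < 0"
    proof (rule ccontr)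
      assume "\<not> ?thesis"
      then have neg: "\<not> u j * u i0 < 0" if "j \<in> S" "j \<noteq> i0" for j using that by blast
      have "j = i0" if "j \<in> S" for j
      proof (rule ccontr)
        assume "j \<noteq> i0"
        then have "\<not> 0 < u j * u i0" using False S(2) that by blast
        moreover have "u j * u i0 \<noteq> 0" using that u0 by (simp add: S_def)
        ultimately show False using neg[OF that \<open>j \<noteq> i0\<close>] by linarith
      qed
      then have "S = {i0}" using S(2) by blast
      then show False using sumS u0 by simp
    qed
    then obtain j where j: "j \<in> S" "j \<noteq> i0" "u j * u i0 < 0" by blast
    have S2: "S = {i0, j}"
    proof (rule ccontr)
      assume "S \<noteq> {i0, j}"
      then obtain l where l: "l \<in> S" "l \<noteq> i0" "l \<noteq> j" using j S by blast
      have "\<not> 0 < u l * u i0" using False l S(2) by blast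
      moreover have "\<not> 0 < u l * u j" using False l j by blast
      moreover have "u l \<noteq> 0" using l by (simp add: S_def)
      ultimately show False using j(3) unfolding zero_less_mult_iff mult_less_0_iff by linarith
    qed
    have "(\<Sum>l\<in>S. u l *\<^sub>R w ! l) = (\<Sum>l\<le>Suc n. u l *\<^sub>R w ! l)"
      by (rule sum.mono_neutral_left) (auto simp: S_def)
    then have "u i0 *\<^sub>R w ! i0 + u j *\<^sub>R w ! j = 0" using less.prems(3) j unfolding S2 by simp
    moreover have "u j = - u i0" using sumS j unfolding S2 by simp
    ultimately have "u i0 *\<^sub>R (w ! i0 - w ! j) = 0" by (simp add: algebra_simps)
    then have eq: "w ! i0 = w ! j" using u0 by simp
    define a where "a = min i0 j"
    define b where "b = max i0 j"
    have ab: "a < b" "b \<le> Suc n" "w ! a = w ! b"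
      using j less.prems(4) eq by (auto simp: a_def b_def S_def min_def max_def)
    have "?thesis \<longleftrightarrow> (\<Sum>l\<le>Suc n. frag_cmul ((- 1) ^ l) (frag_of (facet l w))) \<in> null_chains n"
      unfolding list_boundary_def using len by (simp add: lessThan_Suc_atMost)
    also have "(\<Sum>l\<le>Suc n. frag_cmul ((- 1) ^ l) (frag_of (facet l w))) =
      frag_cmul ((- 1) ^ a) (frag_of (facet a w)) + (frag_cmul ((- 1) ^ b) (frag_of (facet b w))
        + (\<Sum>l\<in>?N - {a} - {b}. frag_cmul ((- 1) ^ l) (frag_of (facet l w))))"
      using ab by (simp add: sum.remove[of ?N a] sum.remove[of "?N - {a}" b] del: sum.atMost_Suc)
    also have "\<dots> \<in> null_chains n"
      unfolding add.assoc[symmetric]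
    proof (rule null_chains_add[OF facet_pair_cancel[OF len ab(1) _ ab(3)] null_chains_sum])
      \<comment> \<open>Every other facet still contains both equal vertices and is
        degenerate.\<close>
      fix l assume l: "l \<in> ?N - {a} - {b}"
      let ?a = "if a < l then a else a - 1" and ?b = "if b < l then b else b - 1"
      have "?a < length (facet l w)" "?b < length (facet l w)" "?a \<noteq> ?b" "facet l w ! ?a = facet l w ! ?b"
        using l ab len by (auto simp: nth_facet)
      then have "\<not> distinct (facet l w)" by (auto simp: nth_eq_iff_index_eq)
      then show "frag_cmul ((- 1) ^ l) (frag_of (facet l w)) \<in> null_chains n"
        using l len by (intro null_chains_cmul null_chains.degenerate) (auto simp: ordered_simplices_def)
    qed (use ab(2) len in simp)
    finally show ?thesis .
  qed
qed

section \<open>Cones\<close>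

definition cone_chain :: "'a \<Rightarrow> ('a list \<Rightarrow>\<^sub>0 int) \<Rightarrow> ('a list \<Rightarrow>\<^sub>0 int)" where
  "cone_chain p = frag_extend (\<lambda>w. frag_of (p # w))"

text \<open>Prefixing \<open>p\<close> shifts positions by one and turns each generator into one of
  the same kind. The list \<open>p # w\<close> may be degenerate when \<open>w\<close> is not, which
  the generators permit.\<close>

lemma cone_chain_null_chains:
  assumes "a \<in> null_chains n"
  shows "cone_chain p a \<in> null_chains (Suc n)"
  using assms
proof induction
  case zero
  then show ?case by (simp add: cone_chain_def null_chains.zero)
next
  case (degenerate w)
  have "p # w \<notin> ordered_simplices (Suc n)"
    using degenerate affine_independent_subset[of "set (p # w)" "set w"]
    by (auto simp: ordered_simplices_def)
  then show ?case using degenerate by (simp add: cone_chain_def null_chains.degenerate)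
next
  case (swap w i j)
  show ?case
    using null_chains.swap[of "p # w" "Suc n" "Suc i" "Suc j"] swap by (simp add: cone_chain_def frag_extend_add)
next
  case (split w i j t m)
  show ?case
    using null_chains.split[of "p # w" "Suc n" "Suc i" "Suc j" t m] split
    by (simp add: cone_chain_def frag_extend_diff)
next
  case (diff a b)
  then show ?case by (simp add: cone_chain_def frag_extend_diff null_chains.diff)
qed

text \<open>The list \<open>p # w\<close> is dependent, with coefficients -1 and the barycentric
  coordinates of \<open>p\<close>, so its boundary is null. That boundary is \<open>w\<close> minus
  the cone over the boundary of \<open>w\<close>.\<close>

lemma cone_chain_boundary:
  assumes w: "w \<in> ordered_simplices n" and p: "p \<in> affine hull set w"
  shows "frag_of w - cone_chain p (list_boundary w) \<in> null_chains n"
proof -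
  have len: "length w = Suc n" by (rule length_ordered_simplex[OF w])
  define u where "u = case_nat (-1) (\<lambda>i. bary w i p)"
  have "list_boundary (p # w) \<in> null_chains n"
  proof (rule list_boundary_degenerate[of _ n u 0])
    show "sum u {..Suc n} = 0"
      using affine_hull_bary[OF w p] unfolding sum.atMost_Suc_shift by (simp add: u_def)
    show "(\<Sum>i\<le>Suc n. u i *\<^sub>R (p # w) ! i) = 0"
      using affine_hull_bary[OF w p] unfolding sum.atMost_Suc_shift by (simp add: u_def)
  qed (auto simp: len u_def)
  moreover have "list_boundary (p # w) = frag_of w - cone_chain p (list_boundary w)"
    unfolding list_boundary_def cone_chain_def
    by (simp add: sum.lessThan_Suc_shift frag_extend_sum frag_extend_cmul facet_def sum_negf[symmetric] o_def del: sum.lessThan_Suc)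
  ultimately show ?thesis by simp
qed

section \<open>Chains with vanishing indicator\<close>

definition simplices_in :: "nat \<Rightarrow> 'a::euclidean_space set \<Rightarrow> 'a list set \<Rightarrow> bool" where
  "simplices_in n P J \<longleftrightarrow> finite J \<and> (\<forall>w\<in>J. w \<in> ordered_simplices n \<and> affine hull set w = P)"

text \<open>On simplices spanning the \<open>n\<close>-plane \<open>P\<close>, the sign of \<open>orient_det B\<close> is identically zero or one of
  the two orientations of \<open>P\<close>. The sets in \<open>E\<close> cover the points that are not generic.\<close>

definition vanishing :: "nat \<Rightarrow> 'a::euclidean_space set \<Rightarrow> 'a list set \<Rightarrow> ('a list \<Rightarrow> int) \<Rightarrow> bool" where
  "vanishing n P J c \<longleftrightarrow> (\<exists>E. finite E \<and> (\<forall>L\<in>E. affine L \<and> aff_dim L < int n) \<and>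
     (\<forall>B x. length B = n \<longrightarrow> x \<in> P - \<Union>E \<longrightarrow>
        (\<Sum>w\<in>J. of_int (c w) * sgn (orient_det B w) * indicator (convex hull set w) x) = (0::real)))"

text \<open>The coefficient of the list \<open>u\<close> in the boundary of the chain with
  coefficients \<open>c\<close>; one facet can belong to several simplices of
  \<open>J\<close>.\<close>

definition facet_coeff :: "nat \<Rightarrow> 'a list set \<Rightarrow> ('a list \<Rightarrow> int) \<Rightarrow> 'a list \<Rightarrow> int" where
  "facet_coeff n J c u = (\<Sum>(w, i)\<in>{(w, i). w \<in> J \<and> i \<le> n \<and> facet i w = u}. (- 1) ^ i * c w)"

definition facets_in :: "nat \<Rightarrow> 'a::euclidean_space list set \<Rightarrow> 'a set \<Rightarrow> 'a list set" where
  "facets_in n J H = {facet i w |w i. w \<in> J \<and> i \<le> n \<and> affine hull set (facet i w) = H}"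

lemma facets_in_image:
  "facets_in n J H = (\<lambda>(w, i). facet i w) ` {(w, i). w \<in> J \<and> i \<le> n \<and> affine hull set (facet i w) = H}"
  by (auto simp: facets_in_def)

lemma finite_index: "finite J \<Longrightarrow> finite {(w, i). w \<in> J \<and> i \<le> (n::nat) \<and> R w i}"
  by (rule finite_subset[of _ "J \<times> {..n}"]) auto

lemma eventually_sgn_line:
  fixes a b :: real
  assumes "a \<noteq> 0"
  shows "eventually (\<lambda>t. sgn ((1 - t) * a + t * b) = sgn a \<and> sgn ((1 + t) * a - t * b) = sgn a) (at_right 0)"
proof -
  have 1: "((\<lambda>t. ((1 - t) * a + t * b) * a) \<longlongrightarrow> ((1 - 0) * a + 0 * b) * a) (at_right 0)"
    by (intro tendsto_intros)
  have 2: "((\<lambda>t. ((1 + t) * a - t * b) * a) \<longlongrightarrow> ((1 + 0) * a - 0 * b) * a) (at_right 0)"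
    by (intro tendsto_intros)
  have pos: "0 < a * a" using assms by (auto simp: zero_less_mult_iff linorder_neq_iff)
  have "eventually (\<lambda>t. ((1 - t) * a + t * b) * a > 0 \<and> ((1 + t) * a - t * b) * a > 0) (at_right 0)"
    using order_tendstoD(1)[OF 1, of 0] order_tendstoD(1)[OF 2, of 0] pos
    by (auto intro: eventually_conj)
  moreover have "sgn z = sgn a" if "0 < z * a" for z
    using that by (auto simp: zero_less_mult_iff)
  ultimately show ?thesis by (auto elim!: eventually_mono)
qed

text \<open>At most one facet of \<open>w\<close> spans \<open>H\<close>, and \<open>w\<close> lies on one side of it. Expanding the
  determinant along \<open>g\<close> shows that this side is the product of the orientations of \<open>w\<close> and of the facet.\<close>

lemma indicator_jump:
  fixes w :: "'a::euclidean_space list"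
  assumes w: "w \<in> ordered_simplices n" "affine hull set w = P" and n: "length B = n - 1" "0 < n"
    and x: "x \<in> P" "h x = 0" and q: "q \<in> P" "h q = 1"
    and h: "\<And>y. h y = c + inner g y" and H: "H = {y \<in> P. h y = 0}"
    and gen: "\<And>i. i \<le> n \<Longrightarrow> affine hull set (facet i w) \<noteq> H \<Longrightarrow> x \<notin> affine hull set (facet i w)"
    and t: "0 < t"
    and stable: "\<And>i. i \<le> n \<Longrightarrow> bary w i x \<noteq> 0 \<Longrightarrow>
       sgn ((1 - t) * bary w i x + t * bary w i q) = sgn (bary w i x) \<and>
       sgn ((1 + t) * bary w i x - t * bary w i q) = sgn (bary w i x)"
  shows "(\<Sum>i\<in>{i. i \<le> n \<and> affine hull set (facet i w) = H}.
      (- 1) ^ i * sgn (orient_det B (facet i w)) * indicator (convex hull set (facet i w)) x)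
    = sgn (orient_det (g # B) w) * (indicator (convex hull set w) ((1 + t) *\<^sub>R x - t *\<^sub>R q)
        - (indicator (convex hull set w) ((1 - t) *\<^sub>R x + t *\<^sub>R q) :: real))"
proof -
  let ?I = "{i. i \<le> n \<and> affine hull set (facet i w) = H}"
  have aff: "affine P" using w(2) by auto
  have inP: "(1 - s) *\<^sub>R x + s *\<^sub>R q \<in> P" for s
    using aff x(1) q(1) by (auto simp: affine_def)
  have inP': "(1 + s) *\<^sub>R x - s *\<^sub>R q \<in> P" for s
    using inP[of "- s"] by simp
  have line: "bary w i ((1 - s) *\<^sub>R x + s *\<^sub>R q) = (1 - s) * bary w i x + s * bary w i q" for i s
    by (rule bary_line[OF w(1)])
  have line': "bary w i ((1 + s) *\<^sub>R x - s *\<^sub>R q) = (1 + s) * bary w i x - s * bary w i q" for i s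
    using line[of i "- s"] by simp
  have nz: "bary w i x \<noteq> 0" if "i \<le> n" "affine hull set (facet i w) \<noteq> H" for i
    using gen[OF that] x(1) mem_affine_hull_facet_iff[OF w(1) that(1), of x] w(2) by simp
  have cv: "y \<in> convex hull set w \<longleftrightarrow> (\<forall>i\<le>n. 0 \<le> bary w i y)" if "y \<in> P" for y
    using mem_convex_hull_iff_bary[OF w(1), of y] w(2) that by simp
  have st: "0 \<le> (1 - t) * bary w i x + t * bary w i q \<longleftrightarrow> 0 \<le> bary w i x"
    "0 \<le> (1 + t) * bary w i x - t * bary w i q \<longleftrightarrow> 0 \<le> bary w i x"
    if "i \<le> n" "affine hull set (facet i w) \<noteq> H" for i
    using stable[OF that(1) nz[OF that]] by (smt (verit) sgn_pos sgn_neg sgn_zero)+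
  show ?thesis
  proof (cases "?I = {}")
    case True
    then have "indicator (convex hull set w) ((1 + t) *\<^sub>R x - t *\<^sub>R q)
      = (indicator (convex hull set w) ((1 - t) *\<^sub>R x + t *\<^sub>R q) :: real)"
      using st by (auto simp: indicator_def cv inP inP' line line')
    then show ?thesis unfolding True by simp
  next
    case False
    then obtain i where i: "i \<le> n" "affine hull set (facet i w) = H" by blast
    have hz: "h (w ! j) = 0" if "j \<le> n" "j \<noteq> i" for j
    proof -
      have "w ! j \<in> set (facet i w)"
        using that i length_ordered_simplex[OF w(1)] by (auto simp: set_facet)
      then have "w ! j \<in> H" using i hull_subset[of "set (facet i w)" affine] by auto
      then show ?thesis using H by simp
    qed
    \<comment> \<open>A second facet spanning \<open>H\<close> would contain the vertex
      \<open>w ! i\<close>, which lies outside the plane of the first.\<close>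
    have uniq: "?I = {i}"
    proof (rule ccontr)
      assume "?I \<noteq> {i}"
      then obtain j where j: "j \<le> n" "affine hull set (facet j w) = H" "j \<noteq> i" using i by blast
      have "w ! i \<in> set (facet j w)"
        using j i length_ordered_simplex[OF w(1)] by (auto simp: set_facet)
      then have "w ! i \<in> affine hull set (facet i w)" using i j hull_subset[of "set (facet j w)" affine] by auto
      then show False
        using mem_affine_hull_facet_iff[OF w(1) i(1)] bary_vertex[OF w(1) i(1) i(1)] by simp
    qed
    \<comment> \<open>On \<open>P\<close> both sides are affine, and they agree at all vertices,
      being zero except at \<open>w ! i\<close>.\<close>
    have hb: "h y = bary w i y * h (w ! i)" if "y \<in> P" for y
    proof -
      have y: "(\<Sum>j\<le>n. bary w j y) = 1" "(\<Sum>j\<le>n. bary w j y *\<^sub>R w ! j) = y"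
        using affine_hull_bary[OF w(1), of y] that w(2) by auto
      have "h y = c * (\<Sum>j\<le>n. bary w j y) + inner g (\<Sum>j\<le>n. bary w j y *\<^sub>R w ! j)"
        unfolding y by (simp add: h)
      also have "\<dots> = (\<Sum>j\<le>n. bary w j y * h (w ! j))"
        by (simp add: h inner_sum_right distrib_left sum.distrib sum_distrib_left mult.commute)
      also have "\<dots> = (\<Sum>j\<le>n. if j = i then bary w i y * h (w ! i) else 0)"
        by (rule sum.cong) (auto simp: hz)
      finally show ?thesis using i by simp
    qed
    \<comment> \<open>The normalisation \<open>h q = 1\<close> makes the two factors reciprocal,
      hence nonzero and of equal sign.\<close>
    have one: "bary w i q * h (w ! i) = 1" using hb[OF q(1)] q(2) by simp
    then have bq: "bary w i q \<noteq> 0" by auto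
    have bx: "bary w i x = 0" using hb[OF x(1)] x(2) one by auto
    have others: "affine hull set (facet j w) \<noteq> H" if "j \<le> n" "j \<noteq> i" for j
      using uniq that by auto
    have f: "x \<in> convex hull set (facet i w) \<longleftrightarrow> (\<forall>j\<le>n. j \<noteq> i \<longrightarrow> 0 \<le> bary w j x)"
      using mem_convex_hull_facet_iff[OF w(1) i(1), of x] x(1) w(2) bx by auto
    have p: "(1 - t) *\<^sub>R x + t *\<^sub>R q \<in> convex hull set w \<longleftrightarrow>
        0 < bary w i q \<and> (\<forall>j\<le>n. j \<noteq> i \<longrightarrow> 0 \<le> bary w j x)"
    proof -
      have "(1 - t) *\<^sub>R x + t *\<^sub>R q \<in> convex hull set w \<longleftrightarrow>
        0 \<le> (1 - t) * bary w i x + t * bary w i q \<and>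
        (\<forall>j\<le>n. j \<noteq> i \<longrightarrow> 0 \<le> (1 - t) * bary w j x + t * bary w j q)"
        using cv[OF inP[of t]] i unfolding line by blast
      also have "(\<forall>j\<le>n. j \<noteq> i \<longrightarrow> 0 \<le> (1 - t) * bary w j x + t * bary w j q) \<longleftrightarrow>
         (\<forall>j\<le>n. j \<noteq> i \<longrightarrow> 0 \<le> bary w j x)" using st others by auto
      also have "0 \<le> (1 - t) * bary w i x + t * bary w i q \<longleftrightarrow> 0 < bary w i q"
        using bq t by (auto simp: bx zero_le_mult_iff)
      finally show ?thesis .
    qed
    have m: "(1 + t) *\<^sub>R x - t *\<^sub>R q \<in> convex hull set w \<longleftrightarrow>
        bary w i q < 0 \<and> (\<forall>j\<le>n. j \<noteq> i \<longrightarrow> 0 \<le> bary w j x)"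
    proof -
      have "(1 + t) *\<^sub>R x - t *\<^sub>R q \<in> convex hull set w \<longleftrightarrow>
        0 \<le> (1 + t) * bary w i x - t * bary w i q \<and>
        (\<forall>j\<le>n. j \<noteq> i \<longrightarrow> 0 \<le> (1 + t) * bary w j x - t * bary w j q)"
        using cv[OF inP'[of t]] i unfolding line' by blast
      also have "(\<forall>j\<le>n. j \<noteq> i \<longrightarrow> 0 \<le> (1 + t) * bary w j x - t * bary w j q) \<longleftrightarrow>
         (\<forall>j\<le>n. j \<noteq> i \<longrightarrow> 0 \<le> bary w j x)" using st others by auto
      also have "0 \<le> (1 + t) * bary w i x - t * bary w i q \<longleftrightarrow> bary w i q < 0"
        using bq t by (auto simp: bx mult_le_0_iff)
      finally show ?thesis .
    qed
    have D: "orient_det (g # B) w = - ((- 1) ^ i * h (w ! i) * orient_det B (facet i w))"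
    proof -
      have "orient_det (g # B) w = - ((- 1) ^ i * (inner g (w ! i) - (- c)) * orient_det B (facet i w))"
      proof (rule orient_det_Cons)
        show "inner g (w ! j) = - c" if "j < length w" "j \<noteq> i" for j
          using hz[of j] that length_ordered_simplex[OF w(1)] by (simp add: h)
      qed (use length_ordered_simplex[OF w(1)] i n in auto)
      then show ?thesis by (simp add: h add.commute)
    qed
    have s: "sgn (h (w ! i)) = sgn (bary w i q)" "bary w i q \<noteq> 0"
      using one by (auto simp: sgn_if zero_less_mult_iff) (smt (verit) mult_nonneg_nonpos mult_nonpos_nonneg)+
    have "sgn (orient_det (g # B) w) = - ((- 1) ^ i * sgn (bary w i q) * sgn (orient_det B (facet i w)))"
      unfolding D by (simp add: sgn_mult s power_sgn sgn_minus)
    \<comment> \<open>By \<open>p\<close> and \<open>m\<close>, only the point on the side of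
      \<open>w\<close> can lie in the simplex, so the difference of the indicators is minus
      \<open>sgn (bary w i q)\<close> times the indicator of the facet at \<open>x\<close>.\<close>
    then show ?thesis
      unfolding uniq using s(2) by (simp add: indicator_def f p m sgn_if)
  qed
qed

text \<open>A generic point \<open>x\<close> of \<open>H\<close> is displaced along the line through
  \<open>q\<close> to \<open>y t\<close> and \<open>y (- t)\<close>, one on each side of
  \<open>H\<close>. For small \<open>t\<close> both avoid \<open>E\<close>, so the sums for
  \<open>g # B\<close> vanish there, \<open>g\<close> being the gradient of the affine function that
  cuts out \<open>H\<close>. By \<open>indicator_jump\<close> their difference is the sum over the
  facets in \<open>H\<close>.\<close>

lemma vanishing_facets:
  fixes J :: "'a::euclidean_space list set"
  assumes J: "simplices_in n P J" and n: "0 < n" and van: "vanishing n P J c"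
  shows "vanishing (n - 1) H (facets_in n J H) (facet_coeff n J c)"
proof (cases "facets_in n J H = {}")
  case True
  then show ?thesis unfolding vanishing_def by (intro exI[of _ "{}"]) simp
next
  case False
  then obtain w0 i0 where w0: "w0 \<in> J" "i0 \<le> n" "affine hull set (facet i0 w0) = H"
    by (auto simp: facets_in_def)
  have fin: "finite J" and Jw: "\<And>w. w \<in> J \<Longrightarrow> w \<in> ordered_simplices n" "\<And>w. w \<in> J \<Longrightarrow> affine hull set w = P"
    using J by (auto simp: simplices_in_def)
  define h where "h = bary w0 i0"
  obtain c0 g where h: "\<And>y. h y = c0 + inner g y"
    using bary_form[OF Jw(1)[OF w0(1)]] unfolding h_def by metis
  have H: "H = {y \<in> P. h y = 0}"
    using mem_affine_hull_facet_iff[OF Jw(1)[OF w0(1)] w0(2)] w0(3) Jw(2)[OF w0(1)] by (auto simp: h_def)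
  define q where "q = w0 ! i0"
  have q: "q \<in> P" "h q = 1"
  proof -
    have "q \<in> set w0" using w0(2) length_ordered_simplex[OF Jw(1)[OF w0(1)]] by (simp add: q_def)
    then show "q \<in> P" using hull_subset[of "set w0" affine] Jw(2)[OF w0(1)] by auto
    show "h q = 1" using bary_vertex[OF Jw(1)[OF w0(1)] w0(2) w0(2)] by (simp add: h_def q_def)
  qed
  have affH: "affine H" using w0(3) by auto
  have dimH: "aff_dim H = int (n - 1)"
    using aff_dim_ordered_simplex[OF facet_ordered_simplex[OF Jw(1)[OF w0(1)] n w0(2)]] w0(3)
    by (metis aff_dim_affine_hull)
  obtain E where E: "finite E" "\<And>L. L \<in> E \<Longrightarrow> affine L" "\<And>L. L \<in> E \<Longrightarrow> aff_dim L < int n"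
    and Ev: "\<And>B x. length B = n \<Longrightarrow> x \<in> P - \<Union>E \<Longrightarrow>
        (\<Sum>w\<in>J. of_int (c w) * sgn (orient_det B w) * indicator (convex hull set w) x) = (0::real)"
    using van unfolding vanishing_def by blast
  \<comment> \<open>Only planes not containing \<open>H\<close> leave a smaller trace on it. The
    traces of the other facet planes are added so that coordinates belonging to facets outside
    \<open>H\<close> do not vanish at \<open>x\<close>.\<close>
  define E' where "E' = (\<lambda>L. L \<inter> H) ` {L \<in> E. \<not> H \<subseteq> L} \<union>
    (\<lambda>(w, i). affine hull set (facet i w) \<inter> H) ` {(w, i). w \<in> J \<and> i \<le> n \<and> affine hull set (facet i w) \<noteq> H}"
  have small: "affine (L \<inter> H) \<and> aff_dim (L \<inter> H) < int (n - 1)" if "affine L" "\<not> H \<subseteq> L" for L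
  proof -
    have *: "affine (L \<inter> H)" using that(1) affH by (simp add: affine_Int)
    moreover have "aff_dim (L \<inter> H) < aff_dim H"
      using aff_dim_psubset[of "L \<inter> H" H] that(2) * affH by (auto simp: hull_same affine_hull_eq)
    ultimately show ?thesis using dimH by simp
  qed
  have Hfacet: "\<not> H \<subseteq> affine hull set (facet i w)" if "w \<in> J" "i \<le> n" "affine hull set (facet i w) \<noteq> H" for w i
  proof
    assume "H \<subseteq> affine hull set (facet i w)"
    moreover have "aff_dim (affine hull set (facet i w)) = int (n - 1)"
      using aff_dim_ordered_simplex[OF facet_ordered_simplex[OF Jw(1)[OF that(1)] n that(2)]] by simp
    ultimately have "H = affine hull set (facet i w)"
      using affH dimH by (intro affine_dim_equal) auto
    then show False using that by simp
  qed
  have "finite E'"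
    unfolding E'_def using E(1) fin by (auto intro: finite_index)
  moreover have "\<forall>L\<in>E'. affine L \<and> aff_dim L < int (n - 1)"
  proof
    fix L assume "L \<in> E'"
    then consider (1) M where "M \<in> E" "\<not> H \<subseteq> M" "L = M \<inter> H"
      | (2) w i where "w \<in> J" "i \<le> n" "affine hull set (facet i w) \<noteq> H"
          "L = affine hull set (facet i w) \<inter> H"
      unfolding E'_def by blast
    then show "affine L \<and> aff_dim L < int (n - 1)"
    proof cases
      case 1
      then show ?thesis using small[OF E(2)] by simp
    next
      case 2
      then show ?thesis using small[OF affine_affine_hull Hfacet] by simp
    qed
  qed
  moreover have "(\<Sum>u\<in>facets_in n J H. of_int (facet_coeff n J c u) * sgn (orient_det B u) * indicator (convex hull set u) x) = (0::real)"
    if B: "length B = n - 1" and x: "x \<in> H - \<Union>E'" for B x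
  proof -
    define y where "y s = (1 - s) *\<^sub>R x + s *\<^sub>R q" for s :: real
    have xP: "x \<in> P" "h x = 0" using x H by auto
    have y_minus: "y (- s) = (1 + s) *\<^sub>R x - s *\<^sub>R q" for s by (simp add: y_def)
    have hy: "h (y s) = s" for s
      using bary_line[OF Jw(1)[OF w0(1)], of i0 s x q] xP q by (simp add: h_def y_def)
    have "affine P" using Jw(2)[OF w0(1)] by auto
    then have yP: "y s \<in> P" for s using xP q by (auto simp: affine_def y_def)
    have gen: "x \<notin> affine hull set (facet i w)" if "w \<in> J" "i \<le> n" "affine hull set (facet i w) \<noteq> H" for w i
      using x that by (auto simp: E'_def)
    have avoid: "eventually (\<lambda>t. y t \<notin> L \<and> y (- t) \<notin> L) (at_right 0)" if L: "L \<in> E" for L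
    proof (cases "x \<in> L")
      case False
      have "closed L" using E(2)[OF L] by (rule affine_closed)
      have 1: "(y \<longlongrightarrow> (1 - 0) *\<^sub>R x + 0 *\<^sub>R q) (at_right 0)" unfolding y_def by (intro tendsto_intros)
      have 2: "((\<lambda>t. y (- t)) \<longlongrightarrow> (1 - (- 0)) *\<^sub>R x + (- 0) *\<^sub>R q) (at_right 0)" unfolding y_def by (intro tendsto_intros)
      have op: "open (- L)" "x \<in> - L" using \<open>closed L\<close> False by auto
      show ?thesis
        using eventually_conj[OF topological_tendstoD[OF 1 op(1)] topological_tendstoD[OF 2 op(1)]] op(2)
        by simp
    next
      case True
      \<comment> \<open>Such an \<open>L\<close> equals \<open>H\<close> by dimension, and
        \<open>h (y t) = t\<close> shows that the line leaves it at once.\<close>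
      then have HL: "H \<subseteq> L" using x L by (auto simp: E'_def)
      then have "aff_dim H = aff_dim L"
        using aff_dim_subset[OF HL] E(3)[OF L] dimH n by linarith
      then have "H = L" using affine_dim_equal[OF affH E(2)[OF L] _ HL] x by auto
      then have "y t \<notin> L" if "t \<noteq> 0" for t using hy[of t] H that by auto
      then show ?thesis
        by (auto simp: eventually_at_filter)
    qed
    have e1: "eventually (\<lambda>t. \<forall>L\<in>E. y t \<notin> L \<and> y (- t) \<notin> L) (at_right 0)"
      by (rule eventually_ball_finite[OF E(1)]) (use avoid in blast)
    have e2: "eventually (\<lambda>t. \<forall>z\<in>{(w, i). w \<in> J \<and> i \<le> n \<and> bary w i x \<noteq> 0}.
         sgn ((1 - t) * bary (fst z) (snd z) x + t * bary (fst z) (snd z) q) = sgn (bary (fst z) (snd z) x) \<and>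
         sgn ((1 + t) * bary (fst z) (snd z) x - t * bary (fst z) (snd z) q) = sgn (bary (fst z) (snd z) x)) (at_right 0)"
      by (intro eventually_ball_finite finite_index[OF fin] ballI eventually_sgn_line) auto
    from eventually_happens'[OF _ eventually_conj[OF eventually_at_right_less eventually_conj[OF e1 e2]]]
    obtain t where t: "0 < t" "\<forall>L\<in>E. y t \<notin> L \<and> y (- t) \<notin> L"
       "\<And>w i. w \<in> J \<Longrightarrow> i \<le> n \<Longrightarrow> bary w i x \<noteq> 0 \<Longrightarrow>
         sgn ((1 - t) * bary w i x + t * bary w i q) = sgn (bary w i x) \<and>
         sgn ((1 + t) * bary w i x - t * bary w i q) = sgn (bary w i x)"
      by auto
    let ?T = "{(w, i). w \<in> J \<and> i \<le> n \<and> affine hull set (facet i w) = H}"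
    let ?f = "\<lambda>(w, i). facet i w"
    let ?\<phi> = "\<lambda>u. sgn (orient_det B u) * indicator (convex hull set u) x :: real"
    have "(\<Sum>u\<in>facets_in n J H. of_int (facet_coeff n J c u) * sgn (orient_det B u) * indicator (convex hull set u) x)
      = (\<Sum>u\<in>?f ` ?T. \<Sum>z\<in>{z \<in> ?T. ?f z = u}. of_int ((- 1) ^ snd z * c (fst z)) * ?\<phi> (?f z))"
      unfolding facets_in_image
    proof (rule sum.cong[OF refl])
      fix u assume "u \<in> ?f ` ?T"
      then have "{(w, i). w \<in> J \<and> i \<le> n \<and> facet i w = u} = {z \<in> ?T. ?f z = u}" by auto
      then have "of_int (facet_coeff n J c u) * ?\<phi> u
          = (\<Sum>z\<in>{z \<in> ?T. ?f z = u}. of_int ((- 1) ^ snd z * c (fst z)) * ?\<phi> u)"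
        by (simp add: facet_coeff_def case_prod_unfold sum_distrib_right)
      also have "\<dots> = (\<Sum>z\<in>{z \<in> ?T. ?f z = u}. of_int ((- 1) ^ snd z * c (fst z)) * ?\<phi> (?f z))"
        by (rule sum.cong) auto
      finally show "of_int (facet_coeff n J c u) * sgn (orient_det B u) * indicator (convex hull set u) x
        = (\<Sum>z\<in>{z \<in> ?T. ?f z = u}. of_int ((- 1) ^ snd z * c (fst z)) * ?\<phi> (?f z))"
        by (simp add: mult.assoc)
    qed
    also have "\<dots> = (\<Sum>z\<in>?T. of_int ((- 1) ^ snd z * c (fst z)) * ?\<phi> (?f z))"
      by (rule sum.image_gen[symmetric]) (rule finite_index[OF fin])
    also have "?T = Sigma J (\<lambda>w. {i. i \<le> n \<and> affine hull set (facet i w) = H})" by auto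
    also have "(\<Sum>z\<in>\<dots>. of_int ((- 1) ^ snd z * c (fst z)) * ?\<phi> (?f z))
      = (\<Sum>w\<in>J. \<Sum>i\<in>{i. i \<le> n \<and> affine hull set (facet i w) = H}.
          of_int ((- 1) ^ i * c w) * ?\<phi> (facet i w))"
      using fin by (subst sum.Sigma) (auto simp: case_prod_unfold)
    also have "\<dots> = (\<Sum>w\<in>J. of_int (c w) * (sgn (orient_det (g # B) w) *
        (indicator (convex hull set w) (y (- t)) - indicator (convex hull set w) (y t))))"
    proof (rule sum.cong[OF refl])
      fix w assume w: "w \<in> J"
      have "(\<Sum>i\<in>{i. i \<le> n \<and> affine hull set (facet i w) = H}.
          (- 1) ^ i * sgn (orient_det B (facet i w)) * indicator (convex hull set (facet i w)) x)
        = sgn (orient_det (g # B) w) * (indicator (convex hull set w) (y (- t)) - (indicator (convex hull set w) (y t) :: real))"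
        unfolding y_minus unfolding y_def
        by (rule indicator_jump[where h = h and P = P and c = c0])
          (use Jw[OF w] B n xP q h H t(1) t(3)[OF w] gen[OF w] in auto)
      then show "(\<Sum>i\<in>{i. i \<le> n \<and> affine hull set (facet i w) = H}.
          of_int ((- 1) ^ i * c w) * ?\<phi> (facet i w)) = of_int (c w) * (sgn (orient_det (g # B) w) *
        (indicator (convex hull set w) (y (- t)) - indicator (convex hull set w) (y t)))"
        by (simp add: sum_distrib_left[symmetric] mult.assoc mult.left_commute[of _ "of_int (c w)"] flip: sum_distrib_left)
    qed
    also have "\<dots> = (\<Sum>w\<in>J. of_int (c w) * sgn (orient_det (g # B) w) * indicator (convex hull set w) (y (- t)))
       - (\<Sum>w\<in>J. of_int (c w) * sgn (orient_det (g # B) w) * indicator (convex hull set w) (y t))"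
      by (simp add: right_diff_distrib sum_subtractf mult.assoc)
    also have "\<dots> = 0"
      using Ev[of "g # B" "y t"] Ev[of "g # B" "y (- t)"] B n yP t(2) by auto
    finally show ?thesis .
  qed
  ultimately show ?thesis unfolding vanishing_def by blast
qed

lemma frag_cmul_sum_left: "finite A \<Longrightarrow> frag_cmul (sum f A) x = (\<Sum>a\<in>A. frag_cmul (f a) x)"
  by (induction A rule: finite_induct) (auto simp: frag_cmul_distrib)

lemma simplices_in_facets:
  assumes "simplices_in n P J" "0 < n"
  shows "simplices_in (n - 1) H (facets_in n J H)"
  using assms finite_index[of J n] facet_ordered_simplex[of _ n]
  unfolding simplices_in_def facets_in_image by auto

text \<open>Pairs of a simplex and an index are grouped by the facet, then facets by the plane they
  span. This lets the induction hypothesis act on one hyperplane at a time.\<close>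

lemma boundary_sum_eq:
  assumes "simplices_in n P J"
  shows "(\<Sum>w\<in>J. frag_cmul (c w) (list_boundary w)) =
    (\<Sum>H\<in>(\<lambda>(w, i). affine hull set (facet i w)) ` (J \<times> {..n}).
      \<Sum>u\<in>facets_in n J H. frag_cmul (facet_coeff n J c u) (frag_of u))"
proof -
  let ?T = "J \<times> {..n}" and ?f = "\<lambda>(w, i). facet i w" and ?h = "\<lambda>u. affine hull set u"
  let ?g = "\<lambda>z. frag_cmul ((- 1) ^ snd z * c (fst z)) (frag_of (?f z))"
  have fin: "finite J" and len: "\<And>w. w \<in> J \<Longrightarrow> length w = Suc n"
    using assms by (auto simp: simplices_in_def length_ordered_simplex)
  have "(\<Sum>w\<in>J. frag_cmul (c w) (list_boundary w)) = (\<Sum>w\<in>J. \<Sum>i\<le>n. ?g (w, i))"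
    by (rule sum.cong)
       (simp_all add: list_boundary_def len lessThan_Suc_atMost frag_cmul_sum mult.commute)
  also have "\<dots> = (\<Sum>z\<in>?T. ?g z)"
    by (simp add: sum.cartesian_product case_prod_unfold)
  also have "\<dots> = (\<Sum>u\<in>?f ` ?T. \<Sum>z\<in>{z \<in> ?T. ?f z = u}. ?g z)"
    using fin by (intro sum.image_gen) auto
  also have "\<dots> = (\<Sum>u\<in>?f ` ?T. frag_cmul (facet_coeff n J c u) (frag_of u))"
  proof (rule sum.cong[OF refl])
    fix u
    have *: "{(w, i). w \<in> J \<and> i \<le> n \<and> facet i w = u} = {z \<in> ?T. ?f z = u}" by auto
    have "finite {z \<in> ?T. ?f z = u}" using fin by auto
    then have "frag_cmul (facet_coeff n J c u) (frag_of u)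
        = (\<Sum>z\<in>{z \<in> ?T. ?f z = u}. frag_cmul ((- 1) ^ snd z * c (fst z)) (frag_of u))"
      unfolding facet_coeff_def * by (simp add: frag_cmul_sum_left case_prod_unfold)
    also have "\<dots> = (\<Sum>z\<in>{z \<in> ?T. ?f z = u}. ?g z)"
      by (rule sum.cong) auto
    finally show "(\<Sum>z\<in>{z \<in> ?T. ?f z = u}. ?g z) = frag_cmul (facet_coeff n J c u) (frag_of u)" ..
  qed
  also have "\<dots> = (\<Sum>H\<in>?h ` ?f ` ?T. \<Sum>u\<in>{u \<in> ?f ` ?T. ?h u = H}. frag_cmul (facet_coeff n J c u) (frag_of u))"
    using fin by (intro sum.image_gen) auto
  also have "?h ` ?f ` ?T = (\<lambda>(w, i). affine hull set (facet i w)) ` ?T"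
    by (auto simp: image_image case_prod_unfold)
  also have "(\<Sum>H\<in>\<dots>. \<Sum>u\<in>{u \<in> ?f ` ?T. ?h u = H}. frag_cmul (facet_coeff n J c u) (frag_of u))
     = (\<Sum>H\<in>\<dots>. \<Sum>u\<in>facets_in n J H. frag_cmul (facet_coeff n J c u) (frag_of u))"
  proof (rule sum.cong[OF refl])
    fix H
    have "{u \<in> ?f ` ?T. ?h u = H} = facets_in n J H" by (auto simp: facets_in_def)
    then show "(\<Sum>u\<in>{u \<in> ?f ` ?T. ?h u = H}. frag_cmul (facet_coeff n J c u) (frag_of u))
      = (\<Sum>u\<in>facets_in n J H. frag_cmul (facet_coeff n J c u) (frag_of u))" by simp
  qed
  finally show ?thesis .
qed

text \<open>A chain with vanishing indicator is the cone over its boundary, and the boundary restricted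
  to each hyperplane again has vanishing indicator.\<close>

lemma vanishing_imp_null:
  assumes "simplices_in n P J" "vanishing n P J c"
  shows "(\<Sum>w\<in>J. frag_cmul (c w) (frag_of w)) \<in> null_chains n"
    and "0 < n \<Longrightarrow> (\<Sum>w\<in>J. frag_cmul (c w) (list_boundary w)) \<in> null_chains (n - 1)"
proof -
  have "(\<Sum>w\<in>J. frag_cmul (c w) (frag_of w)) \<in> null_chains n \<and>
    (0 < n \<longrightarrow> (\<Sum>w\<in>J. frag_cmul (c w) (list_boundary w)) \<in> null_chains (n - 1))"
    using assms
  proof (induction n arbitrary: P J c)
    case 0
    show ?case
    proof (cases "J = {}")
      case True
      then show ?thesis by (simp add: null_chains.zero)
    next
      case False
      then obtain w where w: "w \<in> J" by blast
      have sing: "\<exists>a. v = [a] \<and> P = {a}" if "v \<in> J" for v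
      proof -
        have "length v = Suc 0"
          using 0(1) that length_ordered_simplex[of v 0] by (simp add: simplices_in_def)
        then obtain a where "v = [a]" by (auto simp: length_Suc_conv)
        moreover have "affine hull set v = P" using 0(1) that by (auto simp: simplices_in_def)
        ultimately show ?thesis by auto
      qed
      then obtain a where a: "w = [a]" "P = {a}" using w by blast
      have J: "J = {[a]}"
      proof -
        have "v = [a]" if "v \<in> J" for v using sing[OF that] a(2) by auto
        then show ?thesis using w a by blast
      qed
      obtain E where E: "\<And>L. L \<in> E \<Longrightarrow> aff_dim L < int 0"
        "\<And>B x. length B = 0 \<Longrightarrow> x \<in> P - \<Union>E \<Longrightarrow>
        (\<Sum>w\<in>J. of_int (c w) * sgn (orient_det B w) * indicator (convex hull set w) x) = (0::real)"
        using 0(2) unfolding vanishing_def by blast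
      \<comment> \<open>Affine sets of negative dimension are empty, so the only point of
        \<open>P\<close> is generic and its coefficient must be 0.\<close>
      have "\<Union>E = {}" using E(1) by auto
      then have "a \<in> P - \<Union>E" using a(2) by blast
      then have "(\<Sum>w\<in>J. of_int (c w) * sgn (orient_det [] w) * indicator (convex hull set w) a) = (0::real)"
        using E(2)[of "[]" a] by simp
      then have "c [a] = 0"
        unfolding J by (simp add: orient_det_edges edge_mat_def)
      then show ?thesis unfolding J by (simp add: null_chains.zero)
    qed
  next
    case (Suc n)
    have "(\<Sum>u\<in>facets_in (Suc n) J H. frag_cmul (facet_coeff (Suc n) J c u) (frag_of u)) \<in> null_chains n" for H
      using Suc.IH[of H "facets_in (Suc n) J H" "facet_coeff (Suc n) J c"]
        simplices_in_facets[OF Suc.prems(1)] vanishing_facets[OF Suc.prems(1) _ Suc.prems(2)] by simp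
    then have bd: "(\<Sum>w\<in>J. frag_cmul (c w) (list_boundary w)) \<in> null_chains n"
      unfolding boundary_sum_eq[OF Suc.prems(1)] by (rule null_chains_sum)
    have "(\<Sum>w\<in>J. frag_cmul (c w) (frag_of w)) \<in> null_chains (Suc n)"
    proof (cases "P = {}")
      case True
      have "v = []" if "v \<in> J" for v
        using Suc.prems(1) that True hull_subset[of "set v" affine] by (auto simp: simplices_in_def)
      then have "J = {}" using Suc.prems(1) length_ordered_simplex by (fastforce simp: simplices_in_def)
      then show ?thesis by (simp add: null_chains.zero)
    next
      case False
      then obtain p where p: "p \<in> P" by blast
      have "(\<Sum>w\<in>J. frag_cmul (c w) (frag_of w - cone_chain p (list_boundary w))) \<in> null_chains (Suc n)"
      proof (rule null_chains_sum, rule null_chains_cmul)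
        fix w assume "w \<in> J"
        then have "w \<in> ordered_simplices (Suc n)" "affine hull set w = P"
          using Suc.prems(1) by (auto simp: simplices_in_def)
        then show "frag_of w - cone_chain p (list_boundary w) \<in> null_chains (Suc n)"
          using p by (intro cone_chain_boundary) auto
      qed
      moreover have "cone_chain p (\<Sum>w\<in>J. frag_cmul (c w) (list_boundary w)) \<in> null_chains (Suc n)"
        using bd by (rule cone_chain_null_chains)
      ultimately have "(\<Sum>w\<in>J. frag_cmul (c w) (frag_of w - cone_chain p (list_boundary w)))
         + cone_chain p (\<Sum>w\<in>J. frag_cmul (c w) (list_boundary w)) \<in> null_chains (Suc n)"
        by (rule null_chains_add)
      moreover have "finite J" using Suc.prems(1) by (simp add: simplices_in_def)
      ultimately show ?thesis
        by (simp add: cone_chain_def frag_extend_sum frag_extend_cmul o_def frag_cmul_diff_right sum_subtractf)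
    qed
    then show ?case using bd by simp
  qed
  then show "(\<Sum>w\<in>J. frag_cmul (c w) (frag_of w)) \<in> null_chains n"
    "0 < n \<Longrightarrow> (\<Sum>w\<in>J. frag_cmul (c w) (list_boundary w)) \<in> null_chains (n - 1)"
    by blast+
qed

section \<open>Hausdorff measure of simplices\<close>

lemma hausdorff_measure_mono: "S \<subseteq> T \<Longrightarrow> hausdorff_measure k S \<le> hausdorff_measure k T"
  unfolding hausdorff_measure_def by (intro SUP_mono' INF_superset_mono) auto

lemma hausdorff_measure_le:
  assumes "\<And>\<delta>. 0 < \<delta> \<Longrightarrow> \<exists>C. S \<subseteq> (\<Union>i. C i) \<and> (\<forall>i. bounded (C i) \<and> diameter (C i) \<le> \<delta>) \<and>
    suminf (\<lambda>i. if C i = {} then 0 else ennreal (unit_ball_vol (real k) * (diameter (C i) / 2) ^ k)) \<le> K"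
  shows "hausdorff_measure k S \<le> K"
  unfolding hausdorff_measure_def
proof (rule SUP_least)
  fix \<delta> :: real assume "\<delta> \<in> {0<..}"
  then obtain C where "S \<subseteq> (\<Union>i. C i) \<and> (\<forall>i. bounded (C i) \<and> diameter (C i) \<le> \<delta>) \<and>
    suminf (\<lambda>i. if C i = {} then 0 else ennreal (unit_ball_vol (real k) * (diameter (C i) / 2) ^ k)) \<le> K"
    using assms[of \<delta>] unfolding greaterThan_iff by blast
  then show "(INF C\<in>{C. S \<subseteq> (\<Union>i. C i) \<and> (\<forall>i. bounded (C i) \<and> diameter (C i) \<le> \<delta>)}.
      suminf (\<lambda>i. if C i = {} then 0 else ennreal (unit_ball_vol (real k) * (diameter (C i) / 2) ^ k))) \<le> K"
    by (intro INF_lower2[of C]) auto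
qed

text \<open>Rounding down the coefficients of the edges at the first vertex to multiples of \<open>1/N\<close>.\<close>

lemma convex_hull_grid_cover:
  fixes ws :: "'a::euclidean_space list"
  assumes len: "length ws = Suc j" and N: "0 < N"
    and D: "D = (\<Sum>i<j. norm (ws ! Suc i - ws ! 0))"
  shows "\<exists>C. convex hull set ws \<subseteq> (\<Union>i. C i) \<and> (\<forall>i. bounded (C i) \<and> diameter (C i) \<le> D / real N) \<and>
    suminf (\<lambda>i. if C i = {} then 0 else ennreal (unit_ball_vol (real k) * (diameter (C i) / 2) ^ k))
      \<le> ennreal (real (Suc N ^ j) * (unit_ball_vol (real k) * (D / real N / 2) ^ k))"
proof -
  define e where "e i = ws ! Suc i - ws ! 0" for i
  \<comment> \<open>The value \<open>N\<close> is included because a coefficient equal to 1 rounds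
    down to \<open>N / N\<close>; hence \<open>Suc N ^ j\<close> cells.\<close>
  define F where "F = PiE {..<j} (\<lambda>_. {..N})"
  define B where "B f = {ws ! 0 + (\<Sum>i<j. a i *\<^sub>R e i) |a.
      \<forall>i<j. real (f i) / N \<le> a i \<and> a i \<le> (real (f i) + 1) / N}" for f :: "nat \<Rightarrow> nat"
  have D0: "0 \<le> D" unfolding D by (simp add: sum_nonneg)
  have dist: "dist x y \<le> D / N" if xy: "x \<in> B f" "y \<in> B f" for f x y
  proof -
    obtain a b where a: "x = ws ! 0 + (\<Sum>i<j. a i *\<^sub>R e i)" "\<forall>i<j. real (f i) / N \<le> a i \<and> a i \<le> (real (f i) + 1) / N"
      and b: "y = ws ! 0 + (\<Sum>i<j. b i *\<^sub>R e i)" "\<forall>i<j. real (f i) / N \<le> b i \<and> b i \<le> (real (f i) + 1) / N"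
      using xy unfolding B_def by blast
    have "dist x y = norm (\<Sum>i<j. (a i - b i) *\<^sub>R e i)"
      by (simp add: a b dist_norm scaleR_diff_left sum_subtractf)
    also have "\<dots> \<le> (\<Sum>i<j. norm ((a i - b i) *\<^sub>R e i))" by (rule norm_sum)
    also have "\<dots> \<le> (\<Sum>i<j. (1 / N) * norm (e i))"
    proof (rule sum_mono)
      fix i assume i: "i \<in> {..<j}"
      have "real (f i) / N \<le> a i" "a i \<le> real (f i) / N + 1 / N"
        "real (f i) / N \<le> b i" "b i \<le> real (f i) / N + 1 / N"
        using a(2) b(2) i by (auto simp: add_divide_distrib)
      then have "\<bar>a i - b i\<bar> \<le> 1 / N" by linarith
      then show "norm ((a i - b i) *\<^sub>R e i) \<le> (1 / N) * norm (e i)"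
        unfolding norm_scaleR by (rule mult_right_mono) simp
    qed
    also have "\<dots> = D / N" by (simp add: D e_def sum_divide_distrib)
    finally show ?thesis .
  qed
  have bnd: "bounded (B f)" for f
    unfolding bounded_two_points using dist by blast
  have diam: "diameter (B f) \<le> D / N" for f
    using dist D0 by (intro diameter_le) (auto simp: dist_norm)
  have cover: "convex hull set ws \<subseteq> (\<Union>f\<in>F. B f)"
  proof
    fix x assume "x \<in> convex hull set ws"
    then obtain u where u: "\<forall>v\<in>set ws. 0 \<le> u v" "sum u (set ws) = 1" "(\<Sum>v\<in>set ws. u v *\<^sub>R v) = x"
      using convex_hull_finite[of "set ws"] by auto
    \<comment> \<open>The list may repeat points. The convex coefficient of a point is assigned to
      its first position and the other positions get 0.\<close>
    define idx where "idx v = (LEAST i. ws ! i = v \<and> i < Suc j)" for v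
    have idx: "ws ! idx v = v \<and> idx v < Suc j" if v: "v \<in> set ws" for v
    proof -
      obtain i where "ws ! i = v \<and> i < Suc j" using v len by (auto simp: in_set_conv_nth)
      then show ?thesis unfolding idx_def by (rule LeastI)
    qed
    define a where "a i = (if idx (ws ! Suc i) = Suc i then u (ws ! Suc i) else 0)" for i
    have injs: "inj_on idx (set ws)" using idx by (metis inj_onI)
    have ab: "0 \<le> a i \<and> a i \<le> 1" if "i < j" for i
    proof -
      have "ws ! Suc i \<in> set ws" using that len by simp
      then have "u (ws ! Suc i) \<le> sum u (set ws)" using u(1) by (intro member_le_sum) auto
      then show ?thesis using u \<open>ws ! Suc i \<in> set ws\<close> by (auto simp: a_def)
    qed
    have "x - ws ! 0 = (\<Sum>v\<in>set ws. u v *\<^sub>R (v - ws ! 0))"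
      using u by (simp add: scaleR_diff_right sum_subtractf flip: scaleR_left.sum)
    also have "\<dots> = (\<Sum>v\<in>set ws. u (ws ! idx v) *\<^sub>R (ws ! idx v - ws ! 0))"
      by (rule sum.cong) (auto simp: idx)
    also have "\<dots> = (\<Sum>i\<in>idx ` set ws. u (ws ! i) *\<^sub>R (ws ! i - ws ! 0))"
      using injs by (simp add: sum.reindex)
    also have "\<dots> = (\<Sum>i<Suc j. if i \<in> idx ` set ws then u (ws ! i) *\<^sub>R (ws ! i - ws ! 0) else 0)"
      using idx by (intro sum.mono_neutral_cong_left) auto
    also have "\<dots> = (\<Sum>i<j. if Suc i \<in> idx ` set ws then u (ws ! Suc i) *\<^sub>R e i else 0)"
      unfolding sum.lessThan_Suc_shift e_def by simp
    also have "\<dots> = (\<Sum>i<j. a i *\<^sub>R e i)"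
    proof (rule sum.cong[OF refl])
      fix i assume "i \<in> {..<j}"
      then have mem: "ws ! Suc i \<in> set ws" using len by simp
      have "Suc i \<in> idx ` set ws \<longleftrightarrow> idx (ws ! Suc i) = Suc i"
      proof
        assume "Suc i \<in> idx ` set ws"
        then obtain v where "v \<in> set ws" "Suc i = idx v" by blast
        then show "idx (ws ! Suc i) = Suc i" using idx[of v] by simp
      next
        assume "idx (ws ! Suc i) = Suc i"
        then show "Suc i \<in> idx ` set ws" using mem by (metis image_eqI)
      qed
      then show "(if Suc i \<in> idx ` set ws then u (ws ! Suc i) *\<^sub>R e i else 0) = a i *\<^sub>R e i"
        by (simp add: a_def)
    qed
    finally have x: "x = ws ! 0 + (\<Sum>i<j. a i *\<^sub>R e i)" by (simp add: algebra_simps)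
    define f where "f = (\<lambda>i\<in>{..<j}. nat \<lfloor>a i * N\<rfloor>)"
    have "f \<in> F"
    proof -
      have "nat \<lfloor>a i * N\<rfloor> \<le> N" if "i < j" for i
      proof -
        have "a i * N \<le> 1 * real N" using ab[OF that] by (intro mult_right_mono) auto
        then have "\<lfloor>a i * N\<rfloor> \<le> int N" by (simp add: floor_le_iff)
        then show ?thesis by simp
      qed
      then show ?thesis by (auto simp: f_def F_def)
    qed
    moreover have "x \<in> B f"
    proof -
      have "real (f i) / N \<le> a i \<and> a i \<le> (real (f i) + 1) / N" if "i < j" for i
      proof -
        have "0 \<le> a i * N" using ab[OF that] by simp
        then have "real (f i) = of_int \<lfloor>a i * N\<rfloor>" using that by (simp add: f_def)
        then have "real (f i) \<le> a i * N" "a i * N \<le> real (f i) + 1" by linarith+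
        then show ?thesis using N by (simp add: field_simps)
      qed
      then show ?thesis unfolding B_def x by blast
    qed
    ultimately show "x \<in> (\<Union>f\<in>F. B f)" by blast
  qed
  have finF: "finite F" by (simp add: F_def finite_PiE)
  have cardF: "card F = Suc N ^ j" by (simp add: F_def card_PiE)
  obtain g where g: "bij_betw g {..<card F} F"
    using ex_bij_betw_nat_finite[OF finF] by (auto simp: lessThan_atLeast0)
  define C where "C i = (if i < card F then B (g i) else {})" for i
  let ?K = "unit_ball_vol (real k) * (D / real N / 2) ^ k"
  let ?t = "\<lambda>i. if C i = {} then 0 else ennreal (unit_ball_vol (real k) * (diameter (C i) / 2) ^ k)"
  have "suminf (\<lambda>i. ?t i) = (\<Sum>i<card F. ?t i)"
    by (rule suminf_finite) (auto simp: C_def)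
  also have "\<dots> \<le> (\<Sum>i<card F. ennreal ?K)"
  proof (rule sum_mono)
    fix i assume "i \<in> {..<card F}"
    have "bounded (C i)" "diameter (C i) \<le> D / N" using bnd diam D0 by (auto simp: C_def)
    then have "(diameter (C i) / 2) ^ k \<le> (D / N / 2) ^ k"
      by (intro power_mono) (auto simp: diameter_ge_0)
    then have "unit_ball_vol (real k) * (diameter (C i) / 2) ^ k \<le> ?K"
      by (intro mult_left_mono) auto
    then show "?t i \<le> ennreal ?K" by (auto intro: ennreal_leI)
  qed
  also have "\<dots> = ennreal (real (Suc N ^ j) * ?K)"
    using D0 by (simp add: cardF ennreal_mult'' ennreal_of_nat_eq_real_of_nat)
  finally have "suminf (\<lambda>i. ?t i) \<le> ennreal (real (Suc N ^ j) * ?K)" .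
  moreover have "convex hull set ws \<subseteq> (\<Union>i. C i)"
  proof
    fix x assume "x \<in> convex hull set ws"
    then obtain f where f: "f \<in> F" "x \<in> B f" using cover by blast
    have "f \<in> g ` {..<card F}" using f bij_betw_imp_surj_on[OF g] by simp
    then obtain i where "i < card F" "g i = f" by blast
    then show "x \<in> (\<Union>i. C i)" using f(2) by (auto simp: C_def intro!: exI[of _ i])
  qed
  ultimately show ?thesis using bnd diam D0 by (intro exI[of _ C]) (auto simp: C_def)
qed

text \<open>The grid has \<open>Suc N ^ j\<close> cells of diameter at most \<open>D / N\<close>. In
  dimension \<open>j\<close> the total stays bounded; in dimension \<open>Suc j\<close> a further
  factor \<open>D / N\<close> sends it to 0.\<close>

lemma hausdorff_measure_convex_hull_finite:
  fixes ws :: "'a::euclidean_space list"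
  assumes len: "length ws = Suc j"
  shows "hausdorff_measure j (convex hull set ws) < \<infinity>"
    and "hausdorff_measure (Suc j) (convex hull set ws) = 0"
proof -
  define D where "D = (\<Sum>i<j. norm (ws ! Suc i - ws ! 0))"
  have D0: "0 \<le> D" unfolding D_def by (simp add: sum_nonneg)
  have fine: "\<exists>N>0. D / real N \<le> \<delta> \<and> c / real N \<le> \<epsilon>" if "0 < \<delta>" "0 < \<epsilon>" for \<delta> \<epsilon> c :: real
  proof -
    obtain N where N: "D / \<delta> + \<bar>c\<bar> / \<epsilon> < real N" using reals_Archimedean2 by blast
    have 1: "0 \<le> D / \<delta>" "0 \<le> \<bar>c\<bar> / \<epsilon>" using D0 that by auto
    then have "0 < N" "D / \<delta> \<le> N" "\<bar>c\<bar> / \<epsilon> \<le> N" using N by linarith+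
    then show ?thesis using that by (intro exI[of _ N]) (auto simp: field_simps)
  qed
  \<comment> \<open>The estimate \<open>Suc N \<le> 2 * N\<close> costs a factor 2, which cancels
    the halving of the diameter.\<close>
  have grow: "real (Suc N ^ j) * (D / real N / 2) ^ j \<le> D ^ j" if "0 < N" for N
  proof -
    have "real (Suc N ^ j) * (D / real N / 2) ^ j = (real (Suc N) * (D / real N / 2)) ^ j"
      by (simp only: power_mult_distrib of_nat_power)
    also have "\<dots> \<le> D ^ j"
    proof (rule power_mono)
      have "real (Suc N) \<le> 2 * real N" using that by simp
      then have "real (Suc N) * (D / real N / 2) \<le> (2 * real N) * (D / real N / 2)"
        using D0 by (intro mult_right_mono) auto
      then show "real (Suc N) * (D / real N / 2) \<le> D" using that by simp
    qed (use D0 in auto)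
    finally show ?thesis .
  qed
  have "hausdorff_measure j (convex hull set ws) \<le> ennreal (unit_ball_vol (real j) * D ^ j)"
  proof (rule hausdorff_measure_le)
    fix \<delta> :: real assume "0 < \<delta>"
    then obtain N where N: "0 < N" "D / real N \<le> \<delta>" using fine[of \<delta> 1 0] by auto
    have "real (Suc N ^ j) * (unit_ball_vol (real j) * (D / real N / 2) ^ j) \<le> unit_ball_vol (real j) * D ^ j"
      using mult_left_mono[OF grow[OF N(1)], of "unit_ball_vol (real j)"] by (simp add: mult_ac)
    then show "\<exists>C. convex hull set ws \<subseteq> (\<Union>i. C i) \<and> (\<forall>i. bounded (C i) \<and> diameter (C i) \<le> \<delta>) \<and>
      suminf (\<lambda>i. if C i = {} then 0 else ennreal (unit_ball_vol (real j) * (diameter (C i) / 2) ^ j))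
        \<le> ennreal (unit_ball_vol (real j) * D ^ j)"
      using convex_hull_grid_cover[OF len N(1) D_def, of j] N(2)
      by (meson ennreal_leI order_trans)
  qed
  then show "hausdorff_measure j (convex hull set ws) < \<infinity>"
    by (metis ennreal_less_top infinity_ennreal_def order_le_less_trans)
  have "hausdorff_measure (Suc j) (convex hull set ws) \<le> ennreal \<epsilon>" if \<epsilon>: "0 < \<epsilon>" for \<epsilon>
  proof (rule hausdorff_measure_le)
    fix \<delta> :: real assume "0 < \<delta>"
    let ?c = "unit_ball_vol (real (Suc j)) * D ^ Suc j / 2"
    obtain N where N: "0 < N" "D / real N \<le> \<delta>" "?c / real N \<le> \<epsilon>" using fine[OF \<open>0 < \<delta>\<close> \<epsilon>] by blast
    have "real (Suc N ^ j) * (unit_ball_vol (real (Suc j)) * (D / real N / 2) ^ Suc j)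
      = (real (Suc N ^ j) * (D / real N / 2) ^ j) * (unit_ball_vol (real (Suc j)) * (D / real N / 2))"
      by (simp only: power_Suc mult_ac)
    also have "\<dots> \<le> D ^ j * (unit_ball_vol (real (Suc j)) * (D / real N / 2))"
      using D0 by (intro mult_right_mono[OF grow[OF N(1)]]) auto
    also have "\<dots> = ?c / real N" by (simp add: mult_ac)
    finally have "real (Suc N ^ j) * (unit_ball_vol (real (Suc j)) * (D / real N / 2) ^ Suc j) \<le> \<epsilon>"
      using N(3) by linarith
    then show "\<exists>C. convex hull set ws \<subseteq> (\<Union>i. C i) \<and> (\<forall>i. bounded (C i) \<and> diameter (C i) \<le> \<delta>) \<and>
      suminf (\<lambda>i. if C i = {} then 0 else ennreal (unit_ball_vol (real (Suc j)) * (diameter (C i) / 2) ^ Suc j))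
        \<le> ennreal \<epsilon>"
      using convex_hull_grid_cover[OF len N(1) D_def, of "Suc j"] N(2)
      by (meson ennreal_leI order_trans)
  qed
  then have "hausdorff_measure (Suc j) (convex hull set ws) \<le> 0 + ennreal \<epsilon>" if "0 < \<epsilon>" for \<epsilon>
    using that by simp
  then have "hausdorff_measure (Suc j) (convex hull set ws) \<le> 0"
    by (rule ennreal_le_epsilon)
  then show "hausdorff_measure (Suc j) (convex hull set ws) = 0" by simp
qed

text \<open>Lower bound by Lebesgue measure: a linear map sends the edges to coordinate vectors, and a
  set of diameter \<open>d\<close> lies in a box with \<open>n\<close> sides of length \<open>2 L d\<close> and unit sides otherwise.\<close>

lemma hausdorff_measure_parallelepiped_pos:
  fixes E :: "'a::euclidean_space set"
  assumes E: "independent E" "card E = n" and n: "0 < n" and \<epsilon>: "0 < \<epsilon>"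
    and S: "\<And>a. (\<And>e. e \<in> E \<Longrightarrow> 0 \<le> a e \<and> a e \<le> \<epsilon>) \<Longrightarrow> x0 + (\<Sum>e\<in>E. a e *\<^sub>R e) \<in> S"
  shows "hausdorff_measure n S \<noteq> 0"
proof -
  have finE: "finite E" using E n by (simp add: card_ge_0_finite)
  define X where "X = extend_basis E"
  have X: "independent X" "span X = UNIV" "E \<subseteq> X"
    unfolding X_def using E(1) by (auto simp: independent_extend_basis extend_basis_superset span_extend_basis)
  have finX: "finite X" using X(1) by (rule finiteI_independent)
  have "dim (UNIV :: 'a set) = card X"
    by (rule dim_eq_card) (use X in auto)
  then have "card X = card (Basis :: 'a set)" by simp
  then obtain \<phi> where \<phi>: "bij_betw \<phi> X (Basis :: 'a set)"
    using finite_same_card_bij[OF finX finite_Basis] by blast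
  obtain T :: "'a \<Rightarrow> 'a" where T: "linear T" "\<And>x. x \<in> X \<Longrightarrow> T x = \<phi> x"
    using linear_independent_extend[OF X(1), of \<phi>] by blast
  obtain L where L: "0 < L" "\<And>x. norm (T x) \<le> L * norm x"
    using linear_bounded_pos[OF T(1)] by blast
  define B1 where "B1 = \<phi> ` E"
  have injE: "inj_on \<phi> E" by (rule inj_on_subset[OF bij_betw_imp_inj_on[OF \<phi>] X(3)])
  have B1: "B1 \<subseteq> Basis" "card B1 = n"
    using bij_betw_imp_surj_on[OF \<phi>] X(3) E(2) card_image[OF injE] unfolding B1_def by blast+
  \<comment> \<open>Coordinates in \<open>B1\<close> record the edge coefficients. Unit sides
    elsewhere reduce an estimate in dimension \<open>n\<close> to full-dimensional Lebesgue measure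
    without changing the volume.\<close>
  define Q :: "'a set" where "Q = cbox 0 (\<Sum>b\<in>Basis. (if b \<in> B1 then \<epsilon> else 1) *\<^sub>R b)"
  have comp: "inner (\<Sum>b\<in>Basis. f b *\<^sub>R b) b = f b" if "b \<in> Basis" for f and b :: 'a
    using that by (simp add: inner_sum_left_Basis)
  have prodB: "(\<Prod>b\<in>Basis. if b \<in> B1 then r else 1) = r ^ n" for r :: real
    using B1 by (simp add: prod.If_cases Int_absorb1)
  have emQ: "emeasure lborel Q = ennreal (\<epsilon> ^ n)"
    unfolding Q_def using \<epsilon> by (subst emeasure_lborel_cbox) (auto simp: comp prodB cong: prod.cong)
  let ?\<omega> = "unit_ball_vol (real n)"
  \<comment> \<open>The ratio between the weight of a nonempty covering set of diameter
    \<open>d\<close> and the volume \<open>(2 * L * d) ^ n\<close> of its box.\<close>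
  define \<kappa> where "\<kappa> = ?\<omega> / (4 * L) ^ n"
  have \<kappa>: "0 < \<kappa>" unfolding \<kappa>_def using L(1) by simp
  have lower: "ennreal (\<kappa> * \<epsilon> ^ n)
      \<le> suminf (\<lambda>i. if C i = {} then 0 else ennreal (?\<omega> * (diameter (C i) / 2) ^ n))"
    if C: "S \<subseteq> (\<Union>i. C i)" "\<And>i. bounded (C i)" for C :: "nat \<Rightarrow> 'a set"
  proof -
    define c where "c i = T ((SOME x. x \<in> C i) - x0)" for i
    define d where "d i = L * diameter (C i)" for i
    have d0: "0 \<le> d i" for i using L(1) C(2) by (simp add: d_def diameter_ge_0)
    define box where "box i = (if C i = {} then {} else
       cbox (\<Sum>b\<in>Basis. (if b \<in> B1 then inner (c i) b - d i else 0) *\<^sub>R b)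
            (\<Sum>b\<in>Basis. (if b \<in> B1 then inner (c i) b + d i else 1) *\<^sub>R b))" for i
    have embox: "emeasure lborel (box i) = (if C i = {} then 0 else ennreal ((2 * d i) ^ n))" for i
    proof -
      have "emeasure lborel (cbox (\<Sum>b\<in>Basis. (if b \<in> B1 then inner (c i) b - d i else 0) *\<^sub>R b)
            (\<Sum>b\<in>Basis. (if b \<in> B1 then inner (c i) b + d i else 1) *\<^sub>R b))
          = ennreal (\<Prod>b\<in>Basis. if b \<in> B1 then 2 * d i else 1)"
        using d0[of i] by (subst emeasure_lborel_cbox) (auto simp: comp inner_diff_left intro!: prod.cong arg_cong[where f = ennreal])
      then show ?thesis by (simp add: box_def prodB)
    qed
    have "Q \<subseteq> (\<Union>i. box i)"
    proof
      fix y assume "y \<in> Q"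
      then have y: "0 \<le> inner y b \<and> inner y b \<le> (if b \<in> B1 then \<epsilon> else 1)" if "b \<in> Basis" for b
        using that by (auto simp: Q_def mem_box comp)
      \<comment> \<open>Only the coordinates of \<open>y\<close> in \<open>B1\<close> are used. A
        covering set containing \<open>x\<close> has a box containing \<open>y\<close>, since the
        remaining coordinates are free in the unit interval.\<close>
      define x where "x = x0 + (\<Sum>e\<in>E. (inner y (\<phi> e)) *\<^sub>R e)"
      have "x \<in> S"
        unfolding x_def using y B1 by (intro S) (force simp: B1_def)
      then obtain i where i: "x \<in> C i" using C(1) by blast
      define s where "s = (SOME x. x \<in> C i)"
      have s: "s \<in> C i" unfolding s_def using i by (rule someI)
      have Tx: "inner (T (x - x0)) b = inner y b" if "b \<in> B1" for b
      proof -
        obtain e where e: "e \<in> E" "b = \<phi> e" using \<open>b \<in> B1\<close> by (auto simp: B1_def)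
        have "T (x - x0) = (\<Sum>e\<in>E. (inner y (\<phi> e)) *\<^sub>R \<phi> e)"
          using T X(3) by (auto simp: x_def linear_sum linear_scale intro!: sum.cong)
        also have "\<dots> = (\<Sum>b\<in>B1. (inner y b) *\<^sub>R b)"
          unfolding B1_def using injE by (simp add: sum.reindex)
        finally have "inner (T (x - x0)) b = (\<Sum>b'\<in>B1. (inner y b') * (inner b' b))" by (simp add: inner_sum_left)
        also have "\<dots> = (\<Sum>b'\<in>B1. if b' = b then inner y b else 0)"
          using B1 that by (intro sum.cong) (auto simp: inner_Basis subset_iff)
        also have "\<dots> = inner y b" using that finE by (simp add: B1_def)
        finally show ?thesis .
      qed
      have "\<bar>inner y b - inner (c i) b\<bar> \<le> d i" if "b \<in> B1" for b
      proof -
        have "inner y b - inner (c i) b = inner (T (x - s)) b"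
          unfolding Tx[OF that, symmetric] c_def s_def[symmetric] inner_diff_left[symmetric]
          by (simp add: linear_diff[OF T(1), symmetric])
        also have "\<bar>\<dots>\<bar> \<le> norm (T (x - s)) * norm b" by (rule Cauchy_Schwarz_ineq2)
        also have "\<dots> \<le> L * norm (x - s)" using L(2) B1 that by (auto simp: norm_Basis subset_iff)
        also have "\<dots> \<le> d i"
          unfolding d_def using L(1) diameter_bounded_bound[OF C(2) i s] by (simp add: dist_norm)
        finally show ?thesis .
      qed
      then have "y \<in> box i"
        using i y by (auto simp: box_def mem_box comp abs_le_iff algebra_simps) (smt (verit))+
      then show "y \<in> (\<Union>i. box i)" by blast
    qed
    moreover have box: "range box \<subseteq> sets lborel" by (auto simp: box_def)
    ultimately have "emeasure lborel Q \<le> emeasure lborel (\<Union>i. box i)"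
      by (intro emeasure_mono) auto
    also have "\<dots> \<le> suminf (\<lambda>i. emeasure lborel (box i))" by (rule emeasure_subadditive_countably[OF box])
    finally have "ennreal \<kappa> * ennreal (\<epsilon> ^ n) \<le> ennreal \<kappa> * suminf (\<lambda>i. emeasure lborel (box i))"
      unfolding emQ by (rule mult_left_mono) simp
    also have "\<dots> = suminf (\<lambda>i. ennreal \<kappa> * emeasure lborel (box i))" by (rule ennreal_suminf_cmult[symmetric])
    also have "(\<lambda>i. ennreal \<kappa> * emeasure lborel (box i)) =
        (\<lambda>i. if C i = {} then 0 else ennreal (?\<omega> * (diameter (C i) / 2) ^ n))"
    proof
      fix i
      have "\<kappa> * (2 * d i) ^ n = ?\<omega> * (diameter (C i) / 2) ^ n"
      proof -
        have "\<kappa> * (2 * d i) ^ n = ?\<omega> * ((2 * d i) / (4 * L)) ^ n"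
          by (simp only: \<kappa>_def power_divide times_divide_eq_left times_divide_eq_right)
        also have "(2 * d i) / (4 * L) = diameter (C i) / 2" using L(1) by (simp add: d_def)
        finally show ?thesis .
      qed
      then show "ennreal \<kappa> * emeasure lborel (box i) =
        (if C i = {} then 0 else ennreal (?\<omega> * (diameter (C i) / 2) ^ n))"
        using \<kappa> d0[of i] by (simp add: embox flip: ennreal_mult')
    qed
    finally show ?thesis using \<kappa> \<epsilon> by (simp add: ennreal_mult')
  qed
  have "ennreal (\<kappa> * \<epsilon> ^ n) \<le> hausdorff_measure n S"
    unfolding hausdorff_measure_def
    by (rule SUP_upper2[of 1]) (auto intro!: INF_greatest lower)
  then show ?thesis using \<kappa> \<epsilon> by auto
qed

section \<open>The chain group\<close>

lemma vertices_oriented [simp]: "vertices (oriented w) = set w"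
proof -
  have "set v = set w" if "v \<in> oriented w" for v
    using that by (auto simp: oriented_def)
  moreover have "w \<in> oriented w"
    by (auto simp: oriented_def permutes_id intro!: exI[of _ id])
  ultimately show ?thesis unfolding vertices_def by blast
qed

lemma body_oriented [simp]: "body (oriented w) = convex hull set w"
  by (simp add: body_def)

lemma mem_oriented_self [simp]: "w \<in> oriented w"
  by (auto simp: oriented_def permutes_id intro!: exI[of _ id])

lemma permute_list_ordered_simplex:
  assumes "w \<in> ordered_simplices k" "p permutes {..<Suc k}"
  shows "permute_list p w \<in> ordered_simplices k"
proof -
  have "p permutes {..<length w}" using assms length_ordered_simplex by metis
  then show ?thesis using assms(1) by (simp add: ordered_simplices_def)
qed

context
  fixes w v :: "'a::euclidean_space list" and k :: nat
  assumes w: "w \<in> ordered_simplices k" and v: "v \<in> oriented w"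
begin

lemma oriented_permE:
  obtains p where "p permutes {..<Suc k}" "evenperm p" "v = permute_list p w"
  using v length_ordered_simplex[OF w] by (auto simp: oriented_def)

lemma oriented_ordered: "v \<in> ordered_simplices k"
  using oriented_permE permute_list_ordered_simplex[OF w] by metis

lemma oriented_set: "set v = set w"
  using v by (auto simp: oriented_def)

lemma oriented_det: "length B = k \<Longrightarrow> orient_det B v = orient_det B w"
proof -
  assume B: "length B = k"
  obtain p where p: "p permutes {..<Suc k}" "evenperm p" "v = permute_list p w" using oriented_permE .
  then show ?thesis
    using orient_det_permute[of p B w] B length_ordered_simplex[OF w] by (simp add: sign_def)
qed

lemma oriented_eq: "oriented v = oriented w"
proof -
  obtain p where p: "p permutes {..<Suc k}" "evenperm p" "v = permute_list p w" using oriented_permE .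
  have len: "length w = Suc k" "length v = Suc k"
    using length_ordered_simplex[OF w] length_ordered_simplex[OF oriented_ordered] .
  have perm: "permutation q" if "q permutes {..<Suc k}" for q
    using that by (rule permutes_imp_permutation[rotated]) simp
  have "permute_list q v \<in> oriented w" if q: "q permutes {..<Suc k}" "evenperm q" for q
  proof -
    have "permute_list q v = permute_list (p \<circ> q) w"
      using permute_list_compose[of q w p] q(1) len p(3) by simp
    moreover have "p \<circ> q permutes {..<Suc k}" by (rule permutes_compose[OF q(1) p(1)])
    moreover have "evenperm (p \<circ> q)" using p(2) q(2) evenperm_comp[OF perm perm, OF p(1) q(1)] by simp
    ultimately show ?thesis using len by (auto simp: oriented_def)
  qed
  moreover have "permute_list q w \<in> oriented v" if q: "q permutes {..<Suc k}" "evenperm q" for q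
  proof -
    let ?r = "inv_into UNIV p \<circ> q"
    have ip: "inv_into UNIV p permutes {..<Suc k}" "evenperm (inv_into UNIV p)"
      using permutes_inv[OF p(1)] evenperm_inv[OF perm[OF p(1)]] p(2) by auto
    have r: "?r permutes {..<Suc k}" by (rule permutes_compose[OF q(1) ip(1)])
    have "p \<circ> ?r = q" using permutes_inv_o(1)[OF p(1)] by (simp add: o_assoc)
    then have "permute_list ?r v = permute_list q w"
      using permute_list_compose[of ?r w p] r len p(3) by simp
    moreover have "evenperm ?r" using ip(2) q(2) evenperm_comp[OF perm perm, OF ip(1) q(1)] by simp
    ultimately show ?thesis using r len unfolding oriented_def by (metis (mono_tags, lifting) mem_Collect_eq)
  qed
  ultimately show ?thesis using len unfolding oriented_def[of v] oriented_def[of w]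
    by (auto simp: oriented_def)
qed

end

section \<open>Formal chains, their relations and their classes\<close>

abbreviation is_formal_chain :: "nat \<Rightarrow> ('a::euclidean_space osimplex \<Rightarrow>\<^sub>0 int) \<Rightarrow> bool" where
  "is_formal_chain k c \<equiv> Poly_Mapping.keys c \<subseteq> oriented_simplices k"

lemma relators_subset: "relators k \<subseteq> carrier (free_chains k)"
proof
  fix x :: "'a::euclidean_space osimplex \<Rightarrow>\<^sub>0 int"
  assume "x \<in> relators k"
  then consider (1) vs p where "x = frag_of (oriented vs) + frag_of (oriented (permute_list p vs))"
      "vs \<in> ordered_simplices k" "p permutes {..<Suc k}"
    | (2) \<sigma> K where "x = frag_of \<sigma> - (\<Sum>\<tau>\<in>K. frag_of \<tau>)" "\<sigma> \<in> oriented_simplices k" "subdivision k \<sigma> K"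
    unfolding relators_def by blast
  then show "x \<in> carrier (free_chains k)"
  proof cases
    case 1
    then show ?thesis
      using permute_list_ordered_simplex[OF 1(2,3)] keys_add[of "frag_of (oriented vs)" "frag_of (oriented (permute_list p vs))"]
      by (auto simp: oriented_simplices_def)
  next
    case 2
    have "(\<Sum>\<tau>\<in>K. frag_of \<tau>) \<in> carrier (free_chains k)"
      using 2(3) by (intro sum_closed_free_Abelian_group) (auto simp: subdivision_def)
    then show ?thesis
      using 2 keys_diff[of "frag_of \<sigma>" "\<Sum>\<tau>\<in>K. frag_of \<tau>"] by auto
  qed
qed

lemma subgroup_chain_relations: "subgroup (chain_relations k) (free_chains k)"
  unfolding chain_relations_def
  by (rule group.generate_is_subgroup[OF group_free_Abelian_group relators_subset])

lemma normal_chain_relations: "chain_relations k \<lhd> free_chains k"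
  using comm_group.subgroup_imp_normal[OF abelian_free_Abelian_group subgroup_chain_relations] .

lemma chain_relations_zero: "0 \<in> chain_relations k"
  using subgroup.one_closed[OF subgroup_chain_relations] by simp

lemma chain_relations_keys: "c \<in> chain_relations k \<Longrightarrow> is_formal_chain k c"
  using subgroup.subset[OF subgroup_chain_relations] by (metis carrier_free_Abelian_group_iff subsetD)

lemma chain_relations_add: "a \<in> chain_relations k \<Longrightarrow> b \<in> chain_relations k \<Longrightarrow> a + b \<in> chain_relations k"
  using subgroup.m_closed[OF subgroup_chain_relations, of a k b] by simp

lemma chain_relations_minus: "a \<in> chain_relations k \<Longrightarrow> - a \<in> chain_relations k"
  using subgroup.m_inv_closed[OF subgroup_chain_relations, of a k] chain_relations_keys[of a k] by simp

lemma chain_relations_diff: "a \<in> chain_relations k \<Longrightarrow> b \<in> chain_relations k \<Longrightarrow> a - b \<in> chain_relations k"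
  using chain_relations_add[OF _ chain_relations_minus, of a k b] by simp

lemma relators_in_chain_relations: "a \<in> relators k \<Longrightarrow> a \<in> chain_relations k"
  unfolding chain_relations_def by (rule generate.incl)

lemma mem_chain_class_iff: "d \<in> chain_class k c \<longleftrightarrow> d - c \<in> chain_relations k"
proof -
  have "d \<in> chain_class k c \<longleftrightarrow> (\<exists>h\<in>chain_relations k. d = h + c)"
    by (simp add: chain_class_def r_coset_def)
  also have "\<dots> \<longleftrightarrow> d - c \<in> chain_relations k" by (auto simp: algebra_simps bexI[of _ "d - c"])
  finally show ?thesis .
qed

lemma chain_class_eq_iff: "chain_class k c = chain_class k d \<longleftrightarrow> c - d \<in> chain_relations k"
proof
  assume "chain_class k c = chain_class k d"
  then have "c \<in> chain_class k d" using mem_chain_class_iff[of c k c] chain_relations_zero by simp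
  then show "c - d \<in> chain_relations k" by (simp add: mem_chain_class_iff)
next
  assume cd: "c - d \<in> chain_relations k"
  have "x - c \<in> chain_relations k \<longleftrightarrow> x - d \<in> chain_relations k" for x
    using chain_relations_add[OF _ cd, of "x - c"] chain_relations_diff[OF _ cd, of "x - d"] by auto
  then show "chain_class k c = chain_class k d" by (auto simp: mem_chain_class_iff)
qed

lemma carrier_chain_group: "carrier (chain_group k) = chain_class k ` {c. is_formal_chain k c}"
  unfolding chain_group_def FactGroup_def RCOSETS_def chain_class_def
  by (auto simp: free_Abelian_group_def)

lemma chain_class_in_carrier:
  "is_formal_chain k c \<Longrightarrow> chain_class k c \<in> carrier (chain_group k)"
  by (simp add: carrier_chain_group)

lemma chain_groupE:
  assumes "X \<in> carrier (chain_group k)"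
  obtains c where "is_formal_chain k c" "X = chain_class k c"
  using assms by (auto simp: carrier_chain_group)

lemma group_chain_group [simp]: "group (chain_group k)"
  unfolding chain_group_def by (rule normal.factorgroup_is_group[OF normal_chain_relations])

lemma one_chain_group: "\<one>\<^bsub>chain_group k\<^esub> = chain_class k 0"
  unfolding chain_group_def FactGroup_def
  by (auto simp: chain_class_def r_coset_def)

lemma mult_chain_group:
  assumes "is_formal_chain k c" "is_formal_chain k d"
  shows "chain_class k c \<otimes>\<^bsub>chain_group k\<^esub> chain_class k d = chain_class k (c + d)"
  using normal.rcos_sum[OF normal_chain_relations, of c k d] assms
  by (simp add: chain_group_def FactGroup_def chain_class_def)

lemma inv_chain_group:
  assumes "is_formal_chain k c"
  shows "inv\<^bsub>chain_group k\<^esub> chain_class k c = chain_class k (- c)"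
proof (rule group.inv_equality[OF group_chain_group])
  show "chain_class k (- c) \<otimes>\<^bsub>chain_group k\<^esub> chain_class k c = \<one>\<^bsub>chain_group k\<^esub>"
    using assms by (simp add: mult_chain_group one_chain_group)
qed (use assms chain_class_in_carrier[of c k] chain_class_in_carrier[of "- c" k] keys_diff[of 0 c] in auto)

lemma keys_diff_subset:
  "Poly_Mapping.keys c \<subseteq> S \<Longrightarrow> Poly_Mapping.keys d \<subseteq> S \<Longrightarrow> Poly_Mapping.keys (c - d) \<subseteq> S"
  using keys_diff[of c d] by blast

lemma keys_add_subset:
  "Poly_Mapping.keys c \<subseteq> S \<Longrightarrow> Poly_Mapping.keys d \<subseteq> S \<Longrightarrow> Poly_Mapping.keys (c + d) \<subseteq> S"
  using keys_add[of c d] by blast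

lemma chain_diff_class:
  assumes "is_formal_chain k c" "is_formal_chain k d"
  shows "chain_diff k (chain_class k c) (chain_class k d) = chain_class k (c - d)"
  using assms by (simp add: chain_diff_def inv_chain_group mult_chain_group)

text \<open>Its linear extension leads from lists back to oriented simplices. Degenerate lists go to
  0, as they represent no simplex.\<close>

definition simplex_chain :: "nat \<Rightarrow> 'a::euclidean_space list \<Rightarrow> 'a osimplex \<Rightarrow>\<^sub>0 int" where
  "simplex_chain k w = (if w \<in> ordered_simplices k then frag_of (oriented w) else 0)"

text \<open>The gradients of the barycentric coordinates 1 to \<open>k\<close> are dual to the
  edges, so the edge matrix is the identity. This supplies a \<open>B\<close> that detects the
  orientation.\<close>

lemma orient_det_unit:
  assumes w: "w \<in> ordered_simplices k"
  obtains B where "length B = k" "orient_det B w = 1"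
proof -
  obtain c g where cg: "\<And>i x. bary w i x = c i + inner (g i) x" using bary_form[OF w] by blast
  let ?B = "map (\<lambda>j. g (Suc j)) [0..<k]"
  have "edge_mat ?B w = 1\<^sub>m k"
  proof (intro eq_matI)
    fix i j assume "i < dim_row (1\<^sub>m k)" "j < dim_col (1\<^sub>m k)"
    then have ij: "i < k" "j < k" by auto
    have "inner (g (Suc j)) (w ! Suc i - w ! 0) = bary w (Suc j) (w ! Suc i) - bary w (Suc j) (w ! 0)"
      by (simp add: cg inner_diff_right)
    also have "\<dots> = (if i = j then 1 else 0)" using ij by (simp add: bary_vertex[OF w])
    finally show "edge_mat ?B w $$ (i, j) = 1\<^sub>m k $$ (i, j)"
      using ij by (simp add: edge_mat_def inner_commute)
  qed (auto simp: edge_mat_def)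
  then have "orient_det ?B w = 1" by (simp add: orient_det_edges)
  then show thesis using that[of ?B] by simp
qed

text \<open>The matrix \<open>M\<close> expresses the edges of \<open>w\<close> through those of
  \<open>v\<close> by differences of barycentric coordinates. Its determinant is the quotient of the
  two values of \<open>orient_det B\<close>.\<close>

lemma same_orientationI:
  assumes v: "v \<in> ordered_simplices k" and w: "w \<in> ordered_simplices k"
    and aff: "affine hull set v = affine hull set w"
    and B: "length B = k" "0 < orient_det B v" "0 < orient_det B w"
  shows "same_orientation k v w"
proof -
  define M where "M = Matrix.mat k k (\<lambda>(i, j). bary v (Suc i) (w ! Suc j) - bary v (Suc i) (w ! 0))"
  have M: "M \<in> carrier_mat k k" by (simp add: M_def)
  have expand: "x - v ! 0 = (\<Sum>i<k. bary v (Suc i) x *\<^sub>R (v ! Suc i - v ! 0))" if "x \<in> affine hull set v" for x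
  proof -
    have "x - v ! 0 = (\<Sum>i\<le>k. bary v i x *\<^sub>R v ! i) - (\<Sum>i\<le>k. bary v i x) *\<^sub>R v ! 0"
      using affine_hull_bary[OF v that] by simp
    also have "\<dots> = (\<Sum>i\<le>k. bary v i x *\<^sub>R (v ! i - v ! 0))"
      by (simp only: scaleR_left.sum scaleR_diff_right sum_subtractf)
    also have "\<dots> = (\<Sum>i<Suc k. bary v i x *\<^sub>R (v ! i - v ! 0))" by (simp only: lessThan_Suc_atMost)
    also have "\<dots> = (\<Sum>i<k. bary v (Suc i) x *\<^sub>R (v ! Suc i - v ! 0))"
      unfolding sum.lessThan_Suc_shift by simp
    finally show ?thesis .
  qed
  have inw: "w ! j \<in> affine hull set v" if "j \<le> k" for j
    using that length_ordered_simplex[OF w] hull_subset[of "set w" affine] aff by auto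
  have cob: "w ! Suc j - w ! 0 = (\<Sum>i<k. (M $$ (i, j)) *\<^sub>R (v ! Suc i - v ! 0))" if j: "j < k" for j
  proof -
    have "w ! Suc j - w ! 0 = (w ! Suc j - v ! 0) - (w ! 0 - v ! 0)" by simp
    also have "\<dots> = (\<Sum>i<k. (bary v (Suc i) (w ! Suc j) - bary v (Suc i) (w ! 0)) *\<^sub>R (v ! Suc i - v ! 0))"
      using j expand[OF inw[of "Suc j"]] expand[OF inw[of 0]]
      by (simp add: scaleR_diff_left sum_subtractf)
    also have "\<dots> = (\<Sum>i<k. (M $$ (i, j)) *\<^sub>R (v ! Suc i - v ! 0))"
      using j by (intro sum.cong) (auto simp: M_def)
    finally show ?thesis .
  qed
  have "orient_det B w = Determinant.det M * orient_det B v"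
    by (rule orient_det_change_of_basis) (use M cob B(1) in auto)
  then have "0 < Determinant.det M" using B(2,3) by (simp add: zero_less_mult_iff)
  then show ?thesis unfolding same_orientation_def using aff M cob by blast
qed

lemma same_orientation_sgn:
  assumes "same_orientation k v w" "length B = k"
  shows "sgn (orient_det B w) = sgn (orient_det B v)"
proof -
  obtain M where M: "M \<in> carrier_mat k k" "0 < Determinant.det M"
    "\<forall>j<k. w ! Suc j - w ! 0 = (\<Sum>i<k. (M $$ (i, j)) *\<^sub>R (v ! Suc i - v ! 0))"
    using assms(1) unfolding same_orientation_def by blast
  have "orient_det B w = Determinant.det M * orient_det B v"
    by (rule orient_det_change_of_basis) (use M assms(2) in auto)
  then show ?thesis using M(2) by (simp add: sgn_mult)
qed

text \<open>The two halves are cut from the simplex by the condition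
  \<open>t * bary w i x = (1 - t) * bary w j x\<close>, the hyperplane of its plane through
  \<open>m\<close> and the vertices other than \<open>w ! i\<close> and \<open>w ! j\<close>. The
  overlap lies in a facet, of measure zero, and \<open>orient_det_split\<close> shows that both
  halves keep the orientation.\<close>

lemma split_in_relations:
  fixes w :: "'a::euclidean_space list"
  assumes w: "w \<in> ordered_simplices k" and ij: "i \<le> k" "j \<le> k" "i \<noteq> j"
    and t: "0 < t" "t < 1" and m: "m = (1 - t) *\<^sub>R w ! i + t *\<^sub>R w ! j"
  shows "w[i := m] \<in> ordered_simplices k" "w[j := m] \<in> ordered_simplices k"
    "frag_of (oriented w) - frag_of (oriented (w[i := m])) - frag_of (oriented (w[j := m])) \<in> chain_relations k"
proof -
  have len: "length w = Suc k" by (rule length_ordered_simplex[OF w])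
  have "w ! i \<in> affine hull set w" "w ! j \<in> affine hull set w"
    using ij len hull_subset[of "set w" affine] by auto
  then have mP: "m \<in> affine hull set w"
    unfolding m using mem_affine[OF affine_affine_hull, of "w ! i" "set w" "w ! j" "1 - t" t] by simp
  have bm: "bary w l m = (1 - t) * bary w l (w ! i) + t * bary w l (w ! j)" for l
    unfolding m by (rule bary_line[OF w])
  have bmi: "bary w i m = 1 - t" and bmj: "bary w j m = t"
    and bml: "\<And>l. l \<le> k \<Longrightarrow> l \<noteq> i \<Longrightarrow> l \<noteq> j \<Longrightarrow> bary w l m = 0"
    unfolding bm using ij by (simp_all add: bary_vertex[OF w])
  let ?w1 = "w[i := m]" and ?w2 = "w[j := m]"
  have w1: "?w1 \<in> ordered_simplices k" "affine hull set ?w1 = affine hull set w"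
    using ordered_simplex_update[OF w ij(1) mP] bmi t by auto
  have w2: "?w2 \<in> ordered_simplices k" "affine hull set ?w2 = affine hull set w"
    using ordered_simplex_update[OF w ij(2) mP] bmj t by auto
  show "?w1 \<in> ordered_simplices k" "?w2 \<in> ordered_simplices k" by fact+
  \<comment> \<open>Change of barycentric coordinates: expand \<open>x\<close> over the updated
    vertices and apply the affine function \<open>bary w l\<close>.\<close>
  have trans: "bary w l x = (if l = a then 0 else bary (w[a := m]) l x) + bary (w[a := m]) a x * bary w l m"
    if a: "a \<le> k" and wa: "w[a := m] \<in> ordered_simplices k" "affine hull set (w[a := m]) = affine hull set w"
      and x: "x \<in> affine hull set w" and l: "l \<le> k" for a l x
  proof -
    let ?u = "\<lambda>l. bary (w[a := m]) l x"
    have s: "(\<Sum>l\<le>k. ?u l) = 1" "(\<Sum>l\<le>k. ?u l *\<^sub>R w[a := m] ! l) = x"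
      using affine_hull_bary[OF wa(1), of x] x wa(2) by auto
    have "bary w l x = (\<Sum>l'\<le>k. ?u l' * bary w l (w[a := m] ! l'))"
      using bary_affine_combination[OF w s(1), of l "(!) (w[a := m])"] s(2) by simp
    also have "\<dots> = (\<Sum>l'\<le>k. (if l' = l \<and> l \<noteq> a then ?u l else 0) + (if l' = a then ?u a * bary w l m else 0))"
      using a l len by (intro sum.cong) (auto simp: bary_vertex[OF w])
    also have "\<dots> = (if l = a then 0 else ?u l) + ?u a * bary w l m"
      using a l by (auto simp: sum.distrib)
    finally show ?thesis .
  qed
  \<comment> \<open>The variables are generalised so that exchanging \<open>i\<close> with
    \<open>j\<close> and \<open>t\<close> with \<open>1 - t\<close> gives the other half.\<close>
  have piece: "x \<in> convex hull set (w[i := m]) \<longleftrightarrow> x \<in> convex hull set w \<and> t * bary w i x \<le> (1 - t) * bary w j x"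
    if ij: "i \<le> k" "j \<le> k" "i \<noteq> j"
      and w1: "w[i := m] \<in> ordered_simplices k" "affine hull set (w[i := m]) = affine hull set w"
      and t: "0 < t" "t < 1" and bmi: "bary w i m = 1 - t" and bmj: "bary w j m = t"
      and bml: "\<And>l. l \<le> k \<Longrightarrow> l \<noteq> i \<Longrightarrow> l \<noteq> j \<Longrightarrow> bary w l m = 0"
      and x: "x \<in> affine hull set w" for i j t x
  proof -
    let ?u = "\<lambda>l. bary (w[i := m]) l x"
    have ui: "bary w i x = (1 - t) * ?u i" using trans[OF ij(1) w1 x ij(1)] bmi by simp
    have uj: "bary w j x = ?u j + t * ?u i" using trans[OF ij(1) w1 x ij(2)] bmj ij by simp
    have ul: "bary w l x = ?u l" if "l \<le> k" "l \<noteq> i" "l \<noteq> j" for l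
      using trans[OF ij(1) w1 x that(1)] bml[OF that] that by simp
    have key: "t * bary w i x \<le> (1 - t) * bary w j x \<longleftrightarrow> 0 \<le> ?u j"
    proof -
      have "(1 - t) * bary w j x - t * bary w i x = (1 - t) * ?u j" unfolding ui uj by (simp add: algebra_simps)
      moreover have "0 \<le> (1 - t) * ?u j \<longleftrightarrow> 0 \<le> ?u j" using t by (simp add: zero_le_mult_iff)
      ultimately show ?thesis by linarith
    qed
    have key2: "0 \<le> bary w i x \<longleftrightarrow> 0 \<le> ?u i" unfolding ui using t by (simp add: zero_le_mult_iff)
    have uj0: "0 \<le> bary w j x" if "0 \<le> ?u j" "0 \<le> ?u i" using that t unfolding uj by simp
    have A: "x \<in> convex hull set (w[i := m]) \<longleftrightarrow> (\<forall>l\<le>k. 0 \<le> ?u l)"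
      using mem_convex_hull_iff_bary[OF w1(1)] w1(2) x by simp
    have C: "x \<in> convex hull set w \<longleftrightarrow> (\<forall>l\<le>k. 0 \<le> bary w l x)"
      using mem_convex_hull_iff_bary[OF w] x by simp
    show ?thesis
    proof
      assume "x \<in> convex hull set (w[i := m])"
      then have nn: "\<And>l. l \<le> k \<Longrightarrow> 0 \<le> ?u l" using A by blast
      have "0 \<le> bary w l x" if l: "l \<le> k" for l
      proof (cases "l = i \<or> l = j")
        case True
        then show ?thesis using nn[OF ij(1)] nn[OF ij(2)] key2 uj0 by auto
      next
        case False
        then show ?thesis using ul[OF l] nn[OF l] by simp
      qed
      then show "x \<in> convex hull set w \<and> t * bary w i x \<le> (1 - t) * bary w j x"
        using C key nn[OF ij(2)] by blast
    next
      assume as: "x \<in> convex hull set w \<and> t * bary w i x \<le> (1 - t) * bary w j x"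
      then have nn: "\<And>l. l \<le> k \<Longrightarrow> 0 \<le> bary w l x" using C by blast
      have "0 \<le> ?u l" if l: "l \<le> k" for l
      proof (cases "l = i \<or> l = j")
        case True
        then show ?thesis using nn[OF ij(1)] key2 key as by auto
      next
        case False
        then show ?thesis using ul[OF l] nn[OF l] by simp
      qed
      then show "x \<in> convex hull set (w[i := m])" using A by blast
    qed
  qed
  have m1: "x \<in> convex hull set ?w1 \<longleftrightarrow> x \<in> convex hull set w \<and> t * bary w i x \<le> (1 - t) * bary w j x"
    if "x \<in> affine hull set w" for x
    by (rule piece) (use ij w1 t bmi bmj bml that in simp_all)
  have m2: "x \<in> convex hull set ?w2 \<longleftrightarrow> x \<in> convex hull set w \<and> (1 - t) * bary w j x \<le> t * bary w i x"
    if "x \<in> affine hull set w" for x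
    using piece[OF ij(2,1) ij(3)[symmetric] w2, of "1 - t" x] t bmi bmj bml that by simp
  have sub: "convex hull set v \<subseteq> affine hull set w" if "affine hull set v = affine hull set w" for v
    using convex_hull_subset_affine_hull[of "set v"] that by simp
  have un: "convex hull set ?w1 \<union> convex hull set ?w2 = convex hull set w"
  proof (rule equalityI; rule subsetI)
    fix x assume "x \<in> convex hull set ?w1 \<union> convex hull set ?w2"
    then show "x \<in> convex hull set w" using m1 m2 sub[OF w1(2)] sub[OF w2(2)] by blast
  next
    fix x assume x: "x \<in> convex hull set w"
    then have "x \<in> affine hull set w" using sub[of w] by blast
    then show "x \<in> convex hull set ?w1 \<union> convex hull set ?w2"
      using m1[of x] m2[of x] x linear[of "t * bary w i x" "(1 - t) * bary w j x"] by blast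
  qed
  \<comment> \<open>On the overlap both inequalities are equalities, which makes the coordinate of
    \<open>w ! j\<close> in the first half vanish; the point lies in the facet opposite that
    vertex.\<close>
  have inter: "convex hull set ?w1 \<inter> convex hull set ?w2 \<subseteq> convex hull set (facet j ?w1)"
  proof
    fix x assume x: "x \<in> convex hull set ?w1 \<inter> convex hull set ?w2"
    then have xP: "x \<in> affine hull set w" using sub[OF w1(2)] by blast
    then have eq: "t * bary w i x = (1 - t) * bary w j x" using m1[OF xP] m2[OF xP] x by force
    have nn: "\<forall>l\<le>k. 0 \<le> bary ?w1 l x" using x mem_convex_hull_iff_bary[OF w1(1)] by blast
    have "(1 - t) * bary ?w1 j x = 0"
      using eq trans[OF ij(1) w1 xP ij(1)] trans[OF ij(1) w1 xP ij(2)] bmi bmj ij(3)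
      by (simp add: algebra_simps)
    then have "bary ?w1 j x = 0" using t by simp
    then show "x \<in> convex hull set (facet j ?w1)"
      using mem_convex_hull_facet_iff[OF w1(1) ij(2), of x] nn xP w1(2) by simp
  qed
  have "0 < k" using ij by linarith
  have null: "hausdorff_measure k (convex hull set ?w1 \<inter> convex hull set ?w2) = 0"
  proof -
    have "length (facet j ?w1) = Suc (k - 1)" using ij len \<open>0 < k\<close> by simp
    then have "hausdorff_measure (Suc (k - 1)) (convex hull set (facet j ?w1)) = 0"
      by (rule hausdorff_measure_convex_hull_finite(2))
    then show ?thesis using hausdorff_measure_mono[OF inter, of k] \<open>0 < k\<close> by simp
  qed
  obtain B where B: "length B = k" "orient_det B w = 1" using orient_det_unit[OF w] .
  have "orient_det B ?w1 = (1 - t) * orient_det B w"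
    unfolding m by (rule orient_det_split) (use B ij len in auto)
  then have o1: "same_orientation k w ?w1"
    using same_orientationI[OF w w1(1) w1(2)[symmetric] B(1)] B(2) t by simp
  have m': "m = (1 - (1 - t)) *\<^sub>R w ! j + (1 - t) *\<^sub>R w ! i" unfolding m by simp
  have "orient_det B ?w2 = (1 - (1 - t)) * orient_det B w"
    unfolding m' by (rule orient_det_split) (use B ij len in auto)
  then have o2: "same_orientation k w ?w2"
    using same_orientationI[OF w w2(1) w2(2)[symmetric] B(1)] B(2) t by simp
  \<comment> \<open>The relator sums over a set of simplices, which has two terms only if the halves
    differ. The vertex \<open>w ! j\<close> belongs to the first half alone.\<close>
  have neq: "oriented ?w1 \<noteq> oriented ?w2"
  proof
    assume "oriented ?w1 = oriented ?w2"
    then have "body (oriented ?w1) = body (oriented ?w2)" by simp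
    then have "convex hull set ?w1 = convex hull set ?w2" by simp
    moreover have "?w1 ! j \<in> convex hull set ?w1" by (rule hull_inc, rule nth_mem) (use ij len in simp)
    ultimately have "w ! j \<in> convex hull set ?w2" using ij by simp
    then have "(1 - t) * bary w j (w ! j) \<le> t * bary w i (w ! j)"
      using m2[OF \<open>w ! j \<in> affine hull set w\<close>] by blast
    then show False using ij t by (simp add: bary_vertex[OF w])
  qed
  let ?K = "{oriented ?w1, oriented ?w2}"
  have "subdivision k (oriented w) ?K"
    unfolding subdivision_def
  proof (intro conjI ballI impI)
    show "?K \<subseteq> oriented_simplices k" using w1 w2 by (auto simp: oriented_simplices_def)
    fix \<tau> assume "\<tau> \<in> ?K"
    then show "oriented_as k \<tau> (oriented w)"
      unfolding oriented_as_def using o1 o2 mem_oriented_self by blast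
  next
    fix \<tau> \<tau>' assume "\<tau> \<in> ?K" "\<tau>' \<in> ?K" "\<tau> \<noteq> \<tau>'"
    then show "hausdorff_measure k (body \<tau> \<inter> body \<tau>') = 0"
      using null by (auto simp: Int_commute)
  next
    show "(\<Union>\<tau>\<in>?K. body \<tau>) = body (oriented w)" using un by simp
  qed simp
  then have "frag_of (oriented w) - (\<Sum>\<tau>\<in>?K. frag_of \<tau>) \<in> relators k"
    unfolding relators_def using w by (auto simp: oriented_simplices_def)
  then show "frag_of (oriented w) - frag_of (oriented ?w1) - frag_of (oriented ?w2) \<in> chain_relations k"
    using relators_in_chain_relations neq by (simp add: diff_diff_eq)
qed

text \<open>The vertex \<open>w ! i\<close> is recovered from \<open>m\<close> and
  \<open>w ! j\<close> on their common line, at the parameter \<open>- t / (1 - t)\<close>. In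
  contrapositive form: bisecting a degenerate list yields a degenerate list.\<close>

lemma unsplit_ordered:
  fixes w :: "'a::euclidean_space list"
  assumes w: "w[i := m] \<in> ordered_simplices k" and ij: "i \<le> k" "j \<le> k" "i \<noteq> j" and len: "length w = Suc k"
    and t: "t < 1" and m: "m = (1 - t) *\<^sub>R w ! i + t *\<^sub>R w ! j"
  shows "w \<in> ordered_simplices k"
proof -
  let ?w1 = "w[i := m]" and ?s = "1 - 1 / (1 - t)"
  have "(1 - t) *\<^sub>R w ! i = m - t *\<^sub>R w ! j" unfolding m by simp
  then have "(1 / (1 - t)) *\<^sub>R (1 - t) *\<^sub>R w ! i = (1 / (1 - t)) *\<^sub>R (m - t *\<^sub>R w ! j)" by simp
  moreover have "?s = - (t / (1 - t))" using t by (simp add: field_simps)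
  ultimately have wi: "w ! i = (1 - ?s) *\<^sub>R ?w1 ! i + ?s *\<^sub>R ?w1 ! j"
    using t ij len by (simp add: scaleR_diff_right)
  have "?w1 ! i \<in> affine hull set ?w1" "?w1 ! j \<in> affine hull set ?w1"
    by (rule hull_inc, rule nth_mem, use ij len in simp)+
  then have mem: "w ! i \<in> affine hull set ?w1"
    unfolding wi using mem_affine[OF affine_affine_hull, of "?w1 ! i" "set ?w1" "?w1 ! j" "1 - ?s" ?s] by simp
  have "bary ?w1 i (w ! i) = 1 - ?s"
    unfolding wi bary_line[OF w] using ij by (simp add: bary_vertex[OF w] del: nth_list_update_eq nth_list_update_neq)
  moreover have "1 - ?s \<noteq> 0" using t by simp
  ultimately have "bary ?w1 i (w ! i) \<noteq> 0" by simp
  from ordered_simplex_update(1)[OF w ij(1) mem this] show ?thesis by simp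
qed

text \<open>One case per generator. A relation at a degenerate list goes to 0 because all its terms
  are degenerate: permutations preserve this, and \<open>unsplit_ordered\<close> gives it for both
  halves.\<close>

lemma null_chains_imp_relations:
  assumes "a \<in> null_chains k"
  shows "frag_extend (simplex_chain k) a \<in> chain_relations k"
  using assms
proof induction
  case zero
  then show ?case by (simp add: chain_relations_zero)
next
  case (degenerate w)
  then show ?case by (simp add: simplex_chain_def chain_relations_zero)
next
  case (swap w i j)
  let ?p = "Transposition.transpose i j"
  have p: "?p permutes {..<Suc k}" using swap by (intro permutes_swap_id) auto
  have w': "w[i := w ! j, j := w ! i] = permute_list ?p w"
    using swap p by (intro nth_equalityI) (auto simp: permute_list_nth transpose_def nth_list_update)
  have inv: "permute_list ?p (permute_list ?p w) = w"
    using permute_list_compose[of ?p w ?p] p swap by simp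
  have odd: "\<not> evenperm ?p" using swap by (simp add: evenperm_swap)
  show ?case
  proof (cases "w \<in> ordered_simplices k")
    case True
    then have "permute_list ?p w \<in> ordered_simplices k" by (rule permute_list_ordered_simplex[OF _ p])
    moreover have "frag_of (oriented w) + frag_of (oriented (permute_list ?p w)) \<in> relators k"
      unfolding relators_def using True p odd by blast
    ultimately show ?thesis
      using True relators_in_chain_relations unfolding w' by (simp add: frag_extend_add simplex_chain_def)
  next
    case False
    then have "permute_list ?p w \<notin> ordered_simplices k"
      using permute_list_ordered_simplex[OF _ p, of "permute_list ?p w"] inv by auto
    then show ?thesis using False unfolding w' by (simp add: frag_extend_add simplex_chain_def chain_relations_zero)
  qed
next
  case (split w i j t m)
  show ?case
  proof (cases "w \<in> ordered_simplices k")
    case True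
    then show ?thesis
      using split_in_relations[OF True split(2-7)]
      by (simp add: frag_extend_diff simplex_chain_def)
  next
    case False
    have m': "m = (1 - (1 - t)) *\<^sub>R w ! j + (1 - t) *\<^sub>R w ! i" using split by simp
    have "w[i := m] \<notin> ordered_simplices k"
      using False unsplit_ordered[OF _ split(2,3,4,1,6,7)] by blast
    moreover have "1 - t < 1" using split by simp
    then have "w[j := m] \<notin> ordered_simplices k"
      using False unsplit_ordered[OF _ split(3,2) split(4)[symmetric] split(1) _ m'] by blast
    ultimately show ?thesis using False by (simp add: frag_extend_diff simplex_chain_def chain_relations_zero)
  qed
next
  case (diff a b)
  then show ?case by (simp add: frag_extend_diff chain_relations_diff)
qed

section \<open>The boundary homomorphism\<close>

lemma convex_hull_interior_point:
  assumes w: "w \<in> ordered_simplices n" and pos: "\<And>i. i \<le> n \<Longrightarrow> 0 < bary w i x"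
  obtains d where "0 < d" "\<And>y. y \<in> affine hull set w \<Longrightarrow> norm (y - x) \<le> d \<Longrightarrow> y \<in> convex hull set w"
proof -
  have "continuous_on UNIV (bary w i)" for i
    using continuous_on_bary[OF w continuous_on_id] by simp
  then have "open {y. 0 < bary w i y}" for i
    by (intro open_Collect_less continuous_on_const)
  then have "open (\<Inter>i\<in>{..n}. {y. 0 < bary w i y})" by (intro open_INT) auto
  moreover have "x \<in> (\<Inter>i\<in>{..n}. {y. 0 < bary w i y})" using pos by auto
  ultimately obtain d where d: "0 < d" "cball x d \<subseteq> (\<Inter>i\<in>{..n}. {y. 0 < bary w i y})"
    using open_contains_cball by blast
  show thesis
  proof (rule that[OF d(1)])
    fix y assume y: "y \<in> affine hull set w" "norm (y - x) \<le> d"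
    then have "y \<in> cball x d" by (simp add: dist_norm norm_minus_commute)
    then have "\<forall>i\<le>n. 0 < bary w i y" using d(2) by auto
    then show "y \<in> convex hull set w"
      using mem_convex_hull_iff_bary[OF w] y(1) by (simp add: order_less_imp_le)
  qed
qed

text \<open>At a point interior to both simplices, a small parallelepiped spanned by edge directions
  of \<open>w\<close> fits into the intersection, and its measure is positive.\<close>

lemma hausdorff_measure_Int_simplices:
  fixes v w :: "'a::euclidean_space list"
  assumes v: "v \<in> ordered_simplices n" and w: "w \<in> ordered_simplices n" and n: "0 < n"
    and aff: "affine hull set v = affine hull set w" and x: "x \<in> affine hull set w"
    and pos: "\<And>i. i \<le> n \<Longrightarrow> 0 < bary v i x" "\<And>i. i \<le> n \<Longrightarrow> 0 < bary w i x"
  shows "hausdorff_measure n (convex hull set v \<inter> convex hull set w) \<noteq> 0"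
proof -
  obtain d1 where d1: "0 < d1" "\<And>y. y \<in> affine hull set v \<Longrightarrow> norm (y - x) \<le> d1 \<Longrightarrow> y \<in> convex hull set v"
    using convex_hull_interior_point[OF v pos(1)] by blast
  obtain d2 where d2: "0 < d2" "\<And>y. y \<in> affine hull set w \<Longrightarrow> norm (y - x) \<le> d2 \<Longrightarrow> y \<in> convex hull set w"
    using convex_hull_interior_point[OF w pos(2)] by blast
  have len: "length w = Suc n" and dist: "distinct w" and ind: "\<not> affine_dependent (set w)"
    using w by (auto simp: ordered_simplices_def)
  define E where "E = (\<lambda>x. - (w ! 0) + x) ` (set w - {w ! 0})"
  have w0: "w ! 0 \<in> set w" using len by simp
  then have "\<not> affine_dependent (insert (w ! 0) (set w - {w ! 0}))"
    using ind by (simp add: insert_absorb)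
  then have E: "independent E"
    unfolding E_def by (subst (asm) affine_dependent_iff_dependent) auto
  have cardE: "card E = n"
    unfolding E_def using w0 len distinct_card[OF dist] by (subst card_image) (auto simp: inj_on_def)
  have finE: "finite E" by (simp add: E_def)
  \<comment> \<open>Edge coefficients up to \<open>min d1 d2 / s\<close> move a point by at most
    \<open>min d1 d2\<close>; the summand 1 makes \<open>s\<close> positive.\<close>
  define s where "s = (\<Sum>e\<in>E. norm e) + 1"
  have s: "0 < s" unfolding s_def by (smt (verit) norm_ge_zero sum_nonneg)
  define \<epsilon> where "\<epsilon> = min d1 d2 / s"
  have \<epsilon>: "0 < \<epsilon>" using d1(1) d2(1) s by (simp add: \<epsilon>_def)
  have inP: "x + (\<Sum>e\<in>F. a e *\<^sub>R e) \<in> affine hull set w" if "F \<subseteq> E" for a F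
    using finite_subset[OF that finE] that
  proof (induction F rule: finite_induct)
    case empty
    then show ?case using x by simp
  next
    case (insert e F)
    then obtain p where p: "p \<in> set w" "e = p - w ! 0" by (auto simp: E_def)
    have "(x + (\<Sum>e\<in>F. a e *\<^sub>R e)) + a e *\<^sub>R (p - w ! 0) \<in> affine hull set w"
      using insert p w0 by (intro mem_affine_3_minus affine_affine_hull) (auto intro: hull_inc)
    then have "(x + (\<Sum>e\<in>F. a e *\<^sub>R e)) + a e *\<^sub>R e \<in> affine hull set w"
      by (simp only: p(2))
    then show ?case using insert.hyps by (simp add: add_ac)
  qed
  have "x + (\<Sum>e\<in>E. a e *\<^sub>R e) \<in> convex hull set v \<inter> convex hull set w"
    if a: "\<And>e. e \<in> E \<Longrightarrow> 0 \<le> a e \<and> a e \<le> \<epsilon>" for a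
  proof -
    have "norm (\<Sum>e\<in>E. a e *\<^sub>R e) \<le> (\<Sum>e\<in>E. norm (a e *\<^sub>R e))" by (rule norm_sum)
    also have "\<dots> \<le> (\<Sum>e\<in>E. \<epsilon> * norm e)"
      by (rule sum_mono) (use a in \<open>auto intro!: mult_right_mono\<close>)
    also have "\<dots> = \<epsilon> * (s - 1)" by (simp add: s_def sum_distrib_left)
    also have "\<dots> \<le> \<epsilon> * s" using \<epsilon> by simp
    also have "\<dots> = min d1 d2" using s by (simp add: \<epsilon>_def)
    finally have "norm ((x + (\<Sum>e\<in>E. a e *\<^sub>R e)) - x) \<le> min d1 d2" by simp
    then show ?thesis using d1(2) d2(2) inP[of E a] aff by simp
  qed
  then show ?thesis
    using hausdorff_measure_parallelepiped_pos[OF E cardE n \<epsilon>, of x "convex hull set v \<inter> convex hull set w"] by blast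
qed

section \<open>Compatibility of the boundary with the relations\<close>

definition rep :: "'a osimplex \<Rightarrow> 'a list" where
  "rep \<sigma> = (SOME v. v \<in> \<sigma>)"

lemma rep_mem: "\<sigma> \<in> oriented_simplices k \<Longrightarrow> rep \<sigma> \<in> \<sigma>"
  unfolding rep_def oriented_simplices_def using mem_oriented_self by (metis imageE someI)

lemma rep_oriented: "\<sigma> \<in> oriented_simplices k \<Longrightarrow> oriented (rep \<sigma>) = \<sigma>"
  using rep_mem[of \<sigma> k] oriented_eq by (auto simp: oriented_simplices_def)

lemma rep_ordered: "\<sigma> \<in> oriented_simplices k \<Longrightarrow> rep \<sigma> \<in> ordered_simplices k"
  using rep_mem[of \<sigma> k] oriented_ordered by (auto simp: oriented_simplices_def)

lemma body_rep: "\<sigma> \<in> oriented_simplices k \<Longrightarrow> body \<sigma> = convex hull set (rep \<sigma>)"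
  using rep_oriented[of \<sigma> k] body_oriented[of "rep \<sigma>"] by simp

text \<open>Both orderings have the same convex hull, so the two-term chain has vanishing indicator
  everywhere and \<open>vanishing_imp_null\<close> applies to its boundary. The case
  \<open>s = 1\<close> treats odd permutations, \<open>s = - 1\<close> the independence of the
  chosen ordering.\<close>

lemma vanishing_pair:
  fixes v w :: "'a::euclidean_space list"
  assumes v: "v \<in> ordered_simplices n" and w: "w \<in> ordered_simplices n" and n: "0 < n"
    and set: "set v = set w" and s: "s = 1 \<or> s = - 1"
    and det: "\<And>B :: 'a list. length B = n \<Longrightarrow> orient_det B v + of_int s * orient_det B w = 0"
  shows "list_boundary v + frag_cmul s (list_boundary w) \<in> null_chains (n - 1)"
proof (cases "v = w")
  case True
  \<comment> \<open>The set \<open>{v, w}\<close> would collapse to one element; a \<open>B\<close>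
    of determinant 1 forces \<open>s = - 1\<close>, and the two boundaries cancel.\<close>
  obtain B where "length B = n" "orient_det B w = 1" using orient_det_unit[OF w] .
  then have "s = - 1" using det[of B] True s by auto
  then show ?thesis using True by (simp add: null_chains.zero)
next
  case False
  let ?c = "\<lambda>u. if u = v then 1 else s"
  have "vanishing n (affine hull set w) {v, w} ?c"
    unfolding vanishing_def
  proof (intro exI[of _ "{}"] conjI allI impI)
    fix B :: "'a list" and x assume "length B = n"
    then have "orient_det B v = - of_int s * orient_det B w" using det by fastforce
    then have "sgn (orient_det B v) = - of_int s * sgn (orient_det B w)" using s by (auto simp: sgn_minus)
    moreover have "sum h {v, w} = h v + h w" for h :: "'a list \<Rightarrow> real" using False by simp
    ultimately show "(\<Sum>u\<in>{v, w}. of_int (?c u) * sgn (orient_det B u) * indicator (convex hull set u) x) = (0::real)"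
      using False set by (simp only:) simp
  qed auto
  then have "(\<Sum>u\<in>{v, w}. frag_cmul (?c u) (list_boundary u)) \<in> null_chains (n - 1)"
    using vanishing_imp_null(2)[of n "affine hull set w" "{v, w}" ?c] v w n set by (auto simp: simplices_in_def)
  then show ?thesis using False by simp
qed

text \<open>Off the planes spanned by facets, a point in two pieces would be interior to both, and
  their overlap would have positive measure. A generic point of the simplex thus lies in exactly one
  piece. As orientations agree, the simplex minus its pieces has vanishing indicator.\<close>

lemma subdivision_boundary_null:
  fixes \<sigma> :: "'a::euclidean_space osimplex"
  assumes sub: "subdivision n \<sigma> K" and \<sigma>: "\<sigma> \<in> oriented_simplices n" and n: "0 < n"
  shows "list_boundary (rep \<sigma>) - (\<Sum>\<tau>\<in>K. list_boundary (rep \<tau>)) \<in> null_chains (n - 1)"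
proof -
  have fin: "finite K" and K: "\<And>\<tau>. \<tau> \<in> K \<Longrightarrow> \<tau> \<in> oriented_simplices n"
    and oa: "\<And>\<tau>. \<tau> \<in> K \<Longrightarrow> oriented_as n \<tau> \<sigma>"
    and null: "\<And>\<tau> \<tau>'. \<tau> \<in> K \<Longrightarrow> \<tau>' \<in> K \<Longrightarrow> \<tau> \<noteq> \<tau>' \<Longrightarrow> hausdorff_measure n (body \<tau> \<inter> body \<tau>') = 0"
    and un: "(\<Union>\<tau>\<in>K. body \<tau>) = body \<sigma>"
    using sub by (auto simp: subdivision_def)
  define P where "P = affine hull set (rep \<sigma>)"
  have mem: "affine hull set u = affine hull set (rep \<tau>)"
    "length B = n \<Longrightarrow> orient_det B u = orient_det B (rep \<tau>)"
    if u: "u \<in> \<tau>" "\<tau> \<in> oriented_simplices n" for u \<tau> B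
  proof -
    have o: "u \<in> oriented (rep \<tau>)" using u(1) rep_oriented[OF u(2)] by simp
    show "affine hull set u = affine hull set (rep \<tau>)"
      using oriented_set[OF rep_ordered[OF u(2)] o] by simp
    assume "length B = n"
    then show "orient_det B u = orient_det B (rep \<tau>)"
      by (rule oriented_det[OF rep_ordered[OF u(2)] o])
  qed
  have KP: "affine hull set (rep \<tau>) = P"
    and Kdet: "\<And>B. length B = n \<Longrightarrow> sgn (orient_det B (rep \<tau>)) = sgn (orient_det B (rep \<sigma>))"
    if \<tau>: "\<tau> \<in> K" for \<tau>
  proof -
    obtain us vs where u: "us \<in> \<tau>" "vs \<in> \<sigma>" "same_orientation n vs us"
      using oa[OF \<tau>] unfolding oriented_as_def by blast
    then have "affine hull set vs = affine hull set us" by (simp add: same_orientation_def)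
    then show "affine hull set (rep \<tau>) = P"
      using mem(1)[OF u(1) K[OF \<tau>]] mem(1)[OF u(2) \<sigma>] by (simp add: P_def)
    fix B :: "'a list" assume "length B = n"
    then show "sgn (orient_det B (rep \<tau>)) = sgn (orient_det B (rep \<sigma>))"
      using same_orientation_sgn[OF u(3), of B] mem(2)[OF u(1) K[OF \<tau>], of B] mem(2)[OF u(2) \<sigma>, of B] by simp
  qed
  define J where "J = insert (rep \<sigma>) (rep ` K)"
  \<comment> \<open>Written as a difference so that the coefficient is 0 when
    \<open>\<sigma>\<close> is itself one of the pieces.\<close>
  define c :: "'a list \<Rightarrow> int" where "c w = (if w = rep \<sigma> then 1 else 0) - (if w \<in> rep ` K then 1 else 0)" for w
  have J: "simplices_in n P J"
    unfolding simplices_in_def J_def using fin KP rep_ordered K \<sigma> P_def by auto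
  have finJ: "finite J" using fin by (simp add: J_def)
  have inj: "inj_on rep K"
    by (rule inj_on_inverseI[of _ oriented]) (use rep_oriented K in blast)
  have sumJ: "(\<Sum>w\<in>J. frag_cmul (c w) (f w)) = f (rep \<sigma>) - (\<Sum>\<tau>\<in>K. f (rep \<tau>))"
    for f :: "'a list \<Rightarrow> ('b \<Rightarrow>\<^sub>0 int)"
  proof -
    have "(\<Sum>w\<in>J. frag_cmul (c w) (f w)) = (\<Sum>w\<in>J. if w = rep \<sigma> then f w else 0) - (\<Sum>w\<in>J. if w \<in> rep ` K then f w else 0)"
      unfolding sum_subtractf[symmetric] by (rule sum.cong) (auto simp: c_def)
    also have "(\<Sum>w\<in>J. if w = rep \<sigma> then f w else 0) = f (rep \<sigma>)"
      using finJ by (simp add: J_def)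
    also have "(\<Sum>w\<in>J. if w \<in> rep ` K then f w else 0) = (\<Sum>w\<in>rep ` K. f w)"
      using finJ by (simp add: J_def sum.If_cases Int_absorb1 subset_insertI)
    also have "\<dots> = (\<Sum>\<tau>\<in>K. f (rep \<tau>))" using inj by (simp add: sum.reindex)
    finally show ?thesis .
  qed
  have sumJr: "(\<Sum>w\<in>J. of_int (c w) * f w) = f (rep \<sigma>) - (\<Sum>\<tau>\<in>K. f (rep \<tau>))" for f :: "'a list \<Rightarrow> real"
  proof -
    have "(\<Sum>w\<in>J. of_int (c w) * f w) = (\<Sum>w\<in>J. if w = rep \<sigma> then f w else 0) - (\<Sum>w\<in>J. if w \<in> rep ` K then f w else 0)"
      unfolding sum_subtractf[symmetric] by (rule sum.cong) (auto simp: c_def)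
    also have "(\<Sum>w\<in>J. if w = rep \<sigma> then f w else 0) = f (rep \<sigma>)"
      using finJ by (simp add: J_def)
    also have "(\<Sum>w\<in>J. if w \<in> rep ` K then f w else 0) = (\<Sum>w\<in>rep ` K. f w)"
      using finJ by (simp add: J_def sum.If_cases Int_absorb1 subset_insertI)
    also have "\<dots> = (\<Sum>\<tau>\<in>K. f (rep \<tau>))" using inj by (simp add: sum.reindex)
    finally show ?thesis .
  qed
  \<comment> \<open>Off these planes, membership in a simplex of \<open>J\<close> means that all its
    barycentric coordinates are positive.\<close>
  define E where "E = (\<lambda>(w, i). affine hull set (facet i w)) ` (J \<times> {..n})"
  have Jw: "w \<in> ordered_simplices n" "affine hull set w = P" if "w \<in> J" for w
    using J that by (auto simp: simplices_in_def)
  have "vanishing n P J c"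
    unfolding vanishing_def
  proof (intro exI[of _ E] conjI allI impI)
    show "finite E" using finJ by (simp add: E_def)
    show "\<forall>L\<in>E. affine L \<and> aff_dim L < int n"
    proof
      fix L assume "L \<in> E"
      then obtain w i where wi: "w \<in> J" "i \<le> n" "L = affine hull set (facet i w)" by (auto simp: E_def)
      have "aff_dim (set (facet i w)) = int (n - 1)"
        by (rule aff_dim_ordered_simplex[OF facet_ordered_simplex[OF Jw(1)[OF wi(1)] n wi(2)]])
      then show "affine L \<and> aff_dim L < int n" using wi(3) n by simp
    qed
  next
    fix B :: "'a list" and x assume B: "length B = n" and x: "x \<in> P - \<Union>E"
    have pos: "0 < bary w i x" if "w \<in> J" "x \<in> convex hull set w" "i \<le> n" for w i
    proof -
      have "x \<notin> affine hull set (facet i w)" using x that by (auto simp: E_def)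
      then have "bary w i x \<noteq> 0"
        using mem_affine_hull_facet_iff[OF Jw(1)[OF that(1)] that(3)] Jw(2)[OF that(1)] x by blast
      then show ?thesis using mem_convex_hull_iff_bary[OF Jw(1)[OF that(1)]] that by force
    qed
    have one: "\<tau> = \<tau>'" if "\<tau> \<in> K" "\<tau>' \<in> K" "x \<in> body \<tau>" "x \<in> body \<tau>'" for \<tau> \<tau>'
    proof (rule ccontr)
      assume "\<tau> \<noteq> \<tau>'"
      then have "hausdorff_measure n (convex hull set (rep \<tau>) \<inter> convex hull set (rep \<tau>')) = 0"
        using null[OF that(1,2)] body_rep[OF K[OF that(1)]] body_rep[OF K[OF that(2)]] by simp
      moreover have "hausdorff_measure n (convex hull set (rep \<tau>) \<inter> convex hull set (rep \<tau>')) \<noteq> 0"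
      proof (rule hausdorff_measure_Int_simplices[OF rep_ordered[OF K] rep_ordered[OF K] n])
        show "x \<in> affine hull set (rep \<tau>')" using KP[OF that(2)] x by simp
      qed (use that KP body_rep[OF K] pos in \<open>auto simp: J_def\<close>)
      ultimately show False by simp
    qed
    have "(\<Sum>w\<in>J. of_int (c w) * sgn (orient_det B w) * indicator (convex hull set w) x)
      = sgn (orient_det B (rep \<sigma>)) * indicator (convex hull set (rep \<sigma>)) x
        - (\<Sum>\<tau>\<in>K. sgn (orient_det B (rep \<tau>)) * indicator (convex hull set (rep \<tau>)) x)"
      using sumJr[of "\<lambda>w. sgn (orient_det B w) * indicator (convex hull set w) x"] by (simp add: mult.assoc)
    also have "(\<Sum>\<tau>\<in>K. sgn (orient_det B (rep \<tau>)) * indicator (convex hull set (rep \<tau>)) x)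
      = (\<Sum>\<tau>\<in>K. sgn (orient_det B (rep \<sigma>)) * indicator (body \<tau>) x)"
      by (rule sum.cong) (simp_all add: Kdet[OF _ B] body_rep[OF K])
    also have "\<dots> = sgn (orient_det B (rep \<sigma>)) * (\<Sum>\<tau>\<in>K. indicator (body \<tau>) x)"
      by (simp add: sum_distrib_left)
    also have "(\<Sum>\<tau>\<in>K. indicator (body \<tau>) x) = (indicator (body \<sigma>) x :: real)"
    proof (cases "x \<in> body \<sigma>")
      case True
      then obtain \<tau> where \<tau>: "\<tau> \<in> K" "x \<in> body \<tau>" using un by blast
      have "(\<Sum>\<tau>'\<in>K. indicator (body \<tau>') x :: real) = (\<Sum>\<tau>'\<in>K. if \<tau>' = \<tau> then 1 else 0)"
      proof (rule sum.cong[OF refl])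
        fix \<tau>' assume "\<tau>' \<in> K"
        then show "indicator (body \<tau>') x = (if \<tau>' = \<tau> then 1 else (0::real))"
          using one[OF _ \<tau>(1) _ \<tau>(2), of \<tau>'] \<tau>(2) by (cases "\<tau>' = \<tau>") (auto simp: indicator_def)
      qed
      then show ?thesis using True fin \<tau> by simp
    next
      case False
      then have "x \<notin> body \<tau>" if "\<tau> \<in> K" for \<tau> using un that by blast
      then show ?thesis using False by simp
    qed
    finally show "(\<Sum>w\<in>J. of_int (c w) * sgn (orient_det B w) * indicator (convex hull set w) x) = (0::real)"
      by (simp add: body_rep[OF \<sigma>])
  qed
  then have "(\<Sum>w\<in>J. frag_cmul (c w) (list_boundary w)) \<in> null_chains (n - 1)"
    using vanishing_imp_null(2)[OF J _ n] by blast
  then show ?thesis unfolding sumJ .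
qed

lemma formal_boundary_eq:
  assumes "v \<in> ordered_simplices (Suc k)"
  shows "formal_boundary v = frag_extend (simplex_chain k) (list_boundary v)"
proof -
  have "facet i v \<in> ordered_simplices k" if "i < length v" for i
    using facet_ordered_simplex[OF assms, of i] that length_ordered_simplex[OF assms] by simp
  then show ?thesis
    unfolding formal_boundary_def list_boundary_def facet_def[symmetric]
    by (auto simp: frag_extend_sum frag_extend_cmul simplex_chain_def intro!: sum.cong)
qed

text \<open>A homomorphism on formal sums needs one value per oriented simplex, hence the ordering
  chosen by \<open>rep\<close>. Another ordering changes the value only by an element of
  \<open>chain_relations\<close>, as \<open>formal_boundary_rep\<close> shows.\<close>

definition boundary_frag :: "('a osimplex \<Rightarrow>\<^sub>0 int) \<Rightarrow> ('a osimplex \<Rightarrow>\<^sub>0 int)" where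
  "boundary_frag = frag_extend (\<lambda>\<sigma>. formal_boundary (rep \<sigma>))"

lemma boundary_frag_rep:
  "w \<in> ordered_simplices (Suc k) \<Longrightarrow>
    boundary_frag (frag_of (oriented w)) = frag_extend (simplex_chain k) (list_boundary (rep (oriented w)))"
  unfolding boundary_frag_def frag_extend_of
  by (rule formal_boundary_eq[OF rep_ordered]) (auto simp: oriented_simplices_def)

lemma keys_formal_boundary:
  assumes "v \<in> ordered_simplices (Suc k)"
  shows "is_formal_chain k (formal_boundary v)"
proof -
  have "facet i v \<in> ordered_simplices k" if "i < length v" for i
    using facet_ordered_simplex[OF assms, of i] that length_ordered_simplex[OF assms] by simp
  then have "formal_boundary v \<in> carrier (free_chains k)"
    unfolding formal_boundary_def facet_def[symmetric]
    by (intro sum_closed_free_Abelian_group) (auto simp: oriented_simplices_def)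
  then show ?thesis by simp
qed

lemma keys_boundary_frag:
  assumes "is_formal_chain (Suc k) c"
  shows "is_formal_chain k (boundary_frag c)"
proof -
  have "Poly_Mapping.keys (boundary_frag c) \<subseteq> (\<Union>\<sigma>\<in>Poly_Mapping.keys c. Poly_Mapping.keys (formal_boundary (rep \<sigma>)))"
    unfolding boundary_frag_def by (rule keys_frag_extend)
  also have "\<dots> \<subseteq> oriented_simplices k"
    using assms keys_formal_boundary[OF rep_ordered] by blast
  finally show ?thesis .
qed

text \<open>\<open>vanishing_pair\<close> settles odd permutations and
  \<open>subdivision_boundary_null\<close> settles subdivisions, both on lists;
  \<open>null_chains_imp_relations\<close> carries the result over.\<close>

lemma boundary_frag_relators:
  assumes "x \<in> relators (Suc k)"
  shows "boundary_frag x \<in> chain_relations k"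
proof -
  consider (1) vs p where "x = frag_of (oriented vs) + frag_of (oriented (permute_list p vs))"
      "vs \<in> ordered_simplices (Suc k)" "p permutes {..<Suc (Suc k)}" "\<not> evenperm p"
    | (2) \<sigma> K where "x = frag_of \<sigma> - (\<Sum>\<tau>\<in>K. frag_of \<tau>)" "\<sigma> \<in> oriented_simplices (Suc k)" "subdivision (Suc k) \<sigma> K"
    using assms unfolding relators_def by blast
  then show ?thesis
  proof cases
    case 1
    let ?w = "permute_list p vs"
    have w: "?w \<in> ordered_simplices (Suc k)" by (rule permute_list_ordered_simplex[OF 1(2,3)])
    have o: "oriented vs \<in> oriented_simplices (Suc k)" "oriented ?w \<in> oriented_simplices (Suc k)"
      using w 1(2) by (auto simp: oriented_simplices_def)
    note r = rep_mem[OF o(1)] rep_mem[OF o(2)]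
    have len: "length vs = Suc (Suc k)" by (rule length_ordered_simplex[OF 1(2)])
    have "list_boundary (rep (oriented vs)) + frag_cmul 1 (list_boundary (rep (oriented ?w))) \<in> null_chains (Suc k - 1)"
    proof (rule vanishing_pair[OF rep_ordered[OF o(1)] rep_ordered[OF o(2)]])
      show "set (rep (oriented vs)) = set (rep (oriented ?w))"
        using oriented_set[OF 1(2) r(1)] oriented_set[OF w r(2)] 1(3) len by simp
      fix B :: "'a list" assume B: "length B = Suc k"
      have "orient_det B ?w = - orient_det B vs"
        using orient_det_permute[of p B vs] B 1(3,4) len by (simp add: sign_def)
      then show "orient_det B (rep (oriented vs)) + of_int 1 * orient_det B (rep (oriented ?w)) = 0"
        using oriented_det[OF 1(2) r(1) B] oriented_det[OF w r(2) B] by simp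
    qed auto
    then have "frag_extend (simplex_chain k) (list_boundary (rep (oriented vs)) + list_boundary (rep (oriented ?w)))
        \<in> chain_relations k"
      using null_chains_imp_relations by simp
    moreover have "boundary_frag x = frag_extend (simplex_chain k) (list_boundary (rep (oriented vs)) + list_boundary (rep (oriented ?w)))"
      unfolding 1(1) frag_extend_add boundary_frag_rep[OF 1(2), symmetric] boundary_frag_rep[OF w, symmetric]
      by (simp add: boundary_frag_def frag_extend_add)
    ultimately show ?thesis by simp
  next
    case 2
    have K: "finite K" "\<And>\<tau>. \<tau> \<in> K \<Longrightarrow> \<tau> \<in> oriented_simplices (Suc k)"
      using 2(3) by (auto simp: subdivision_def)
    have "list_boundary (rep \<sigma>) - (\<Sum>\<tau>\<in>K. list_boundary (rep \<tau>)) \<in> null_chains k"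
      using subdivision_boundary_null[OF 2(3,2)] by simp
    then have "frag_extend (simplex_chain k) (list_boundary (rep \<sigma>) - (\<Sum>\<tau>\<in>K. list_boundary (rep \<tau>))) \<in> chain_relations k"
      by (rule null_chains_imp_relations)
    moreover have "boundary_frag x = frag_extend (simplex_chain k) (list_boundary (rep \<sigma>) - (\<Sum>\<tau>\<in>K. list_boundary (rep \<tau>)))"
    proof -
      have "(\<Sum>\<tau>\<in>K. formal_boundary (rep \<tau>)) = (\<Sum>\<tau>\<in>K. frag_extend (simplex_chain k) (list_boundary (rep \<tau>)))"
        by (rule sum.cong) (simp_all add: formal_boundary_eq[OF rep_ordered] K)
      then show ?thesis
        unfolding 2(1) boundary_frag_def using 2(2) K(1)
        by (simp add: frag_extend_diff frag_extend_sum o_def formal_boundary_eq[OF rep_ordered])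
    qed
    ultimately show ?thesis by simp
  qed
qed

lemma boundary_frag_relations:
  assumes "x \<in> chain_relations (Suc k)"
  shows "boundary_frag x \<in> chain_relations k"
  using assms unfolding chain_relations_def[of "Suc k"]
proof induction
  case one
  then show ?case by (simp add: boundary_frag_def chain_relations_zero)
next
  case (incl h)
  then show ?case by (rule boundary_frag_relators)
next
  case (inv h)
  then have "is_formal_chain (Suc k) h" using relators_subset by fastforce
  then show ?case
    using chain_relations_minus[OF boundary_frag_relators[OF inv]]
    by (simp add: boundary_frag_def frag_extend_minus)
next
  case (eng h1 h2)
  then show ?case using chain_relations_add by (simp add: boundary_frag_def frag_extend_add)
qed

lemma boundary_frag_diff: "boundary_frag (a - b) = boundary_frag a - boundary_frag b"
  by (simp add: boundary_frag_def frag_extend_diff)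

lemma formal_boundary_rep:
  assumes v: "v \<in> ordered_simplices (Suc k)"
  shows "boundary_frag (frag_of (oriented v)) - formal_boundary v \<in> chain_relations k"
proof -
  have o: "oriented v \<in> oriented_simplices (Suc k)" using v by (auto simp: oriented_simplices_def)
  have "list_boundary (rep (oriented v)) + frag_cmul (- 1) (list_boundary v) \<in> null_chains (Suc k - 1)"
    by (rule vanishing_pair[OF rep_ordered[OF o] v])
      (use oriented_set[OF v rep_mem[OF o]] oriented_det[OF v rep_mem[OF o]] in auto)
  then have "frag_extend (simplex_chain k) (list_boundary (rep (oriented v)) - list_boundary v) \<in> chain_relations k"
    using null_chains_imp_relations by simp
  then show ?thesis unfolding frag_extend_diff boundary_frag_rep[OF v] formal_boundary_eq[OF v] .
qed

text \<open>\<open>boundary\<close> is a definite description, so its properties require existence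
  and uniqueness. For existence, \<open>boundary_frag\<close> descends to cosets by
  \<open>boundary_frag_relations\<close> and takes the prescribed value at every ordering by
  \<open>formal_boundary_rep\<close>. Uniqueness holds because homomorphisms that agree on simplices
  agree on all differences of formal sums.\<close>

theorem boundary_hom: "boundary k \<in> hom (chain_group (Suc k)) (chain_group k)"
proof -
  let ?G = "chain_group (Suc k) :: 'a chain monoid" and ?H = "chain_group k :: 'a chain monoid"
  let ?P = "\<lambda>f. f \<in> hom ?G ?H \<and> f \<in> extensional (carrier ?G) \<and>
     (\<forall>vs\<in>ordered_simplices (Suc k).
        f (chain_class (Suc k) (frag_of (oriented vs))) = chain_class k (formal_boundary vs))"
  let ?S = "oriented_simplices (Suc k)"
  define sel where "sel X = (SOME c. Poly_Mapping.keys c \<subseteq> ?S \<and> X = chain_class (Suc k) c)" for X :: "'a chain"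
  define f where "f = (\<lambda>X\<in>carrier ?G. chain_class k (boundary_frag (sel X)))"
  have f: "f (chain_class (Suc k) c) = chain_class k (boundary_frag c)" if c: "Poly_Mapping.keys c \<subseteq> ?S" for c
  proof -
    let ?X = "chain_class (Suc k) c"
    have "Poly_Mapping.keys (sel ?X) \<subseteq> ?S \<and> ?X = chain_class (Suc k) (sel ?X)"
      unfolding sel_def by (rule someI[of _ c]) (use c in simp)
    then have "c - sel ?X \<in> chain_relations (Suc k)" using chain_class_eq_iff by blast
    then have "boundary_frag c - boundary_frag (sel ?X) \<in> chain_relations k"
      using boundary_frag_relations[of "c - sel ?X" k] by (simp add: boundary_frag_diff)
    then have "chain_class k (boundary_frag c) = chain_class k (boundary_frag (sel ?X))"
      by (simp add: chain_class_eq_iff)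
    then show ?thesis using chain_class_in_carrier[OF c] by (simp add: f_def)
  qed
  have "?P f"
  proof (intro conjI ballI)
    show "f \<in> hom ?G ?H"
    proof (rule homI)
      fix X assume "X \<in> carrier ?G"
      then obtain c where "Poly_Mapping.keys c \<subseteq> ?S" "X = chain_class (Suc k) c" by (rule chain_groupE)
      then show "f X \<in> carrier ?H" using f chain_class_in_carrier[OF keys_boundary_frag] by simp
    next
      fix X Y assume XY: "X \<in> carrier ?G" "Y \<in> carrier ?G"
      obtain c where c: "Poly_Mapping.keys c \<subseteq> ?S" "X = chain_class (Suc k) c" using XY(1) by (rule chain_groupE)
      obtain d where d: "Poly_Mapping.keys d \<subseteq> ?S" "Y = chain_class (Suc k) d" using XY(2) by (rule chain_groupE)
      have "boundary_frag (c + d) = boundary_frag c + boundary_frag d"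
        by (simp add: boundary_frag_def frag_extend_add)
      then show "f (X \<otimes>\<^bsub>?G\<^esub> Y) = f X \<otimes>\<^bsub>?H\<^esub> f Y"
        unfolding c(2) d(2) mult_chain_group[OF c(1) d(1)] f[OF keys_add_subset[OF c(1) d(1)]] f[OF c(1)] f[OF d(1)]
        by (simp add: mult_chain_group keys_boundary_frag[OF c(1)] keys_boundary_frag[OF d(1)])
    qed
    show "f \<in> extensional (carrier ?G)" by (simp add: f_def)
    fix vs :: "'a list" assume vs: "vs \<in> ordered_simplices (Suc k)"
    then have "oriented vs \<in> ?S" by (auto simp: oriented_simplices_def)
    then show "f (chain_class (Suc k) (frag_of (oriented vs))) = chain_class k (formal_boundary vs)"
      using formal_boundary_rep[OF vs] by (simp add: f chain_class_eq_iff)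
  qed
  moreover have "g = h" if g: "?P g" and h: "?P h" for g h
  proof (rule extensionalityI[OF conjunct1[OF conjunct2[OF g]] conjunct1[OF conjunct2[OF h]]])
    fix X assume "X \<in> carrier ?G"
    then obtain c where c: "Poly_Mapping.keys c \<subseteq> ?S" "X = chain_class (Suc k) c" by (rule chain_groupE)
    have "g (chain_class (Suc k) c) = h (chain_class (Suc k) c)"
    proof (rule free_Abelian_group_induct[OF c(1), of "\<lambda>c. g (chain_class (Suc k) c) = h (chain_class (Suc k) c)"])
      have "g (\<one>\<^bsub>?G\<^esub>) = \<one>\<^bsub>?H\<^esub>" "h (\<one>\<^bsub>?G\<^esub>) = \<one>\<^bsub>?H\<^esub>"
        by (rule hom_one[OF conjunct1[OF g] group_chain_group group_chain_group]
            hom_one[OF conjunct1[OF h] group_chain_group group_chain_group])+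
      then show "g (chain_class (Suc k) 0) = h (chain_class (Suc k) 0)" by (simp add: one_chain_group)
    next
      fix a b
      assume 2: "Poly_Mapping.keys a \<subseteq> ?S" "Poly_Mapping.keys b \<subseteq> ?S"
        "g (chain_class (Suc k) a) = h (chain_class (Suc k) a)" "g (chain_class (Suc k) b) = h (chain_class (Suc k) b)"
      have X: "chain_class (Suc k) (a - b) \<in> carrier ?G" "chain_class (Suc k) b \<in> carrier ?G"
        by (rule chain_class_in_carrier[OF keys_diff_subset[OF 2(1,2)]] chain_class_in_carrier[OF 2(2)])+
      have "chain_class (Suc k) a = chain_class (Suc k) (a - b) \<otimes>\<^bsub>?G\<^esub> chain_class (Suc k) b"
        by (simp add: mult_chain_group[OF keys_diff_subset[OF 2(1,2)] 2(2)])
      then have ga: "u (chain_class (Suc k) a) = u (chain_class (Suc k) (a - b)) \<otimes>\<^bsub>?H\<^esub> u (chain_class (Suc k) b)"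
        if "u \<in> hom ?G ?H" for u using hom_mult[OF that X] by simp
      have "g (chain_class (Suc k) (a - b)) \<otimes>\<^bsub>?H\<^esub> g (chain_class (Suc k) b)
        = h (chain_class (Suc k) (a - b)) \<otimes>\<^bsub>?H\<^esub> g (chain_class (Suc k) b)"
        using ga[of g] ga[of h] g h 2 by simp
      moreover have "g (chain_class (Suc k) (a - b)) \<in> carrier ?H" "h (chain_class (Suc k) (a - b)) \<in> carrier ?H"
        "g (chain_class (Suc k) b) \<in> carrier ?H"
        using g h X by (auto intro: hom_in_carrier)
      ultimately show "g (chain_class (Suc k) (a - b)) = h (chain_class (Suc k) (a - b))"
        using group.right_cancel[OF group_chain_group] by blast
    next
      fix \<sigma> :: "'a osimplex" assume 3: "\<sigma> \<in> ?S"
      then obtain vs where "vs \<in> ordered_simplices (Suc k)" "\<sigma> = oriented vs" by (auto simp: oriented_simplices_def)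
      then show "g (chain_class (Suc k) (frag_of \<sigma>)) = h (chain_class (Suc k) (frag_of \<sigma>))" using g h by simp
    qed
    then show "g X = h X" using c(2) by simp
  qed
  ultimately have "boundary k = f"
    unfolding boundary_def by (intro the_equality) blast+
  then show ?thesis using \<open>?P f\<close> by simp
qed

section \<open>Refinement into small simplices\<close>

text \<open>Balls are convex, used twice: the hull lies in the ball of radius \<open>r\<close> about
  each vertex, so all vertices, and with them the hull, lie in the ball of radius \<open>r\<close>
  about each point of the hull.\<close>

lemma diameter_convex_hull_le:
  fixes S :: "'a::euclidean_space set"
  assumes S: "finite S" "\<And>x y. x \<in> S \<Longrightarrow> y \<in> S \<Longrightarrow> norm (x - y) \<le> r" and r: "0 \<le> r"
  shows "diameter (convex hull S) \<le> r"
proof (rule diameter_le)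
  fix x y assume xy: "x \<in> convex hull S" "y \<in> convex hull S"
  have 1: "convex hull S \<subseteq> cball a r" if "a \<in> S" for a
    using S(2)[OF that] by (intro hull_minimal) (auto simp: dist_norm)
  have "a \<in> cball x r" if "a \<in> S" for a
    using 1[OF that] xy(1) by (auto simp: dist_commute)
  then have "convex hull S \<subseteq> cball x r" by (intro hull_minimal) auto
  then show "norm (x - y) \<le> r" using xy(2) by (auto simp: dist_norm)
qed (use r in simp)

text \<open>Each edge counts once. The cardinality is the quantity that decreases under
  bisection.\<close>

definition long_edges :: "real \<Rightarrow> 'a::euclidean_space list \<Rightarrow> (nat \<times> nat) set" where
  "long_edges r w = {(i, j). i < j \<and> j < length w \<and> r < (norm (w ! i - w ! j))\<^sup>2}"

lemma finite_long_edges: "finite (long_edges r w)"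
  by (rule finite_subset[of _ "{..<length w} \<times> {..<length w}"]) (auto simp: long_edges_def)

text \<open>The length of a median, by the theorem of Apollonius.\<close>

lemma norm_midpoint_sq:
  fixes a b c :: "'a::euclidean_space"
  shows "(norm ((1/2) *\<^sub>R a + (1/2) *\<^sub>R b - c))\<^sup>2
    = (norm (a - c))\<^sup>2 / 2 + (norm (b - c))\<^sup>2 / 2 - (norm (a - b))\<^sup>2 / 4"
  unfolding power2_norm_eq_inner
  by (simp add: inner_diff_left inner_diff_right inner_add_left inner_add_right inner_commute field_simps)

text \<open>The factor \<open>4/5\<close>: halving an edge of squared length above \<open>r\<close> creates medians of squared length
  at most \<open>R - r/4\<close>, which equals \<open>r\<close> for \<open>r = 4R/5\<close>.\<close>

lemma midpoint_edges:
  fixes w :: "'a::euclidean_space list"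
  assumes R: "\<And>i j. i < length w \<Longrightarrow> j < length w \<Longrightarrow> (norm (w ! i - w ! j))\<^sup>2 \<le> R" "0 \<le> R"
    and ij: "i < length w" "j < length w" "i \<noteq> j" and long: "4/5 * R < (norm (w ! i - w ! j))\<^sup>2"
    and m: "m = (1 - 1/2) *\<^sub>R w ! i + (1/2) *\<^sub>R w ! j" and l: "l < length w"
  shows "(norm (m - w ! l))\<^sup>2 \<le> 4/5 * R"
proof -
  have m': "m = (1/2) *\<^sub>R w ! i + (1/2) *\<^sub>R w ! j" unfolding m by simp
  have "(norm (m - w ! l))\<^sup>2 = (norm (w ! i - w ! l))\<^sup>2 / 2 + (norm (w ! j - w ! l))\<^sup>2 / 2
      - (norm (w ! i - w ! j))\<^sup>2 / 4"
    unfolding m' by (rule norm_midpoint_sq)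
  moreover have "(norm (w ! i - w ! l))\<^sup>2 \<le> R" "(norm (w ! j - w ! l))\<^sup>2 \<le> R" using R(1) ij l by auto
  ultimately show ?thesis using long by linarith
qed

text \<open>All edges at the new vertex are short by \<open>near\<close>, so no long edge arises,
  while the long edge between positions \<open>a\<close> and \<open>b\<close> becomes short.\<close>

lemma bisect_long_edges:
  fixes w :: "'a::euclidean_space list"
  assumes R: "\<And>i j. i < length w \<Longrightarrow> j < length w \<Longrightarrow> (norm (w ! i - w ! j))\<^sup>2 \<le> R" "0 \<le> R"
    and ab: "a < length w" "b < length w" "a \<noteq> b" and long: "4/5 * R < (norm (w ! a - w ! b))\<^sup>2"
    and near: "\<And>l. l < length w \<Longrightarrow> (norm (m - w ! l))\<^sup>2 \<le> 4/5 * R"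
  shows "long_edges (4/5 * R) (w[a := m]) \<subset> long_edges (4/5 * R) w"
    and "i < length w \<Longrightarrow> j < length w \<Longrightarrow> (norm (w[a := m] ! i - w[a := m] ! j))\<^sup>2 \<le> R"
proof -
  have R45: "4/5 * R \<le> R" using R(2) by simp
  have nr: "(norm (w[a := m] ! i - w[a := m] ! j))\<^sup>2 \<le> 4/5 * R"
    if "i < length w" "j < length w" "i = a \<or> j = a" for i j
    using that near R(2) by (cases "i = a"; cases "j = a") (auto simp: norm_minus_commute)
  show "(norm (w[a := m] ! i - w[a := m] ! j))\<^sup>2 \<le> R" if "i < length w" "j < length w"
  proof (cases "i = a \<or> j = a")
    case True
    then show ?thesis using nr[OF that] R45 by linarith
  next
    case False
    then show ?thesis using R(1)[OF that] by simp
  qed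
  have "long_edges (4/5 * R) (w[a := m]) \<subseteq> long_edges (4/5 * R) w"
  proof
    fix z assume "z \<in> long_edges (4/5 * R) (w[a := m])"
    then obtain i j where z: "z = (i, j)" "i < j" "j < length w"
      "4/5 * R < (norm (w[a := m] ! i - w[a := m] ! j))\<^sup>2" by (auto simp: long_edges_def)
    then have "i \<noteq> a" "j \<noteq> a" using nr[of i j] by auto
    then show "z \<in> long_edges (4/5 * R) w" using z by (auto simp: long_edges_def)
  qed
  moreover have "(min a b, max a b) \<in> long_edges (4/5 * R) w"
    using ab long by (auto simp: long_edges_def min_def max_def norm_minus_commute)
  moreover have "(min a b, max a b) \<notin> long_edges (4/5 * R) (w[a := m])"
    using nr[of "min a b" "max a b"] ab by (auto simp: long_edges_def min_def max_def)
  ultimately show "long_edges (4/5 * R) (w[a := m]) \<subset> long_edges (4/5 * R) w" by blast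
qed

text \<open>Induction on the number of edges of squared length above \<open>4/5 * R\<close>.
  Bisecting one of them lowers this number in both halves and keeps all squared lengths below the
  bound \<open>R\<close>.\<close>

lemma simplex_refinement_step:
  fixes w :: "'a::euclidean_space list"
  assumes "w \<in> ordered_simplices n" "0 \<le> R"
    and "\<And>i j. i \<le> n \<Longrightarrow> j \<le> n \<Longrightarrow> (norm (w ! i - w ! j))\<^sup>2 \<le> R"
  shows "\<exists>c. frag_of w - c \<in> null_chains n \<and> (\<forall>v\<in>Poly_Mapping.keys c. v \<in> ordered_simplices n \<and>
    (\<forall>i\<le>n. \<forall>j\<le>n. (norm (v ! i - v ! j))\<^sup>2 \<le> 4/5 * R))"
  using assms(1,3)
proof (induction "card (long_edges (4/5 * R) w)" arbitrary: w rule: less_induct)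
  case less
  have len: "length w = Suc n" by (rule length_ordered_simplex[OF less.prems(1)])
  have Rw: "(norm (w ! i - w ! j))\<^sup>2 \<le> R" if "i < length w" "j < length w" for i j
    using less.prems(2) that len by simp
  show ?case
  proof (cases "long_edges (4/5 * R) w = {}")
    case True
    have "(norm (w ! i - w ! j))\<^sup>2 \<le> 4/5 * R" if "i \<le> n" "j \<le> n" for i j
    proof -
      have short: "(norm (w ! i - w ! j))\<^sup>2 \<le> 4/5 * R" if "i < j" "j \<le> n" for i j
      proof -
        have "(i, j) \<notin> long_edges (4/5 * R) w" using True by blast
        then show ?thesis using that len unfolding long_edges_def by (simp add: not_less)
      qed
      show ?thesis
        using short[of i j] short[of j i] that assms(2)
        by (cases i j rule: linorder_cases) (auto simp: norm_minus_commute)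
    qed
    then show ?thesis
      using less.prems(1) by (intro exI[of _ "frag_of w"]) (auto simp: null_chains.zero keys_frag_of)
  next
    case False
    then obtain a b where ab: "a < b" "b < length w" "4/5 * R < (norm (w ! a - w ! b))\<^sup>2"
      by (auto simp: long_edges_def)
    define m where "m = (1 - 1/2) *\<^sub>R w ! a + (1/2) *\<^sub>R w ! b"
    have near: "(norm (m - w ! l))\<^sup>2 \<le> 4/5 * R" if "l < length w" for l
      by (rule midpoint_edges[OF Rw assms(2) _ ab(2) _ ab(3) m_def that]) (use ab in auto)
    have ba: "4/5 * R < (norm (w ! b - w ! a))\<^sup>2" using ab(3) by (simp add: norm_minus_commute)
    have aN: "a \<le> n" "b \<le> n" "a \<noteq> b" using ab len by auto
    have ords: "w[a := m] \<in> ordered_simplices n" "w[b := m] \<in> ordered_simplices n"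
      using split_in_relations(1,2)[OF less.prems(1) aN _ _ m_def] by auto
    have sub: "long_edges (4/5 * R) (w[a := m]) \<subset> long_edges (4/5 * R) w"
       "long_edges (4/5 * R) (w[b := m]) \<subset> long_edges (4/5 * R) w"
      using bisect_long_edges(1)[OF Rw assms(2) _ ab(2) _ ab(3) near]
        bisect_long_edges(1)[OF Rw assms(2) ab(2) _ _ ba near] ab by auto
    have RR: "(norm (w[a := m] ! i - w[a := m] ! j))\<^sup>2 \<le> R" "(norm (w[b := m] ! i - w[b := m] ! j))\<^sup>2 \<le> R"
      if "i \<le> n" "j \<le> n" for i j
      using bisect_long_edges(2)[OF Rw assms(2) _ ab(2) _ ab(3) near, of i j]
        bisect_long_edges(2)[OF Rw assms(2) ab(2) _ _ ba near, of i j] ab that len by auto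
    obtain c1 where c1: "frag_of (w[a := m]) - c1 \<in> null_chains n"
      "\<forall>v\<in>Poly_Mapping.keys c1. v \<in> ordered_simplices n \<and> (\<forall>i\<le>n. \<forall>j\<le>n. (norm (v ! i - v ! j))\<^sup>2 \<le> 4/5 * R)"
      using less.hyps[OF psubset_card_mono[OF finite_long_edges sub(1)] ords(1)] RR(1) by blast
    obtain c2 where c2: "frag_of (w[b := m]) - c2 \<in> null_chains n"
      "\<forall>v\<in>Poly_Mapping.keys c2. v \<in> ordered_simplices n \<and> (\<forall>i\<le>n. \<forall>j\<le>n. (norm (v ! i - v ! j))\<^sup>2 \<le> 4/5 * R)"
      using less.hyps[OF psubset_card_mono[OF finite_long_edges sub(2)] ords(2)] RR(2) by blast
    have "frag_of w - frag_of (w[a := m]) - frag_of (w[b := m]) \<in> null_chains n"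
      by (rule null_chains.split[OF len aN _ _ m_def]) auto
    then have "(frag_of w - frag_of (w[a := m]) - frag_of (w[b := m])) + ((frag_of (w[a := m]) - c1) + (frag_of (w[b := m]) - c2)) \<in> null_chains n"
      using c1(1) c2(1) by (intro null_chains_add)
    then have "frag_of w - (c1 + c2) \<in> null_chains n" by (simp add: algebra_simps)
    moreover have "\<forall>v\<in>Poly_Mapping.keys (c1 + c2). v \<in> ordered_simplices n \<and> (\<forall>i\<le>n. \<forall>j\<le>n. (norm (v ! i - v ! j))\<^sup>2 \<le> 4/5 * R)"
      using c1(2) c2(2) keys_add[of c1 c2] by blast
    ultimately show ?thesis by blast
  qed
qed

lemma frag_extend_diff_null:
  assumes "\<And>w. w \<in> Poly_Mapping.keys c \<Longrightarrow> frag_of w - f w \<in> null_chains n"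
  shows "c - frag_extend f c \<in> null_chains n"
proof -
  have "c - frag_extend f c = (\<Sum>w\<in>Poly_Mapping.keys c. frag_cmul (Poly_Mapping.lookup c w) (frag_of w - f w))"
    by (subst (1) frag_expansion) (simp add: frag_extend_def frag_cmul_diff_right sum_subtractf)
  also have "\<dots> \<in> null_chains n"
    using assms by (intro null_chains_sum null_chains_cmul)
  finally show ?thesis .
qed

text \<open>Each round multiplies the bound on squared edge lengths by \<open>4/5\<close>, so
  finitely many rounds bring it down to 1. The sum of all squared lengths is a convenient initial
  bound.\<close>

lemma simplex_refinement:
  fixes w :: "'a::euclidean_space list"
  assumes "w \<in> ordered_simplices n"
  shows "\<exists>c. frag_of w - c \<in> null_chains n \<and> (\<forall>v\<in>Poly_Mapping.keys c. v \<in> ordered_simplices n \<and>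
    (\<forall>i\<le>n. \<forall>j\<le>n. norm (v ! i - v ! j) \<le> 1))"
proof -
  define R where "R = (\<Sum>i\<le>n. \<Sum>j\<le>n. (norm (w ! i - w ! j))\<^sup>2)"
  have R0: "0 \<le> R" by (simp add: R_def sum_nonneg)
  have Rw: "(norm (w ! i - w ! j))\<^sup>2 \<le> R" if "i \<le> n" "j \<le> n" for i j
  proof -
    have "(norm (w ! i - w ! j))\<^sup>2 \<le> (\<Sum>j\<le>n. (norm (w ! i - w ! j))\<^sup>2)"
      using that by (intro member_le_sum) auto
    also have "\<dots> \<le> R" unfolding R_def
      using that by (intro member_le_sum[of i _ "\<lambda>i. \<Sum>j\<le>n. (norm (w ! i - w ! j))\<^sup>2"]) (auto simp: sum_nonneg)
    finally show ?thesis .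
  qed
  have step: "\<exists>c. frag_of w - c \<in> null_chains n \<and> (\<forall>v\<in>Poly_Mapping.keys c. v \<in> ordered_simplices n \<and>
    (\<forall>i\<le>n. \<forall>j\<le>n. (norm (v ! i - v ! j))\<^sup>2 \<le> (4/5) ^ N * R))" for N
  proof (induction N)
    case 0
    then show ?case
      using assms Rw by (intro exI[of _ "frag_of w"]) (auto simp: null_chains.zero keys_frag_of)
  next
    case (Suc N)
    let ?Q = "\<lambda>N c. \<forall>v\<in>Poly_Mapping.keys c. v \<in> ordered_simplices n \<and>
      (\<forall>i\<le>n. \<forall>j\<le>n. (norm (v ! i - v ! j))\<^sup>2 \<le> (4/5) ^ N * R)"
    obtain c where c: "frag_of w - c \<in> null_chains n" "?Q N c" using Suc by blast
    have "\<exists>d. frag_of v - d \<in> null_chains n \<and> ?Q (Suc N) d" if "v \<in> Poly_Mapping.keys c" for v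
    proof -
      have "\<exists>d. frag_of v - d \<in> null_chains n \<and> (\<forall>u\<in>Poly_Mapping.keys d. u \<in> ordered_simplices n \<and>
        (\<forall>i\<le>n. \<forall>j\<le>n. (norm (u ! i - u ! j))\<^sup>2 \<le> 4/5 * ((4/5) ^ N * R)))"
        by (rule simplex_refinement_step) (use c(2) that R0 in auto)
      then show ?thesis by (simp add: mult.assoc)
    qed
    then obtain f where f: "\<And>v. v \<in> Poly_Mapping.keys c \<Longrightarrow> frag_of v - f v \<in> null_chains n"
      "\<And>v. v \<in> Poly_Mapping.keys c \<Longrightarrow> ?Q (Suc N) (f v)" by metis
    have "(frag_of w - c) + (c - frag_extend f c) \<in> null_chains n"
      using c(1) frag_extend_diff_null[of c f n] f(1) by (intro null_chains_add) auto
    then have "frag_of w - frag_extend f c \<in> null_chains n" by simp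
    moreover have "?Q (Suc N) (frag_extend f c)"
      using f(2) keys_frag_extend[of f c] by blast
    ultimately show ?case by blast
  qed
  \<comment> \<open>The shift to \<open>R + 1\<close> keeps the quotient meaningful for
    \<open>R = 0\<close>.\<close>
  obtain N where N: "(4/5) ^ N < 1 / (R + 1)"
    using real_arch_pow_inv[of "1 / (R + 1)" "4/5"] R0 by auto
  have "(4/5) ^ N * R \<le> (4/5) ^ N * (R + 1)" by simp
  also have "\<dots> < 1" using N R0 by (simp add: field_simps)
  finally have small: "(4/5) ^ N * R \<le> 1" by simp
  obtain c where c: "frag_of w - c \<in> null_chains n" "\<forall>v\<in>Poly_Mapping.keys c. v \<in> ordered_simplices n \<and>
    (\<forall>i\<le>n. \<forall>j\<le>n. (norm (v ! i - v ! j))\<^sup>2 \<le> (4/5) ^ N * R)" using step by blast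
  have "norm (v ! i - v ! j) \<le> 1" if "v \<in> Poly_Mapping.keys c" "i \<le> n" "j \<le> n" for v i j
  proof -
    have "(norm (v ! i - v ! j))\<^sup>2 \<le> 1" using c(2) that small by force
    then show ?thesis by (simp add: power_le_one_iff abs_square_le_1)
  qed
  then show ?thesis using c by (intro exI[of _ c]) auto
qed

text \<open>Bisections of lists become relations between oriented simplices by
  \<open>null_chains_imp_relations\<close>. The infimum in \<open>chain_mass\<close> is thereby
  taken over a nonempty set, which is the source of finite flat norms.\<close>

lemma small_representative:
  fixes c :: "'a::euclidean_space osimplex \<Rightarrow>\<^sub>0 int"
  assumes "is_formal_chain k c"
  shows "\<exists>d. c - d \<in> chain_relations k \<and> Poly_Mapping.keys d \<subseteq> small_simplices k"
  using assms
proof (induction c rule: frag_induction)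
  case zero
  then show ?case by (intro exI[of _ 0]) (simp add: chain_relations_zero)
next
  case (one \<sigma>)
  then obtain w where w: "w \<in> ordered_simplices k" "\<sigma> = oriented w" by (auto simp: oriented_simplices_def)
  obtain c where c: "frag_of w - c \<in> null_chains k"
    "\<forall>v\<in>Poly_Mapping.keys c. v \<in> ordered_simplices k \<and> (\<forall>i\<le>k. \<forall>j\<le>k. norm (v ! i - v ! j) \<le> 1)"
    using simplex_refinement[OF w(1)] by blast
  let ?d = "frag_extend (simplex_chain k) c"
  have "frag_of \<sigma> - ?d \<in> chain_relations k"
    using null_chains_imp_relations[OF c(1)] w by (simp add: frag_extend_diff simplex_chain_def)
  moreover have "Poly_Mapping.keys ?d \<subseteq> small_simplices k"
  proof -
    have "Poly_Mapping.keys (simplex_chain k v) \<subseteq> small_simplices k" if "v \<in> Poly_Mapping.keys c" for v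
    proof -
      have v: "v \<in> ordered_simplices k" "\<And>i j. i \<le> k \<Longrightarrow> j \<le> k \<Longrightarrow> norm (v ! i - v ! j) \<le> 1"
        using c(2) that by auto
      have "diameter (convex hull set v) \<le> 1"
      proof (rule diameter_convex_hull_le)
        fix x y assume "x \<in> set v" "y \<in> set v"
        then show "norm (x - y) \<le> 1"
          using v(2) length_ordered_simplex[OF v(1)] by (auto simp: in_set_conv_nth less_Suc_eq_le)
      qed auto
      then show ?thesis
        using v(1) by (auto simp: simplex_chain_def keys_frag_of small_simplices_def oriented_simplices_def)
    qed
    then show ?thesis using keys_frag_extend[of "simplex_chain k" c] by blast
  qed
  ultimately show ?case by blast
next
  case (diff a b)
  then obtain d e where de: "a - d \<in> chain_relations k" "Poly_Mapping.keys d \<subseteq> small_simplices k"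
    "b - e \<in> chain_relations k" "Poly_Mapping.keys e \<subseteq> small_simplices k" by blast
  have "(a - b) - (d - e) = (a - d) - (b - e)" by simp
  then have "(a - b) - (d - e) \<in> chain_relations k" using chain_relations_diff[OF de(1,3)] by (simp only:)
  then show ?case using keys_diff_subset[OF de(2,4)] by blast
qed

section \<open>Masses, norms and the pairing\<close>

lemma ennreal_times_divide_cancel: "0 < m \<Longrightarrow> m < \<infinity> \<Longrightarrow> (x / m) * m = (x :: ennreal)"
  by (simp add: ennreal_divide_times ennreal_divide_self)

text \<open>A finite nonzero \<open>N\<close> can be divided out and multiplied back. For
  \<open>N = 0\<close>, any element of \<open>T\<close> shows \<open>x = 0\<close>.\<close>

lemma le_mult_Inf_ennreal:
  fixes x N :: ennreal
  assumes "N < \<infinity>" "T \<noteq> {}" "\<And>t. t \<in> T \<Longrightarrow> x \<le> N * t"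
  shows "x \<le> N * Inf T"
proof (cases "N = 0")
  case True
  then show ?thesis using assms(2,3) by auto
next
  case False
  then have N: "0 < N" by (simp add: zero_less_iff_neq_zero)
  have "x / N \<le> Inf T"
    by (intro Inf_greatest divide_le_posI_ennreal N assms(3))
  then have "(x / N) * N \<le> Inf T * N" by (rule mult_right_mono) simp
  then show ?thesis unfolding ennreal_times_divide_cancel[OF N assms(1)] by (simp only: mult.commute)
qed

lemma le_Inf_add_Inf_ennreal:
  fixes x :: ennreal
  assumes "\<And>s t. s \<in> S \<Longrightarrow> t \<in> T \<Longrightarrow> x \<le> s + t"
  shows "x \<le> Inf S + Inf T"
proof (rule ennreal_le_epsilon)
  fix e :: real assume fin: "Inf S + Inf T < top_class.top" and e: "0 < e"
  have "Inf S < \<infinity>" "Inf T < \<infinity>" using fin by auto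
  moreover have "x < x + ennreal (e / 2)" if "x < \<infinity>" for x :: ennreal
    using that e by (cases x) (auto simp: ennreal_less_iff simp flip: ennreal_plus)
  ultimately have "Inf S < Inf S + ennreal (e / 2)" "Inf T < Inf T + ennreal (e / 2)" by blast+
  then obtain s t where st: "s \<in> S" "s < Inf S + ennreal (e / 2)" "t \<in> T" "t < Inf T + ennreal (e / 2)"
    unfolding Inf_less_iff by blast
  have "x \<le> s + t" using assms st by blast
  also have "\<dots> \<le> (Inf S + ennreal (e / 2)) + (Inf T + ennreal (e / 2))"
    using st by (intro add_mono) auto
  also have "\<dots> = Inf S + Inf T + (ennreal (e / 2) + ennreal (e / 2))" by (simp add: ac_simps)
  also have "ennreal (e / 2) + ennreal (e / 2) = ennreal e" using e by (simp flip: ennreal_plus)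
  finally show "x \<le> Inf S + Inf T + ennreal e" .
qed

section \<open>Additive functionals on chains\<close>

definition additive_on :: "nat \<Rightarrow> ('a::euclidean_space chain \<Rightarrow> real) \<Rightarrow> bool" where
  "additive_on k A \<longleftrightarrow> (\<forall>X\<in>carrier (chain_group k). \<forall>Y\<in>carrier (chain_group k).
     A (X \<otimes>\<^bsub>chain_group k\<^esub> Y) = A X + A Y)"

lemma additive_on_add:
  assumes "additive_on k A" "is_formal_chain k c" "is_formal_chain k d"
  shows "A (chain_class k (c + d)) = A (chain_class k c) + A (chain_class k d)"
  using assms(1) chain_class_in_carrier[OF assms(2)] chain_class_in_carrier[OF assms(3)] mult_chain_group[OF assms(2,3)]
  unfolding additive_on_def by metis

lemma additive_on_zero: "additive_on k A \<Longrightarrow> A (chain_class k 0) = 0"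
  using additive_on_add[of k A 0 0] by simp

lemma additive_on_diff:
  assumes "additive_on k A" "is_formal_chain k c" "is_formal_chain k d"
  shows "A (chain_class k (c - d)) = A (chain_class k c) - A (chain_class k d)"
  using additive_on_add[OF assms(1) keys_diff_subset[OF assms(2,3)] assms(3)] by simp

lemma additive_on_sum:
  assumes "additive_on k A" "finite I" "\<And>i. i \<in> I \<Longrightarrow> is_formal_chain k (f i)"
  shows "A (chain_class k (sum f I)) = (\<Sum>i\<in>I. A (chain_class k (f i)))"
  using assms(2,3)
proof (induction I rule: finite_induct)
  case empty
  then show ?case using additive_on_zero[OF assms(1)] by simp
next
  case (insert i I)
  have "sum f I \<in> carrier (free_chains k)"
    using insert by (intro sum_closed_free_Abelian_group) simp
  then show ?case using insert additive_on_add[OF assms(1), of "f i" "sum f I"] by simp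
qed

lemma keys_cmul_subset: "Poly_Mapping.keys c \<subseteq> S \<Longrightarrow> Poly_Mapping.keys (frag_cmul n c) \<subseteq> S"
  using keys_cmul[of n c] by blast

lemma additive_on_cmul:
  assumes A: "additive_on k A" and c: "is_formal_chain k c"
  shows "A (chain_class k (frag_cmul n c)) = of_int n * A (chain_class k c)"
proof -
  have nat: "A (chain_class k (frag_cmul (int m) c)) = of_nat m * A (chain_class k c)" for m
  proof (induction m)
    case 0
    then show ?case using additive_on_zero[OF A] by simp
  next
    case (Suc m)
    have "frag_cmul (int (Suc m)) c = c + frag_cmul (int m) c" by (simp add: frag_cmul_distrib)
    then show ?case
      using Suc additive_on_add[OF A c keys_cmul_subset[OF c], of "int m"] by (simp add: algebra_simps)
  qed
  show ?thesis
  proof (cases n)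
    case (nonneg m)
    then show ?thesis using nat by simp
  next
    case (neg m)
    have "frag_cmul n c = 0 - frag_cmul (int (Suc m)) c" using neg by simp
    then have "A (chain_class k (frag_cmul n c)) = A (chain_class k 0) - A (chain_class k (frag_cmul (int (Suc m)) c))"
      using additive_on_diff[OF A _ keys_cmul_subset[OF c], of 0 "int (Suc m)"] by simp
    moreover have "real_of_int n = - real (Suc m)" using neg by simp
    ultimately show ?thesis by (simp only: nat additive_on_zero[OF A])
  qed
qed

lemma additive_on_expand:
  assumes A: "additive_on k A" and c: "is_formal_chain k c"
  shows "A (chain_class k c) = (\<Sum>\<sigma>\<in>Poly_Mapping.keys c. of_int (Poly_Mapping.lookup c \<sigma>) * A (chain_class k (frag_of \<sigma>)))"
proof -
  have "c = (\<Sum>\<sigma>\<in>Poly_Mapping.keys c. frag_cmul (Poly_Mapping.lookup c \<sigma>) (frag_of \<sigma>))"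
    using frag_expansion[of c] by (simp add: frag_extend_def)
  moreover have "A (chain_class k (\<Sum>\<sigma>\<in>Poly_Mapping.keys c. frag_cmul (Poly_Mapping.lookup c \<sigma>) (frag_of \<sigma>)))
    = (\<Sum>\<sigma>\<in>Poly_Mapping.keys c. A (chain_class k (frag_cmul (Poly_Mapping.lookup c \<sigma>) (frag_of \<sigma>))))"
    using c by (intro additive_on_sum[OF A] keys_cmul_subset) auto
  moreover have "\<dots> = (\<Sum>\<sigma>\<in>Poly_Mapping.keys c. of_int (Poly_Mapping.lookup c \<sigma>) * A (chain_class k (frag_of \<sigma>)))"
    using c by (intro sum.cong refl additive_on_cmul[OF A]) auto
  ultimately show ?thesis by simp
qed

text \<open>Each boundary face is the hull of \<open>k\<close> points and so has finite measure in
  dimension \<open>k - 1\<close>; the maximum runs over finitely many faces.\<close>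

lemma simplex_mass_finite:
  assumes \<sigma>: "\<sigma> \<in> oriented_simplices k" and k: "0 < k"
  shows "simplex_mass k \<alpha> \<sigma> < \<infinity>"
proof -
  define w where "w = rep \<sigma>"
  have w: "w \<in> ordered_simplices k" "vertices \<sigma> = set w"
    unfolding w_def using rep_ordered[OF \<sigma>] rep_oriented[OF \<sigma>] vertices_oriented[of "rep \<sigma>"] by auto
  have len: "length w = Suc k" and dist: "distinct w" using w(1) by (auto simp: ordered_simplices_def)
  have faces: "boundary_faces \<sigma> = (\<lambda>v. convex hull (set w - {v})) ` set w"
    unfolding boundary_faces_def w(2) by blast
  have fin: "hausdorff_measure (k - 1) F < \<infinity>" if F: "F \<in> boundary_faces \<sigma>" for F
  proof -
    obtain v where v: "v \<in> set w" "F = convex hull (set w - {v})" using F unfolding faces by blast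
    obtain i where i: "i < length w" "v = w ! i" using v(1) by (auto simp: in_set_conv_nth)
    have "set w - {v} = set (facet i w)"
      using i dist by (auto simp: set_facet in_set_conv_nth nth_eq_iff_index_eq)
    moreover have "length (facet i w) = Suc (k - 1)" using i len k by simp
    ultimately show ?thesis
      using hausdorff_measure_convex_hull_finite(1)[of "facet i w" "k - 1"] v(2) by simp
  qed
  have "finite (boundary_faces \<sigma>)" "boundary_faces \<sigma> \<noteq> {}"
    unfolding faces using len by auto
  then have "(MAX F\<in>boundary_faces \<sigma>. hausdorff_measure (k - 1) F * ennreal (height \<sigma> powr real_of_ereal \<alpha>)) < \<infinity>"
    using fin by (subst Max_less_iff) (auto simp: ennreal_mult_less_top)
  then show ?thesis by (simp add: simplex_mass_def)
qed

lemma small_simplices_subset: "small_simplices k \<subseteq> oriented_simplices k"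
  by (auto simp: small_simplices_def)

text \<open>For finite nonzero mass the quotient can be multiplied back. For \<alpha> = \<infinity>,
  a finite norm means that \<open>A\<close> vanishes on all chains.\<close>

lemma cochain_norm_bound:
  assumes k: "0 < k" and \<sigma>: "\<sigma> \<in> small_simplices k" and N: "cochain_norm k \<alpha> A < \<infinity>"
  shows "ennreal \<bar>A (chain_class k (frag_of \<sigma>))\<bar> \<le> cochain_norm k \<alpha> A * simplex_mass k \<alpha> \<sigma>"
proof (cases "\<alpha> = \<infinity>")
  case True
  then have "A X = 0" if "X \<in> carrier (chain_group k)" for X
    using N that by (auto simp: cochain_norm_def split: if_splits)
  moreover have "chain_class k (frag_of \<sigma>) \<in> carrier (chain_group k)"
    using \<sigma> small_simplices_subset by (intro chain_class_in_carrier) (auto simp: keys_frag_of)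
  ultimately show ?thesis by simp
next
  case False
  let ?x = "ennreal \<bar>A (chain_class k (frag_of \<sigma>))\<bar>" and ?m = "simplex_mass k \<alpha> \<sigma>"
  have m: "?m < \<infinity>" using simplex_mass_finite[OF _ k] \<sigma> small_simplices_subset by blast
  have le: "?x / ?m \<le> cochain_norm k \<alpha> A"
    using False \<sigma> by (simp add: cochain_norm_def) (rule SUP_upper)
  show ?thesis
  proof (cases "?m = 0")
    case True
    \<comment> \<open>In \<open>ennreal\<close> a nonzero number divided by 0 is infinite, so a
      finite norm forces \<open>A\<close> to vanish on a simplex of mass zero.\<close>
    have "?x / ?m \<noteq> \<infinity>" using le N by (metis leD)
    then have "?x = 0" using True by (auto simp: ennreal_divide_eq_top_iff split: if_splits)
    then show ?thesis by simp
  next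
    case False
    then have "0 < ?m" by (simp add: zero_less_iff_neq_zero)
    then have "?x = (?x / ?m) * ?m" using ennreal_times_divide_cancel[OF _ m] by simp
    also have "\<dots> \<le> cochain_norm k \<alpha> A * ?m" using le by (rule mult_right_mono) simp
    finally show ?thesis .
  qed
qed

section \<open>Bounding a cochain by mass and flat norm\<close>

definition frag_mass :: "nat \<Rightarrow> ereal \<Rightarrow> ('a::euclidean_space osimplex \<Rightarrow>\<^sub>0 int) \<Rightarrow> ennreal" where
  "frag_mass k \<alpha> c = (\<Sum>\<sigma>\<in>Poly_Mapping.keys c.
     ennreal (real_of_int \<bar>Poly_Mapping.lookup c \<sigma>\<bar>) * simplex_mass k \<alpha> \<sigma>)"

abbreviation small_representatives ::
    "nat \<Rightarrow> ('a::euclidean_space osimplex \<Rightarrow>\<^sub>0 int) \<Rightarrow> ('a osimplex \<Rightarrow>\<^sub>0 int) set" where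
  "small_representatives k c \<equiv> {d. d - c \<in> chain_relations k \<and> Poly_Mapping.keys d \<subseteq> small_simplices k}"

lemma chain_mass_eq:
  "chain_mass k \<alpha> (chain_class k c) =
    Inf (frag_mass k \<alpha> ` small_representatives k c)"
  unfolding chain_mass_def frag_mass_def mem_chain_class_iff by simp

lemma small_representatives_nonempty:
  assumes "is_formal_chain k c"
  shows "small_representatives k c \<noteq> {}"
proof -
  obtain d where d: "c - d \<in> chain_relations k" "Poly_Mapping.keys d \<subseteq> small_simplices k"
    using small_representative[OF assms] by blast
  then have "d - c \<in> chain_relations k" using chain_relations_minus[OF d(1)] by simp
  then show ?thesis using d(2) by blast
qed

lemma frag_mass_finite:
  assumes "0 < k" "Poly_Mapping.keys c \<subseteq> small_simplices k"
  shows "frag_mass k \<alpha> c < \<infinity>"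
proof -
  have "simplex_mass k \<alpha> \<sigma> < \<infinity>" if "\<sigma> \<in> Poly_Mapping.keys c" for \<sigma>
    using simplex_mass_finite[OF _ assms(1)] small_simplices_subset assms(2) that by blast
  then show ?thesis by (simp add: frag_mass_def ennreal_mult_less_top)
qed

lemma chain_mass_finite:
  assumes "0 < k" "is_formal_chain k c"
  shows "chain_mass k \<alpha> (chain_class k c) < \<infinity>"
proof -
  obtain d where "d \<in> small_representatives k c"
    using small_representatives_nonempty[OF assms(2)] by blast
  then show ?thesis unfolding chain_mass_eq Inf_less_iff using frag_mass_finite[OF assms(1)] by blast
qed

lemma cochain_norm_chain_mass:
  assumes k: "0 < k" and A: "additive_on k A" and N: "cochain_norm k \<alpha> A < \<infinity>"
    and c: "is_formal_chain k c"
  shows "ennreal \<bar>A (chain_class k c)\<bar> \<le> cochain_norm k \<alpha> A * chain_mass k \<alpha> (chain_class k c)"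
  unfolding chain_mass_eq
proof (rule le_mult_Inf_ennreal[OF N])
  fix t assume "t \<in> frag_mass k \<alpha> ` small_representatives k c"
  then obtain d where d: "t = frag_mass k \<alpha> d" "d - c \<in> chain_relations k" "Poly_Mapping.keys d \<subseteq> small_simplices k"
    by blast
  have d': "is_formal_chain k d" using d(3) small_simplices_subset by blast
  have "A (chain_class k c) = A (chain_class k d)" using d(2) chain_class_eq_iff by metis
  also have "\<dots> = (\<Sum>\<sigma>\<in>Poly_Mapping.keys d. of_int (Poly_Mapping.lookup d \<sigma>) * A (chain_class k (frag_of \<sigma>)))"
    by (rule additive_on_expand[OF A d'])
  finally have "\<bar>A (chain_class k c)\<bar> \<le> (\<Sum>\<sigma>\<in>Poly_Mapping.keys d. \<bar>of_int (Poly_Mapping.lookup d \<sigma>) * A (chain_class k (frag_of \<sigma>))\<bar>)"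
    using sum_abs by metis
  then have "ennreal \<bar>A (chain_class k c)\<bar> \<le> ennreal (\<Sum>\<sigma>\<in>Poly_Mapping.keys d. \<bar>of_int (Poly_Mapping.lookup d \<sigma>) * A (chain_class k (frag_of \<sigma>))\<bar>)"
    by (rule ennreal_leI)
  also have "\<dots> = (\<Sum>\<sigma>\<in>Poly_Mapping.keys d. ennreal (real_of_int \<bar>Poly_Mapping.lookup d \<sigma>\<bar>) * ennreal \<bar>A (chain_class k (frag_of \<sigma>))\<bar>)"
    by (subst sum_ennreal[symmetric]) (simp_all add: abs_mult ennreal_mult)
  also have "\<dots> \<le> (\<Sum>\<sigma>\<in>Poly_Mapping.keys d. ennreal (real_of_int \<bar>Poly_Mapping.lookup d \<sigma>\<bar>) * (cochain_norm k \<alpha> A * simplex_mass k \<alpha> \<sigma>))"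
    using d(3) by (intro sum_mono mult_left_mono cochain_norm_bound[OF k _ N]) auto
  also have "\<dots> = cochain_norm k \<alpha> A * t"
    unfolding d(1) frag_mass_def by (simp add: sum_distrib_left mult_ac)
  finally show "ennreal \<bar>A (chain_class k c)\<bar> \<le> cochain_norm k \<alpha> A * t" .
qed (use small_representatives_nonempty[OF c] in simp)

lemma boundary_class:
  assumes "is_formal_chain (Suc k) e"
  obtains f where "is_formal_chain k f" "boundary k (chain_class (Suc k) e) = chain_class k f"
  using hom_in_carrier[OF boundary_hom chain_class_in_carrier[OF assms]] by (rule chain_groupE)

lemma flat_norm_eq:
  "flat_norm k \<alpha> \<beta> X = Inf ((\<lambda>Z. chain_mass k \<alpha> (chain_diff k X (boundary k Z)) + chain_mass (Suc k) \<beta> Z)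
     ` carrier (chain_group (Suc k)))"
  by (simp add: flat_norm_def)

lemma carrier_nonempty: "chain_class k 0 \<in> carrier (chain_group k)"
  by (rule chain_class_in_carrier) simp

lemma additive_on_coboundary:
  assumes "additive_on k A"
  shows "additive_on (Suc k) (coboundary k A)"
  unfolding additive_on_def
proof (intro ballI)
  fix X Y :: "'a chain" assume XY: "X \<in> carrier (chain_group (Suc k))" "Y \<in> carrier (chain_group (Suc k))"
  have "X \<otimes>\<^bsub>chain_group (Suc k)\<^esub> Y \<in> carrier (chain_group (Suc k))"
    using XY group.is_monoid[OF group_chain_group] by (intro monoid.m_closed)
  then show "coboundary k A (X \<otimes>\<^bsub>chain_group (Suc k)\<^esub> Y) = coboundary k A X + coboundary k A Y"
    using XY assms hom_mult[OF boundary_hom XY] hom_in_carrier[OF boundary_hom XY(1)]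
      hom_in_carrier[OF boundary_hom XY(2)]
    by (simp add: coboundary_def additive_on_def)
qed

lemma flat_norm_finite:
  fixes X :: "'a::euclidean_space chain"
  assumes "0 < k" "X \<in> carrier (chain_group k)"
  shows "flat_norm k \<alpha> \<beta> X < \<infinity>"
proof -
  obtain c where c: "is_formal_chain k c" "X = chain_class k c"
    using assms(2) by (rule chain_groupE)
  obtain f where f: "is_formal_chain k f" "boundary k (chain_class (Suc k) (0 :: 'a osimplex \<Rightarrow>\<^sub>0 int)) = chain_class k f"
    using boundary_class[of "(0 :: 'a osimplex \<Rightarrow>\<^sub>0 int)" k] by auto
  have "chain_mass k \<alpha> (chain_diff k X (boundary k (chain_class (Suc k) 0))) + chain_mass (Suc k) \<beta> (chain_class (Suc k) 0) < \<infinity>"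
    using chain_mass_finite[OF assms(1) keys_diff_subset[OF c(1) f(1)]] chain_mass_finite[of "Suc k" 0]
    by (simp add: c f chain_diff_class)
  then show ?thesis unfolding flat_norm_eq Inf_less_iff using carrier_nonempty[of "Suc k"] by blast
qed

lemma pairing_bound:
  assumes k: "0 < k" and A: "additive_on k A" and N: "cochain_norm2 k \<alpha> \<beta> A < \<infinity>"
    and X: "X \<in> carrier (chain_group k)"
  shows "ennreal \<bar>A X\<bar> \<le> cochain_norm2 k \<alpha> \<beta> A * flat_norm k \<alpha> \<beta> X"
  unfolding flat_norm_eq
proof (rule le_mult_Inf_ennreal[OF N])
  let ?T = "\<lambda>Z. chain_mass k \<alpha> (chain_diff k X (boundary k Z)) + chain_mass (Suc k) \<beta> Z"
  fix t assume "t \<in> ?T ` carrier (chain_group (Suc k))"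
  then obtain Z where Z: "Z \<in> carrier (chain_group (Suc k))" "t = ?T Z" by blast
  obtain c where c: "is_formal_chain k c" "X = chain_class k c"
    using X by (rule chain_groupE)
  obtain e where e: "is_formal_chain (Suc k) e" "Z = chain_class (Suc k) e"
    using Z(1) by (rule chain_groupE)
  obtain f where f: "is_formal_chain k f" "boundary k Z = chain_class k f"
    using boundary_class[OF e(1)] e(2) by blast
  let ?a = "cochain_norm k \<alpha> A" and ?b = "cochain_norm (Suc k) \<beta> (coboundary k A)"
  have ab: "?a < \<infinity>" "?b < \<infinity>" using N by (auto simp: cochain_norm2_def)
  have cf: "is_formal_chain k (c - f)" by (rule keys_diff_subset[OF c(1) f(1)])
  have "A X = A (chain_class k (c - f)) + A (chain_class k f)"
    using additive_on_diff[OF A c(1) f(1)] c(2) by simp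
  moreover have "A (chain_class k f) = coboundary k A (chain_class (Suc k) e)"
    using Z(1) e(2) f(2) by (simp add: coboundary_def)
  ultimately have "\<bar>A X\<bar> \<le> \<bar>A (chain_class k (c - f))\<bar> + \<bar>coboundary k A (chain_class (Suc k) e)\<bar>"
    by linarith
  then have "ennreal \<bar>A X\<bar> \<le> ennreal \<bar>A (chain_class k (c - f))\<bar> + ennreal \<bar>coboundary k A (chain_class (Suc k) e)\<bar>"
    by (simp add: ennreal_leI flip: ennreal_plus)
  also have "\<dots> \<le> ?a * chain_mass k \<alpha> (chain_class k (c - f)) + ?b * chain_mass (Suc k) \<beta> (chain_class (Suc k) e)"
    by (intro add_mono cochain_norm_chain_mass k A ab cf e additive_on_coboundary) simp
  \<comment> \<open>Both factors are enlarged to \<open>?a + ?b\<close>, so that one constant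
    multiplies the whole competitor \<open>t\<close> in the infimum.\<close>
  also have "\<dots> \<le> (?a + ?b) * chain_mass k \<alpha> (chain_class k (c - f)) + (?a + ?b) * chain_mass (Suc k) \<beta> (chain_class (Suc k) e)"
    by (intro add_mono mult_right_mono) auto
  also have "\<dots> = cochain_norm2 k \<alpha> \<beta> A * t"
    unfolding Z(2) cochain_norm2_def using c f e by (simp add: chain_diff_class distrib_left)
  finally show "ennreal \<bar>A X\<bar> \<le> cochain_norm2 k \<alpha> \<beta> A * t" .
qed (use carrier_nonempty[of "Suc k"] in blast)

section \<open>The flat norm as a seminorm\<close>

lemma frag_mass_superset:
  assumes "finite S" "Poly_Mapping.keys c \<subseteq> S"
  shows "frag_mass k \<alpha> c = (\<Sum>\<sigma>\<in>S. ennreal (real_of_int \<bar>Poly_Mapping.lookup c \<sigma>\<bar>) * simplex_mass k \<alpha> \<sigma>)"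
  unfolding frag_mass_def using assms
  by (intro sum.mono_neutral_left) (auto simp: in_keys_iff)

lemma frag_mass_add: "frag_mass k \<alpha> (c + d) \<le> frag_mass k \<alpha> c + frag_mass k \<alpha> d"
proof -
  let ?S = "Poly_Mapping.keys c \<union> Poly_Mapping.keys d"
  have "frag_mass k \<alpha> (c + d) = (\<Sum>\<sigma>\<in>?S. ennreal (real_of_int \<bar>Poly_Mapping.lookup (c + d) \<sigma>\<bar>) * simplex_mass k \<alpha> \<sigma>)"
    by (intro frag_mass_superset keys_add) simp
  also have "\<dots> \<le> (\<Sum>\<sigma>\<in>?S. (ennreal (real_of_int \<bar>Poly_Mapping.lookup c \<sigma>\<bar>) + ennreal (real_of_int \<bar>Poly_Mapping.lookup d \<sigma>\<bar>)) * simplex_mass k \<alpha> \<sigma>)"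
    by (intro sum_mono mult_right_mono) (auto simp: lookup_add simp flip: ennreal_plus intro!: ennreal_leI)
  also have "\<dots> = frag_mass k \<alpha> c + frag_mass k \<alpha> d"
    by (simp add: frag_mass_superset[of ?S c] frag_mass_superset[of ?S d] distrib_right sum.distrib)
  finally show ?thesis .
qed

lemma frag_mass_minus: "frag_mass k \<alpha> (- c) = frag_mass k \<alpha> c"
  by (simp add: frag_mass_def)

lemma chain_mass_add:
  "chain_mass k \<alpha> (chain_class k (c + d)) \<le> chain_mass k \<alpha> (chain_class k c) + chain_mass k \<alpha> (chain_class k d)"
  unfolding chain_mass_eq[of k \<alpha> c] chain_mass_eq[of k \<alpha> d]
proof (rule le_Inf_add_Inf_ennreal)
  fix s t
  assume "s \<in> frag_mass k \<alpha> ` small_representatives k c"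
    "t \<in> frag_mass k \<alpha> ` small_representatives k d"
  then obtain a b where a: "s = frag_mass k \<alpha> a" "a - c \<in> chain_relations k" "Poly_Mapping.keys a \<subseteq> small_simplices k"
    and b: "t = frag_mass k \<alpha> b" "b - d \<in> chain_relations k" "Poly_Mapping.keys b \<subseteq> small_simplices k" by blast
  have "(a + b) - (c + d) \<in> chain_relations k"
    using chain_relations_add[OF a(2) b(2)] by (simp add: algebra_simps)
  then have "chain_mass k \<alpha> (chain_class k (c + d)) \<le> frag_mass k \<alpha> (a + b)"
    unfolding chain_mass_eq using keys_add_subset[OF a(3) b(3)] by (intro Inf_lower imageI CollectI conjI)
  also have "\<dots> \<le> s + t" unfolding a(1) b(1) by (rule frag_mass_add)
  finally show "chain_mass k \<alpha> (chain_class k (c + d)) \<le> s + t" .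
qed

lemma chain_mass_minus_le: "chain_mass k \<alpha> (chain_class k (- c)) \<le> chain_mass k \<alpha> (chain_class k c)"
  unfolding chain_mass_eq[of k \<alpha> c]
proof (rule Inf_greatest)
  fix s assume "s \<in> frag_mass k \<alpha> ` small_representatives k c"
  then obtain a where a: "s = frag_mass k \<alpha> a" "a - c \<in> chain_relations k" "Poly_Mapping.keys a \<subseteq> small_simplices k"
    by blast
  have "- a - - c \<in> chain_relations k" using chain_relations_minus[OF a(2)] by (simp add: algebra_simps)
  then have "chain_mass k \<alpha> (chain_class k (- c)) \<le> frag_mass k \<alpha> (- a)"
    unfolding chain_mass_eq using a(3) by (intro Inf_lower) auto
  then show "chain_mass k \<alpha> (chain_class k (- c)) \<le> s" by (simp add: a(1) frag_mass_minus)
qed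

lemma chain_mass_zero: "chain_mass k \<alpha> (chain_class k (0 :: 'a::euclidean_space osimplex \<Rightarrow>\<^sub>0 int)) = 0"
proof -
  have "chain_mass k \<alpha> (chain_class k (0 :: 'a osimplex \<Rightarrow>\<^sub>0 int)) \<le> frag_mass k \<alpha> (0 :: 'a osimplex \<Rightarrow>\<^sub>0 int)"
    unfolding chain_mass_eq by (rule Inf_lower, rule imageI) (simp add: chain_relations_zero)
  then show ?thesis by (simp add: frag_mass_def)
qed

text \<open>Fillings \<open>Z\<close> and \<open>W\<close> for the two chains add up to a filling
  for the sum, because \<open>boundary\<close> is a homomorphism.\<close>

lemma flat_norm_add:
  assumes c: "is_formal_chain k c" and d: "is_formal_chain k d"
  shows "flat_norm k \<alpha> \<beta> (chain_class k (c + d)) \<le> flat_norm k \<alpha> \<beta> (chain_class k c) + flat_norm k \<alpha> \<beta> (chain_class k d)"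
  unfolding flat_norm_eq[of _ _ _ "chain_class k c"] flat_norm_eq[of _ _ _ "chain_class k d"]
proof (rule le_Inf_add_Inf_ennreal)
  let ?T = "\<lambda>X Z. chain_mass k \<alpha> (chain_diff k X (boundary k Z)) + chain_mass (Suc k) \<beta> Z"
  fix s t
  assume "s \<in> ?T (chain_class k c) ` carrier (chain_group (Suc k))" "t \<in> ?T (chain_class k d) ` carrier (chain_group (Suc k))"
  then obtain Z W where ZW: "Z \<in> carrier (chain_group (Suc k))" "s = ?T (chain_class k c) Z"
    "W \<in> carrier (chain_group (Suc k))" "t = ?T (chain_class k d) W" by blast
  obtain a where a: "is_formal_chain (Suc k) a" "Z = chain_class (Suc k) a"
    using ZW(1) by (rule chain_groupE)
  obtain b where b: "is_formal_chain (Suc k) b" "W = chain_class (Suc k) b"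
    using ZW(3) by (rule chain_groupE)
  obtain e where e: "is_formal_chain k e" "boundary k Z = chain_class k e"
    using boundary_class[OF a(1)] a(2) by blast
  obtain f where f: "is_formal_chain k f" "boundary k W = chain_class k f"
    using boundary_class[OF b(1)] b(2) by blast
  have bd: "boundary k (chain_class (Suc k) (a + b)) = chain_class k (e + f)"
    using hom_mult[OF boundary_hom ZW(1,3)] a b e f by (simp add: mult_chain_group)
  have "flat_norm k \<alpha> \<beta> (chain_class k (c + d)) \<le> ?T (chain_class k (c + d)) (chain_class (Suc k) (a + b))"
    unfolding flat_norm_eq using keys_add_subset[OF a(1) b(1)] by (intro Inf_lower imageI chain_class_in_carrier)
  also have "\<dots> = chain_mass k \<alpha> (chain_class k ((c - e) + (d - f))) + chain_mass (Suc k) \<beta> (chain_class (Suc k) (a + b))"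
    unfolding bd using chain_diff_class[OF keys_add_subset[OF c d] keys_add_subset[OF e(1) f(1)]]
    by (simp add: algebra_simps)
  also have "\<dots> \<le> (chain_mass k \<alpha> (chain_class k (c - e)) + chain_mass k \<alpha> (chain_class k (d - f)))
      + (chain_mass (Suc k) \<beta> (chain_class (Suc k) a) + chain_mass (Suc k) \<beta> (chain_class (Suc k) b))"
    by (intro add_mono chain_mass_add)
  also have "\<dots> = s + t"
    unfolding ZW(2,4) e(2) f(2) chain_diff_class[OF c e(1)] chain_diff_class[OF d f(1)]
    unfolding a(2) b(2) by (simp add: ac_simps)
  finally show "flat_norm k \<alpha> \<beta> (chain_class k (c + d)) \<le> s + t" .
qed

lemma flat_norm_minus_le:
  assumes c: "is_formal_chain k c"
  shows "flat_norm k \<alpha> \<beta> (chain_class k (- c)) \<le> flat_norm k \<alpha> \<beta> (chain_class k c)"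
  unfolding flat_norm_eq[of _ _ _ "chain_class k c"]
proof (rule Inf_greatest)
  let ?T = "\<lambda>X Z. chain_mass k \<alpha> (chain_diff k X (boundary k Z)) + chain_mass (Suc k) \<beta> Z"
  fix s assume "s \<in> ?T (chain_class k c) ` carrier (chain_group (Suc k))"
  then obtain Z where Z: "Z \<in> carrier (chain_group (Suc k))" "s = ?T (chain_class k c) Z" by blast
  obtain a where a: "is_formal_chain (Suc k) a" "Z = chain_class (Suc k) a"
    using Z(1) by (rule chain_groupE)
  obtain e where e: "is_formal_chain k e" "boundary k Z = chain_class k e"
    using boundary_class[OF a(1)] a(2) by blast
  have mn: "is_formal_chain k (- c)" "is_formal_chain k (- e)"
    "is_formal_chain (Suc k) (- a)" using c e(1) a(1) by auto
  have "group_hom (chain_group (Suc k)) (chain_group k) (boundary k)"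
    by (intro group_hom.intro group_hom_axioms.intro group_chain_group boundary_hom)
  then have bd: "boundary k (chain_class (Suc k) (- a)) = chain_class k (- e)"
    using group_hom.hom_inv[of "chain_group (Suc k)" "chain_group k" "boundary k" Z] Z(1) a e
    by (simp add: inv_chain_group)
  have "flat_norm k \<alpha> \<beta> (chain_class k (- c)) \<le> ?T (chain_class k (- c)) (chain_class (Suc k) (- a))"
    unfolding flat_norm_eq using mn by (intro Inf_lower imageI chain_class_in_carrier)
  also have "\<dots> = chain_mass k \<alpha> (chain_class k (- (c - e))) + chain_mass (Suc k) \<beta> (chain_class (Suc k) (- a))"
    unfolding bd chain_diff_class[OF mn(1,2)] by simp
  also have "\<dots> \<le> chain_mass k \<alpha> (chain_class k (c - e)) + chain_mass (Suc k) \<beta> (chain_class (Suc k) a)"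
    by (intro add_mono chain_mass_minus_le)
  also have "\<dots> = s"
    unfolding Z(2) e(2) chain_diff_class[OF c e(1)] unfolding a(2) by simp
  finally show "flat_norm k \<alpha> \<beta> (chain_class k (- c)) \<le> s" .
qed

lemma flat_norm_zero: "flat_norm k \<alpha> \<beta> (chain_class k (0 :: 'a::euclidean_space osimplex \<Rightarrow>\<^sub>0 int)) = 0"
proof -
  have bd: "boundary k (chain_class (Suc k) (0 :: 'a osimplex \<Rightarrow>\<^sub>0 int)) = chain_class k 0"
    using hom_one[OF boundary_hom group_chain_group group_chain_group, of k] by (simp add: one_chain_group)
  have "flat_norm k \<alpha> \<beta> (chain_class k (0 :: 'a osimplex \<Rightarrow>\<^sub>0 int)) \<le> chain_mass k \<alpha> (chain_diff k (chain_class k 0) (boundary k (chain_class (Suc k) (0 :: 'a osimplex \<Rightarrow>\<^sub>0 int))))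
      + chain_mass (Suc k) \<beta> (chain_class (Suc k) (0 :: 'a osimplex \<Rightarrow>\<^sub>0 int))"
    unfolding flat_norm_eq by (rule Inf_lower, rule image_eqI[OF refl carrier_nonempty])
  also have "\<dots> = 0" unfolding bd using chain_diff_class[of "0 :: 'a osimplex \<Rightarrow>\<^sub>0 int" k 0] by (simp add: chain_mass_zero)
  finally show ?thesis by simp
qed

lemma chain_diff_in_carrier:
  assumes "X \<in> carrier (chain_group k)" "Y \<in> carrier (chain_group k)"
  shows "chain_diff k X Y \<in> carrier (chain_group k)"
proof -
  obtain c where c: "is_formal_chain k c" "X = chain_class k c" using assms(1) by (rule chain_groupE)
  obtain d where d: "is_formal_chain k d" "Y = chain_class k d" using assms(2) by (rule chain_groupE)
  show ?thesis using chain_class_in_carrier[OF keys_diff_subset[OF c(1) d(1)]] chain_diff_class[OF c(1) d(1)] c d by simp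
qed

lemma flat_dist_finite:
  "0 < k \<Longrightarrow> X \<in> carrier (chain_group k) \<Longrightarrow> Y \<in> carrier (chain_group k) \<Longrightarrow> flat_dist k \<alpha> \<beta> X Y < \<infinity>"
  unfolding flat_dist_def by (intro flat_norm_finite chain_diff_in_carrier)

lemma flat_dist_self: "X \<in> carrier (chain_group k) \<Longrightarrow> flat_dist k \<alpha> \<beta> X X = 0"
  by (elim chain_groupE) (simp add: flat_dist_def chain_diff_class flat_norm_zero)

lemma flat_dist_commute:
  assumes "X \<in> carrier (chain_group k)" "Y \<in> carrier (chain_group k)"
  shows "flat_dist k \<alpha> \<beta> X Y = flat_dist k \<alpha> \<beta> Y X"
proof -
  obtain c where c: "is_formal_chain k c" "X = chain_class k c" using assms(1) by (rule chain_groupE)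
  obtain d where d: "is_formal_chain k d" "Y = chain_class k d" using assms(2) by (rule chain_groupE)
  show ?thesis
    using flat_norm_minus_le[OF keys_diff_subset[OF c(1) d(1)], of \<alpha> \<beta>] flat_norm_minus_le[OF keys_diff_subset[OF d(1) c(1)], of \<alpha> \<beta>]
    unfolding flat_dist_def c(2) d(2) chain_diff_class[OF c(1) d(1)] chain_diff_class[OF d(1) c(1)] by simp
qed

lemma flat_dist_triangle:
  assumes "X \<in> carrier (chain_group k)" "Y \<in> carrier (chain_group k)" "Z \<in> carrier (chain_group k)"
  shows "flat_dist k \<alpha> \<beta> X Z \<le> flat_dist k \<alpha> \<beta> X Y + flat_dist k \<alpha> \<beta> Y Z"
proof -
  obtain c where c: "is_formal_chain k c" "X = chain_class k c" using assms(1) by (rule chain_groupE)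
  obtain d where d: "is_formal_chain k d" "Y = chain_class k d" using assms(2) by (rule chain_groupE)
  obtain e where e: "is_formal_chain k e" "Z = chain_class k e" using assms(3) by (rule chain_groupE)
  show ?thesis
    using flat_norm_add[OF keys_diff_subset[OF c(1) d(1)] keys_diff_subset[OF d(1) e(1)], of \<alpha> \<beta>]
    unfolding flat_dist_def c(2) d(2) e(2) chain_diff_class[OF c(1) d(1)] chain_diff_class[OF d(1) e(1)] chain_diff_class[OF c(1) e(1)]
    by simp
qed

text \<open>The pointwise form serves two purposes: the triangle inequality for
  \<open>cochain_dist\<close>, and the comparison of the norms of two cochains at a given
  distance.\<close>

lemma cochain_norm_triangle:
  assumes "\<And>X. X \<in> carrier (chain_group k) \<Longrightarrow> \<bar>A X\<bar> \<le> \<bar>B X\<bar> + \<bar>C X\<bar>"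
  shows "cochain_norm k \<alpha> A \<le> cochain_norm k \<alpha> B + cochain_norm k \<alpha> C"
proof (cases "\<alpha> = \<infinity>")
  case True
  show ?thesis
  proof (cases "(\<forall>X\<in>carrier (chain_group k). B X = 0) \<and> (\<forall>X\<in>carrier (chain_group k). C X = 0)")
    case all: True
    then have "\<forall>X\<in>carrier (chain_group k). A X = 0" using assms by fastforce
    then show ?thesis using True by (simp add: cochain_norm_def)
  next
    case False
    then show ?thesis using True by (auto simp: cochain_norm_def)
  qed
next
  case False
  have "ennreal \<bar>A (chain_class k (frag_of \<sigma>))\<bar> / simplex_mass k \<alpha> \<sigma>
      \<le> cochain_norm k \<alpha> B + cochain_norm k \<alpha> C" if \<sigma>: "\<sigma> \<in> small_simplices k" for \<sigma>
  proof -
    let ?X = "chain_class k (frag_of \<sigma>)" and ?m = "simplex_mass k \<alpha> \<sigma>"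
    have "?X \<in> carrier (chain_group k)"
      using \<sigma> small_simplices_subset by (intro chain_class_in_carrier) (auto simp: keys_frag_of)
    then have "ennreal \<bar>A ?X\<bar> \<le> ennreal \<bar>B ?X\<bar> + ennreal \<bar>C ?X\<bar>"
      using assms by (simp add: ennreal_leI flip: ennreal_plus)
    then have "ennreal \<bar>A ?X\<bar> / ?m \<le> (ennreal \<bar>B ?X\<bar> + ennreal \<bar>C ?X\<bar>) / ?m" by (rule divide_right_mono_ennreal)
    also have "\<dots> = ennreal \<bar>B ?X\<bar> / ?m + ennreal \<bar>C ?X\<bar> / ?m"
      by (simp add: divide_ennreal_def distrib_right)
    also have "\<dots> \<le> cochain_norm k \<alpha> B + cochain_norm k \<alpha> C"
      using False \<sigma> by (auto simp: cochain_norm_def intro!: add_mono SUP_upper)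
    finally show ?thesis .
  qed
  then have "(SUP \<sigma>\<in>small_simplices k. ennreal \<bar>A (chain_class k (frag_of \<sigma>))\<bar> / simplex_mass k \<alpha> \<sigma>)
      \<le> cochain_norm k \<alpha> B + cochain_norm k \<alpha> C" by (rule SUP_least)
  then show ?thesis using False unfolding cochain_norm_def[of k \<alpha> A] by simp
qed

lemma cochain_norm2_triangle:
  assumes "\<And>X. X \<in> carrier (chain_group k) \<Longrightarrow> \<bar>A X\<bar> \<le> \<bar>B X\<bar> + \<bar>C X\<bar>"
  shows "cochain_norm2 k \<alpha> \<beta> A \<le> cochain_norm2 k \<alpha> \<beta> B + cochain_norm2 k \<alpha> \<beta> C"
proof -
  have "cochain_norm (Suc k) \<beta> (coboundary k A) \<le> cochain_norm (Suc k) \<beta> (coboundary k B) + cochain_norm (Suc k) \<beta> (coboundary k C)"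
    by (rule cochain_norm_triangle) (auto simp: coboundary_def intro!: assms hom_in_carrier[OF boundary_hom])
  moreover have "cochain_norm k \<alpha> A \<le> cochain_norm k \<alpha> B + cochain_norm k \<alpha> C"
    by (rule cochain_norm_triangle) (rule assms)
  ultimately show ?thesis
    unfolding cochain_norm2_def using add_mono by (fastforce simp: ac_simps)
qed

section \<open>Completion of a pseudometric\<close>

text \<open>The radius at \<open>y\<close> is \<open>e - d x y\<close>, a legitimate subtraction
  since \<open>d x y < e\<close> makes \<open>d x y\<close> finite. The triangle inequality is asked
  only from the fixed centre, which suits both factors of the product.\<close>

lemma openin_dist_topology_ball:
  assumes tri: "\<And>y z. y \<in> M \<Longrightarrow> z \<in> M \<Longrightarrow> d x z \<le> d x y + d y z"
  shows "openin (dist_topology M d) {y \<in> M. d x y < e}"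
  unfolding openin_dist_topology
proof (intro conjI ballI)
  fix y assume "y \<in> {y \<in> M. d x y < e}"
  then have y: "y \<in> M" "d x y < e" by auto
  show "\<exists>e'>0. \<forall>z\<in>M. d y z < e' \<longrightarrow> z \<in> {y \<in> M. d x y < e}"
  proof (intro exI[of _ "e - d x y"] conjI ballI impI)
    show "0 < e - d x y" using y(2) by (simp add: diff_gt_0_iff_gt_ennreal)
    fix z assume z: "z \<in> M" "d y z < e - d x y"
    have "d x z \<le> d x y + d y z" by (rule tri[OF y(1) z(1)])
    also have "\<dots> < e"
    proof -
      have "d x y < \<infinity>" using y(2) by (metis infinity_ennreal_def order_less_le_trans top_greatest)
      then show ?thesis using z(2) by (simp add: less_diff_eq_ennreal add.commute)
    qed
    finally show "z \<in> {y \<in> M. d x y < e}" using z(1) by simp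
  qed
qed auto

lemma topspace_dist_topology [simp]: "topspace (dist_topology M d) = M"
proof -
  have "openin (dist_topology M d) M"
    unfolding openin_dist_topology by (auto intro: exI[of _ 1])
  moreover have "U \<subseteq> M" if "openin (dist_topology M d) U" for U
    using that unfolding openin_dist_topology by blast
  ultimately show ?thesis unfolding topspace_def by blast
qed

text \<open>Finiteness permits the passage to the real distance \<open>rdist\<close>, where
  differences, absolute values and completeness of the reals are at hand.\<close>

locale finite_pseudometric =
  fixes M :: "'b set" and d :: "'b \<Rightarrow> 'b \<Rightarrow> ennreal"
  assumes finite: "\<And>x y. x \<in> M \<Longrightarrow> y \<in> M \<Longrightarrow> d x y < \<infinity>"
    and refl: "\<And>x. x \<in> M \<Longrightarrow> d x x = 0"
    and sym: "\<And>x y. x \<in> M \<Longrightarrow> y \<in> M \<Longrightarrow> d x y = d y x"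
    and triangle: "\<And>x y z. x \<in> M \<Longrightarrow> y \<in> M \<Longrightarrow> z \<in> M \<Longrightarrow> d x z \<le> d x y + d y z"
begin

definition rdist :: "'b \<Rightarrow> 'b \<Rightarrow> real" where
  "rdist x y = enn2real (d x y)"

lemma d_eq_rdist: "x \<in> M \<Longrightarrow> y \<in> M \<Longrightarrow> d x y = ennreal (rdist x y)"
  using finite by (simp add: rdist_def less_top)

lemma rdist_nonneg: "0 \<le> rdist x y"
  by (simp add: rdist_def)

lemma rdist_triangle: "x \<in> M \<Longrightarrow> y \<in> M \<Longrightarrow> z \<in> M \<Longrightarrow> rdist x z \<le> rdist x y + rdist y z"
  using triangle[of x y z] by (simp add: d_eq_rdist rdist_nonneg flip: ennreal_plus)

lemma rdist_sym: "x \<in> M \<Longrightarrow> y \<in> M \<Longrightarrow> rdist x y = rdist y x"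
  using sym by (simp add: rdist_def)

lemma cauchy_seqs_mem: "s \<in> cauchy_seqs M d \<Longrightarrow> s n \<in> M"
  by (auto simp: cauchy_seqs_def)

lemma cauchy_seqs_rdist:
  assumes "s \<in> cauchy_seqs M d" "0 < e"
  obtains N where "\<And>m n. N \<le> m \<Longrightarrow> N \<le> n \<Longrightarrow> rdist (s m) (s n) < e"
proof -
  obtain N where N: "\<forall>m\<ge>N. \<forall>n\<ge>N. d (s m) (s n) < ennreal e"
    using assms unfolding cauchy_seqs_def by (auto dest!: spec[of _ "ennreal e"])
  have "rdist (s m) (s n) < e" if "N \<le> m" "N \<le> n" for m n
  proof -
    have "d (s m) (s n) < ennreal e" using N that by blast
    then show ?thesis
      using d_eq_rdist[OF cauchy_seqs_mem[OF assms(1)] cauchy_seqs_mem[OF assms(1)], of m n]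
      by (simp add: ennreal_less_iff rdist_nonneg)
  qed
  then show thesis using that by blast
qed

text \<open>Quadrilateral inequality: the distances at two indices differ by at most the distance
  between the two terms of \<open>s\<close> plus that between the two terms of
  \<open>t\<close>.\<close>

lemma convergent_rdist:
  assumes s: "s \<in> cauchy_seqs M d" and t: "t \<in> cauchy_seqs M d"
  shows "convergent (\<lambda>n. rdist (s n) (t n))"
proof (rule Cauchy_convergent, rule metric_CauchyI)
  fix e :: real assume "0 < e"
  then have "0 < e / 2" by simp
  obtain N1 where N1: "\<And>m n. N1 \<le> m \<Longrightarrow> N1 \<le> n \<Longrightarrow> rdist (s m) (s n) < e / 2"
    using cauchy_seqs_rdist[OF s \<open>0 < e / 2\<close>] by blast
  obtain N2 where N2: "\<And>m n. N2 \<le> m \<Longrightarrow> N2 \<le> n \<Longrightarrow> rdist (t m) (t n) < e / 2"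
    using cauchy_seqs_rdist[OF t \<open>0 < e / 2\<close>] by blast
  note S = cauchy_seqs_mem[OF s] and T = cauchy_seqs_mem[OF t]
  have "dist (rdist (s m) (t m)) (rdist (s n) (t n)) < e" if "max N1 N2 \<le> m" "max N1 N2 \<le> n" for m n
  proof -
    have "rdist (s m) (s n) < e / 2" "rdist (t m) (t n) < e / 2" using N1 N2 that by auto
    moreover have "rdist (s m) (t m) \<le> rdist (s m) (s n) + rdist (s n) (t m)" "rdist (s n) (t m) \<le> rdist (s n) (t n) + rdist (t n) (t m)"
      "rdist (s n) (t n) \<le> rdist (s n) (s m) + rdist (s m) (t n)" "rdist (s m) (t n) \<le> rdist (s m) (t m) + rdist (t m) (t n)"
      using S T by (intro rdist_triangle; simp)+
    moreover have "rdist (t n) (t m) = rdist (t m) (t n)" "rdist (s n) (s m) = rdist (s m) (s n)"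
      using S T by (intro rdist_sym; simp)+
    ultimately show ?thesis by (simp add: dist_real_def abs_less_iff)
  qed
  then show "\<exists>N. \<forall>m\<ge>N. \<forall>n\<ge>N. dist (rdist (s m) (t m)) (rdist (s n) (t n)) < e" by blast
qed

lemma cauchy_rel_rdist:
  assumes "(s, t) \<in> cauchy_rel M d"
  shows "(\<lambda>n. rdist (s n) (t n)) \<longlonglongrightarrow> 0"
proof -
  have "(\<lambda>n. d (s n) (t n)) \<longlonglongrightarrow> 0" "s \<in> cauchy_seqs M d" "t \<in> cauchy_seqs M d"
    using assms by (auto simp: cauchy_rel_def)
  then have "(\<lambda>n. ennreal (rdist (s n) (t n))) \<longlonglongrightarrow> ennreal 0"
    using d_eq_rdist cauchy_seqs_mem by simp
  then show ?thesis by (subst (asm) tendsto_ennreal_iff) (auto simp: rdist_nonneg)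
qed

lemma cauchy_relI:
  assumes "s \<in> cauchy_seqs M d" "t \<in> cauchy_seqs M d" "(\<lambda>n. rdist (s n) (t n)) \<longlonglongrightarrow> 0"
  shows "(s, t) \<in> cauchy_rel M d"
proof -
  have "(\<lambda>n. ennreal (rdist (s n) (t n))) \<longlonglongrightarrow> ennreal 0" using assms(3) by (rule tendsto_ennrealI)
  then show ?thesis using assms(1,2) d_eq_rdist cauchy_seqs_mem by (simp add: cauchy_rel_def)
qed

lemma equiv_cauchy_rel: "equiv (cauchy_seqs M d) (cauchy_rel M d)"
proof (rule equivI)
  show "cauchy_rel M d \<subseteq> cauchy_seqs M d \<times> cauchy_seqs M d" by (auto simp: cauchy_rel_def)
  show "refl_on (cauchy_seqs M d) (cauchy_rel M d)"
    using refl cauchy_seqs_mem by (auto simp: refl_on_def cauchy_rel_def)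
  show "sym (cauchy_rel M d)"
  proof (rule symI)
    fix s t assume "(s, t) \<in> cauchy_rel M d"
    then have "s \<in> cauchy_seqs M d" "t \<in> cauchy_seqs M d" "(\<lambda>n. d (s n) (t n)) \<longlonglongrightarrow> 0"
      by (auto simp: cauchy_rel_def)
    moreover have "d (t n) (s n) = d (s n) (t n)" for n
      using calculation cauchy_seqs_mem by (intro sym)
    ultimately show "(t, s) \<in> cauchy_rel M d" by (simp add: cauchy_rel_def)
  qed
  show "trans (cauchy_rel M d)"
  proof (rule transI)
    fix s t u assume st: "(s, t) \<in> cauchy_rel M d" and tu: "(t, u) \<in> cauchy_rel M d"
    have C: "s \<in> cauchy_seqs M d" "t \<in> cauchy_seqs M d" "u \<in> cauchy_seqs M d"
      using st tu by (auto simp: cauchy_rel_def)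
    have "(\<lambda>n. rdist (s n) (u n)) \<longlonglongrightarrow> 0"
    proof (rule tendsto_sandwich[OF _ _ tendsto_const])
      show "(\<lambda>n. rdist (s n) (t n) + rdist (t n) (u n)) \<longlonglongrightarrow> 0"
        using tendsto_add[OF cauchy_rel_rdist[OF st] cauchy_rel_rdist[OF tu]] by simp
    qed (use C cauchy_seqs_mem in \<open>auto simp: rdist_nonneg intro!: always_eventually rdist_triangle\<close>)
    then show "(s, u) \<in> cauchy_rel M d" using C by (intro cauchy_relI)
  qed
qed

lemma completion_mem:
  assumes "P \<in> completion M d" "s \<in> P"
  shows "s \<in> cauchy_seqs M d"
  using assms equiv_cauchy_rel unfolding completion_def by (metis in_quotient_imp_subset subsetD)

lemma completion_nonempty: "P \<in> completion M d \<Longrightarrow> \<exists>s. s \<in> P"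
  using equiv_cauchy_rel unfolding completion_def by (metis in_quotient_imp_non_empty ex_in_conv)

lemma completion_rel:
  assumes "P \<in> completion M d" "s \<in> P" "t \<in> P"
  shows "(s, t) \<in> cauchy_rel M d"
  using assms equiv_cauchy_rel unfolding completion_def by (metis in_quotient_imp_in_rel insert_subset empty_subsetI)

text \<open>This gives meaning to the definite description in \<open>completion_dist\<close>: the
  limit exists for one pair of representatives, and other representatives alter the distances by a
  null sequence.\<close>

lemma completion_dist_tendsto:
  assumes P: "P \<in> completion M d" and Q: "Q \<in> completion M d" and s: "s \<in> P" and t: "t \<in> Q"
  shows "(\<lambda>n. d (s n) (t n)) \<longlonglongrightarrow> completion_dist d P Q"
proof -
  note C = completion_mem[OF P] completion_mem[OF Q]
  obtain l where l: "(\<lambda>n. rdist (s n) (t n)) \<longlonglongrightarrow> l"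
    using convergent_rdist[OF C(1)[OF s] C(2)[OF t]] by (auto simp: convergent_def)
  have all: "(\<lambda>n. d (s' n) (t' n)) \<longlonglongrightarrow> ennreal l" if s': "s' \<in> P" and t': "t' \<in> Q" for s' t'
  proof -
    have mem: "s n \<in> M" "t n \<in> M" "s' n \<in> M" "t' n \<in> M" for n
      using cauchy_seqs_mem C s t s' t' by blast+
    have "(\<lambda>n. rdist (s' n) (t' n) - rdist (s n) (t n)) \<longlonglongrightarrow> 0"
    proof (rule Lim_null_comparison)
      show "(\<lambda>n. rdist (s n) (s' n) + rdist (t n) (t' n)) \<longlonglongrightarrow> 0"
        using tendsto_add[OF cauchy_rel_rdist[OF completion_rel[OF P s s']] cauchy_rel_rdist[OF completion_rel[OF Q t t']]] by simp
      have "norm (rdist (s' n) (t' n) - rdist (s n) (t n)) \<le> rdist (s n) (s' n) + rdist (t n) (t' n)" for n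
      proof -
        have "rdist (s' n) (t' n) \<le> rdist (s' n) (s n) + rdist (s n) (t' n)" "rdist (s n) (t' n) \<le> rdist (s n) (t n) + rdist (t n) (t' n)"
          "rdist (s n) (t n) \<le> rdist (s n) (s' n) + rdist (s' n) (t n)" "rdist (s' n) (t n) \<le> rdist (s' n) (t' n) + rdist (t' n) (t n)"
          using mem by (intro rdist_triangle; simp)+
        moreover have "rdist (s' n) (s n) = rdist (s n) (s' n)" "rdist (t' n) (t n) = rdist (t n) (t' n)"
          using mem by (intro rdist_sym; simp)+
        ultimately show ?thesis by (simp add: abs_le_iff)
      qed
      then show "eventually (\<lambda>n. norm (rdist (s' n) (t' n) - rdist (s n) (t n)) \<le> rdist (s n) (s' n) + rdist (t n) (t' n)) sequentially"
        by (rule always_eventually[OF allI])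
    qed
    from tendsto_add[OF this l] have "(\<lambda>n. rdist (s' n) (t' n)) \<longlonglongrightarrow> l" by simp
    then have "(\<lambda>n. ennreal (rdist (s' n) (t' n))) \<longlonglongrightarrow> ennreal l" by (rule tendsto_ennrealI)
    then show ?thesis using mem by (simp add: d_eq_rdist)
  qed
  have "completion_dist d P Q = ennreal l"
    unfolding completion_dist_def
  proof (rule the_equality)
    show "\<forall>s\<in>P. \<forall>t\<in>Q. (\<lambda>n. d (s n) (t n)) \<longlonglongrightarrow> ennreal l" using all by blast
    fix l' assume "\<forall>s\<in>P. \<forall>t\<in>Q. (\<lambda>n. d (s n) (t n)) \<longlonglongrightarrow> l'"
    then show "l' = ennreal l" using all[OF s t] s t LIMSEQ_unique by blast
  qed
  then show ?thesis using all[OF s t] by simp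
qed

lemma completion_dist_self:
  assumes "P \<in> completion M d"
  shows "completion_dist d P P = 0"
proof -
  obtain s where s: "s \<in> P" using completion_nonempty[OF assms] by blast
  have "(\<lambda>n. d (s n) (s n)) \<longlonglongrightarrow> completion_dist d P P"
    by (rule completion_dist_tendsto[OF assms assms s s])
  moreover have "d (s n) (s n) = 0" for n using refl cauchy_seqs_mem[OF completion_mem[OF assms s]] by simp
  ultimately have "(\<lambda>n. 0 :: ennreal) \<longlonglongrightarrow> completion_dist d P P" by simp
  then show ?thesis using LIMSEQ_unique tendsto_const by metis
qed

lemma completion_dist_triangle:
  assumes "P \<in> completion M d" "Q \<in> completion M d" "R \<in> completion M d"
  shows "completion_dist d P R \<le> completion_dist d P Q + completion_dist d Q R"
proof -
  obtain s t u where st: "s \<in> P" "t \<in> Q" "u \<in> R" using assms completion_nonempty by metis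
  have mem: "s n \<in> M" "t n \<in> M" "u n \<in> M" for n
    using cauchy_seqs_mem[OF completion_mem[OF assms(1) st(1)]] cauchy_seqs_mem[OF completion_mem[OF assms(2) st(2)]]
      cauchy_seqs_mem[OF completion_mem[OF assms(3) st(3)]] by auto
  show ?thesis
  proof (rule tendsto_le[OF sequentially_bot])
    show "(\<lambda>n. d (s n) (t n) + d (t n) (u n)) \<longlonglongrightarrow> completion_dist d P Q + completion_dist d Q R"
      by (intro tendsto_add completion_dist_tendsto assms st)
    show "(\<lambda>n. d (s n) (u n)) \<longlonglongrightarrow> completion_dist d P R"
      by (rule completion_dist_tendsto[OF assms(1,3) st(1,3)])
    show "\<forall>\<^sub>F n in sequentially. d (s n) (u n) \<le> d (s n) (t n) + d (t n) (u n)"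
      by (rule always_eventually, rule allI, rule triangle[OF mem])
  qed
qed

lemma completion_embed_mem:
  assumes "x \<in> M"
  shows "completion_embed M d x \<in> completion M d" "(\<lambda>_. x) \<in> completion_embed M d x"
proof -
  have c: "(\<lambda>_. x) \<in> cauchy_seqs M d" using assms refl by (auto simp: cauchy_seqs_def)
  then show "completion_embed M d x \<in> completion M d"
    unfolding completion_embed_def completion_def by (rule quotientI)
  show "(\<lambda>_. x) \<in> completion_embed M d x"
    unfolding completion_embed_def using equiv_class_self[OF equiv_cauchy_rel c] .
qed

end

section \<open>The extended pairing\<close>

lemma finite_pseudometric_flat_dist:
  "0 < k \<Longrightarrow> finite_pseudometric (carrier (chain_group k)) (flat_dist k \<alpha> \<beta>)"
  by unfold_locales (auto intro: flat_dist_finite[unfolded infinity_ennreal_def] flat_dist_self flat_dist_commute flat_dist_triangle)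

lemma bounded_cochainsD:
  assumes "A \<in> bounded_cochains k \<alpha> \<beta>"
  shows "additive_on k A" "cochain_norm2 k \<alpha> \<beta> A < \<infinity>"
  using assms by (auto simp: bounded_cochains_def cochains_def additive_on_def)

lemma additive_on_chain_diff:
  assumes "additive_on k A" "X \<in> carrier (chain_group k)" "Y \<in> carrier (chain_group k)"
  shows "A (chain_diff k X Y) = A X - A Y"
proof -
  obtain c where c: "is_formal_chain k c" "X = chain_class k c" using assms(2) by (rule chain_groupE)
  obtain d where d: "is_formal_chain k d" "Y = chain_class k d" using assms(3) by (rule chain_groupE)
  show ?thesis using additive_on_diff[OF assms(1) c(1) d(1)] chain_diff_class[OF c(1) d(1)] c(2) d(2) by simp
qed

lemma pairing_dist_bound:
  assumes "0 < k" "A \<in> bounded_cochains k \<alpha> \<beta>" "X \<in> carrier (chain_group k)" "Y \<in> carrier (chain_group k)"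
  shows "ennreal \<bar>A X - A Y\<bar> \<le> cochain_norm2 k \<alpha> \<beta> A * flat_dist k \<alpha> \<beta> X Y"
  using pairing_bound[OF assms(1) bounded_cochainsD[OF assms(2)] chain_diff_in_carrier[OF assms(3,4)]]
    additive_on_chain_diff[OF bounded_cochainsD(1)[OF assms(2)] assms(3,4)]
  by (simp add: flat_dist_def)

lemma flat_norm_le_dist_add:
  assumes "X \<in> carrier (chain_group k)" "Y \<in> carrier (chain_group k)"
  shows "flat_norm k \<alpha> \<beta> X \<le> flat_dist k \<alpha> \<beta> X Y + flat_norm k \<alpha> \<beta> Y"
proof -
  obtain c where c: "is_formal_chain k c" "X = chain_class k c" using assms(1) by (rule chain_groupE)
  obtain d where d: "is_formal_chain k d" "Y = chain_class k d" using assms(2) by (rule chain_groupE)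
  show ?thesis
    using flat_norm_add[OF keys_diff_subset[OF c(1) d(1)] d(1), of \<alpha> \<beta>]
    unfolding flat_dist_def c(2) d(2) chain_diff_class[OF c(1) d(1)] by simp
qed

text \<open>The limit is taken along one chosen Cauchy sequence of the class;
  \<open>pairing_tendsto\<close> shows that every other sequence in the class has the same
  limit.\<close>

definition extended_pairing :: "(nat \<Rightarrow> 'a::euclidean_space chain) set \<Rightarrow> 'a cochain \<Rightarrow> real" where
  "extended_pairing P A = lim (\<lambda>n. A ((SOME s. s \<in> P) n))"

abbreviation flat_completion :: "nat \<Rightarrow> ereal \<Rightarrow> ereal \<Rightarrow> (nat \<Rightarrow> 'a::euclidean_space chain) set set" where
  "flat_completion k \<alpha> \<beta> \<equiv> completion (carrier (chain_group k)) (flat_dist k \<alpha> \<beta>)"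

context
  fixes k :: nat and \<alpha> \<beta> :: ereal
  assumes k: "0 < k"
begin

interpretation F: finite_pseudometric "carrier (chain_group k) :: 'a::euclidean_space chain set" "flat_dist k \<alpha> \<beta>"
  by (rule finite_pseudometric_flat_dist[OF k])

lemma pairing_rdist_bound:
  fixes A :: "'a::euclidean_space cochain"
  assumes "A \<in> bounded_cochains k \<alpha> \<beta>" "X \<in> carrier (chain_group k)" "Y \<in> carrier (chain_group k)"
  shows "\<bar>A X - A Y\<bar> \<le> enn2real (cochain_norm2 k \<alpha> \<beta> A) * F.rdist X Y"
proof -
  have "cochain_norm2 k \<alpha> \<beta> A = ennreal (enn2real (cochain_norm2 k \<alpha> \<beta> A))"
    using bounded_cochainsD(2)[OF assms(1)] by (simp add: less_top)
  then have "ennreal \<bar>A X - A Y\<bar> \<le> ennreal (enn2real (cochain_norm2 k \<alpha> \<beta> A) * F.rdist X Y)"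
    using pairing_dist_bound[OF k assms] F.d_eq_rdist[OF assms(2,3)] F.rdist_nonneg[of X Y]
    by (metis ennreal_mult enn2real_nonneg)
  then show ?thesis by (subst (asm) ennreal_le_iff) (auto intro: mult_nonneg_nonneg F.rdist_nonneg)
qed

text \<open>A bounded cochain is Lipschitz for the flat distance, so it maps Cauchy sequences to
  Cauchy sequences and equivalent ones to sequences with equal limits.\<close>

lemma pairing_tendsto:
  fixes A :: "'a::euclidean_space cochain"
  assumes A: "A \<in> bounded_cochains k \<alpha> \<beta>" and P: "P \<in> flat_completion k \<alpha> \<beta>" and s: "s \<in> P"
  shows "(\<lambda>n. A (s n)) \<longlonglongrightarrow> extended_pairing P A"
proof -
  define a where "a = enn2real (cochain_norm2 k \<alpha> \<beta> A)"
  have a: "0 \<le> a" by (simp add: a_def)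
  have conv: "convergent (\<lambda>n. A (t n))" if t: "t \<in> P" for t
  proof (rule Cauchy_convergent, rule metric_CauchyI)
    fix e :: real assume e: "0 < e"
    have C: "t \<in> cauchy_seqs (carrier (chain_group k)) (flat_dist k \<alpha> \<beta>)" by (rule F.completion_mem[OF P t])
    have "0 < e / (a + 1)" using e a by simp
    then obtain N where N: "\<And>m n. N \<le> m \<Longrightarrow> N \<le> n \<Longrightarrow> F.rdist (t m) (t n) < e / (a + 1)"
      using F.cauchy_seqs_rdist[OF C] by blast
    have "dist (A (t m)) (A (t n)) < e" if mn: "N \<le> m" "N \<le> n" for m n
    proof -
      have "\<bar>A (t m) - A (t n)\<bar> \<le> a * F.rdist (t m) (t n)"
        unfolding a_def by (rule pairing_rdist_bound[OF A F.cauchy_seqs_mem[OF C] F.cauchy_seqs_mem[OF C]])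
      also have "\<dots> \<le> (a + 1) * F.rdist (t m) (t n)" using F.rdist_nonneg by (intro mult_right_mono) auto
      also have "\<dots> < e" using N[OF mn] a by (simp add: field_simps)
      finally show ?thesis by (simp add: dist_real_def)
    qed
    then show "\<exists>N. \<forall>m\<ge>N. \<forall>n\<ge>N. dist (A (t m)) (A (t n)) < e" by blast
  qed
  define t where "t = (SOME s. s \<in> P)"
  have t: "t \<in> P" unfolding t_def by (rule someI[of "\<lambda>s. s \<in> P", OF s])
  have lim: "(\<lambda>n. A (t n)) \<longlonglongrightarrow> extended_pairing P A"
    unfolding extended_pairing_def t_def[symmetric] using conv[OF t] by (simp add: convergent_LIMSEQ_iff)
  have "(\<lambda>n. A (s n) - A (t n)) \<longlonglongrightarrow> 0"
  proof (rule Lim_null_comparison)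
    show "(\<lambda>n. a * F.rdist (s n) (t n)) \<longlonglongrightarrow> 0"
      using tendsto_mult_left[OF F.cauchy_rel_rdist[OF F.completion_rel[OF P s t]], of a] by simp
    have "norm (A (s n) - A (t n)) \<le> a * F.rdist (s n) (t n)" for n
      unfolding a_def real_norm_def
      by (rule pairing_rdist_bound[OF A F.cauchy_seqs_mem[OF F.completion_mem[OF P s]] F.cauchy_seqs_mem[OF F.completion_mem[OF P t]]])
    then show "\<forall>\<^sub>F n in sequentially. norm (A (s n) - A (t n)) \<le> a * F.rdist (s n) (t n)"
      by (rule always_eventually[OF allI])
  qed
  from tendsto_add[OF this lim] show ?thesis by simp
qed

lemma extended_pairing_chain_bound:
  fixes A :: "'a::euclidean_space cochain"
  assumes A: "A \<in> bounded_cochains k \<alpha> \<beta>" and P: "P \<in> flat_completion k \<alpha> \<beta>" and Q: "Q \<in> flat_completion k \<alpha> \<beta>"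
  shows "ennreal \<bar>extended_pairing P A - extended_pairing Q A\<bar>
    \<le> cochain_norm2 k \<alpha> \<beta> A * completion_dist (flat_dist k \<alpha> \<beta>) P Q"
proof -
  obtain s t where st: "s \<in> P" "t \<in> Q" using F.completion_nonempty P Q by metis
  have "(\<lambda>n. \<bar>A (s n) - A (t n)\<bar>) \<longlonglongrightarrow> \<bar>extended_pairing P A - extended_pairing Q A\<bar>"
    by (intro tendsto_intros pairing_tendsto A P Q st)
  then have 1: "(\<lambda>n. ennreal \<bar>A (s n) - A (t n)\<bar>) \<longlonglongrightarrow> ennreal \<bar>extended_pairing P A - extended_pairing Q A\<bar>"
    by (rule tendsto_ennrealI)
  have 2: "(\<lambda>n. cochain_norm2 k \<alpha> \<beta> A * flat_dist k \<alpha> \<beta> (s n) (t n))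
      \<longlonglongrightarrow> cochain_norm2 k \<alpha> \<beta> A * completion_dist (flat_dist k \<alpha> \<beta>) P Q"
    using bounded_cochainsD(2)[OF A] F.completion_dist_tendsto[OF P Q st]
    by (intro ennreal_tendsto_cmult) simp_all
  show ?thesis
    by (rule tendsto_le[OF sequentially_bot 2 1], rule always_eventually, rule allI,
        rule pairing_dist_bound[OF k A F.cauchy_seqs_mem[OF F.completion_mem[OF P st(1)]]
          F.cauchy_seqs_mem[OF F.completion_mem[OF Q st(2)]]])
qed

lemma cochain_dist_triangle:
  "cochain_dist k \<alpha> \<beta> A C \<le> cochain_dist k \<alpha> \<beta> A B + cochain_dist k \<alpha> \<beta> B C"
  unfolding cochain_dist_def by (rule cochain_norm2_triangle) simp

lemma cochain_norm2_le_dist_add: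
  "cochain_norm2 k \<alpha> \<beta> B \<le> cochain_norm2 k \<alpha> \<beta> A + cochain_dist k \<alpha> \<beta> A B"
  unfolding cochain_dist_def by (rule cochain_norm2_triangle) simp

text \<open>Flat norms are eventually bounded along a Cauchy sequence representing \<open>P\<close>.
  With this bound as constant, \<open>pairing_bound\<close> for the difference of \<open>A\<close>
  and \<open>B\<close> passes to the limit.\<close>

lemma extended_pairing_cochain_bound:
  fixes P :: "(nat \<Rightarrow> 'a::euclidean_space chain) set"
  assumes P: "P \<in> flat_completion k \<alpha> \<beta>"
  obtains c where "0 \<le> c"
    "\<And>A B. A \<in> bounded_cochains k \<alpha> \<beta> \<Longrightarrow> B \<in> bounded_cochains k \<alpha> \<beta> \<Longrightarrow> cochain_dist k \<alpha> \<beta> A B < \<infinity> \<Longrightarrow>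
      ennreal \<bar>extended_pairing P A - extended_pairing P B\<bar> \<le> cochain_dist k \<alpha> \<beta> A B * ennreal c"
proof -
  obtain s where s: "s \<in> P" using F.completion_nonempty[OF P] by blast
  have C: "s \<in> cauchy_seqs (carrier (chain_group k)) (flat_dist k \<alpha> \<beta>)" by (rule F.completion_mem[OF P s])
  note sG = F.cauchy_seqs_mem[OF C]
  obtain N where N: "\<And>m n. N \<le> m \<Longrightarrow> N \<le> n \<Longrightarrow> F.rdist (s m) (s n) < 1"
    using F.cauchy_seqs_rdist[OF C, of 1] by auto
  \<comment> \<open>From \<open>N\<close> on, the sequence stays within flat distance 1 of
    \<open>s N\<close>.\<close>
  define c where "c = 1 + enn2real (flat_norm k \<alpha> \<beta> (s N))"
  have c: "0 \<le> c" by (simp add: c_def)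
  have bound: "flat_norm k \<alpha> \<beta> (s n) \<le> ennreal c" if n: "N \<le> n" for n
  proof -
    have "flat_norm k \<alpha> \<beta> (s n) \<le> flat_dist k \<alpha> \<beta> (s n) (s N) + flat_norm k \<alpha> \<beta> (s N)"
      by (rule flat_norm_le_dist_add[OF sG sG])
    also have "\<dots> \<le> ennreal 1 + ennreal (enn2real (flat_norm k \<alpha> \<beta> (s N)))"
    proof (rule add_mono)
      show "flat_dist k \<alpha> \<beta> (s n) (s N) \<le> ennreal 1"
        unfolding F.d_eq_rdist[OF sG sG] using N[OF n order_refl] by (intro ennreal_leI) simp
      show "flat_norm k \<alpha> \<beta> (s N) \<le> ennreal (enn2real (flat_norm k \<alpha> \<beta> (s N)))"
        using flat_norm_finite[OF k sG, of \<alpha> \<beta> N] by (simp add: less_top)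
    qed
    also have "\<dots> = ennreal c" unfolding c_def by (rule ennreal_plus[symmetric]) auto
    finally show ?thesis .
  qed
  show thesis
  proof (rule that[OF c])
    fix A B :: "'a cochain"
    assume A: "A \<in> bounded_cochains k \<alpha> \<beta>" and B: "B \<in> bounded_cochains k \<alpha> \<beta>"
      and fin: "cochain_dist k \<alpha> \<beta> A B < \<infinity>"
    let ?D = "\<lambda>X\<in>carrier (chain_group k). A X - B X"
    have D: "additive_on k ?D"
      unfolding additive_on_def
    proof (intro ballI)
      fix X Y :: "'a chain" assume XY: "X \<in> carrier (chain_group k)" "Y \<in> carrier (chain_group k)"
      then have "X \<otimes>\<^bsub>chain_group k\<^esub> Y \<in> carrier (chain_group k)"
        using group.is_monoid[OF group_chain_group] by (intro monoid.m_closed)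
      then show "?D (X \<otimes>\<^bsub>chain_group k\<^esub> Y) = ?D X + ?D Y"
        using XY bounded_cochainsD(1)[OF A] bounded_cochainsD(1)[OF B] by (simp add: additive_on_def)
    qed
    have "(\<lambda>n. \<bar>A (s n) - B (s n)\<bar>) \<longlonglongrightarrow> \<bar>extended_pairing P A - extended_pairing P B\<bar>"
      by (intro tendsto_intros pairing_tendsto A B P s)
    then have "(\<lambda>n. ennreal \<bar>A (s n) - B (s n)\<bar>) \<longlonglongrightarrow> ennreal \<bar>extended_pairing P A - extended_pairing P B\<bar>"
      by (rule tendsto_ennrealI)
    then show "ennreal \<bar>extended_pairing P A - extended_pairing P B\<bar> \<le> cochain_dist k \<alpha> \<beta> A B * ennreal c"
    proof (rule LIMSEQ_le_const2)
      have "ennreal \<bar>A (s n) - B (s n)\<bar> \<le> cochain_dist k \<alpha> \<beta> A B * ennreal c" if n: "N \<le> n" for n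
      proof -
        have "ennreal \<bar>?D (s n)\<bar> \<le> cochain_norm2 k \<alpha> \<beta> ?D * flat_norm k \<alpha> \<beta> (s n)"
          by (rule pairing_bound[OF k D _ sG]) (use fin in \<open>simp add: cochain_dist_def\<close>)
        also have "\<dots> \<le> cochain_norm2 k \<alpha> \<beta> ?D * ennreal c" by (intro mult_left_mono bound n) simp
        finally show ?thesis using sG by (simp add: cochain_dist_def)
      qed
      then show "\<exists>N. \<forall>n\<ge>N. ennreal \<bar>A (s n) - B (s n)\<bar> \<le> cochain_dist k \<alpha> \<beta> A B * ennreal c" by blast
    qed
  qed
qed

lemma cochain_dist_self: "cochain_dist k \<alpha> \<beta> A A = 0"
proof -
  have zero: "cochain_norm n \<gamma> B = 0" if B: "\<And>X. X \<in> carrier (chain_group n) \<Longrightarrow> B X = 0"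
    for n \<gamma> and B :: "'a::euclidean_space cochain"
  proof -
    have "B (chain_class n (frag_of \<sigma>)) = 0" if "\<sigma> \<in> small_simplices n" for \<sigma>
      by (rule B, rule chain_class_in_carrier) (use that small_simplices_subset in \<open>auto simp: keys_frag_of\<close>)
    then have "(SUP \<sigma>\<in>small_simplices n. ennreal \<bar>B (chain_class n (frag_of \<sigma>))\<bar> / simplex_mass n \<gamma> \<sigma>) \<le> 0"
      by (intro SUP_least) simp
    then show ?thesis using B by (simp add: cochain_norm_def)
  qed
  show ?thesis
    unfolding cochain_dist_def cochain_norm2_def
    by (simp add: zero coboundary_def hom_in_carrier[OF boundary_hom])
qed

text \<open>The difference is split at the pair \<open>(P, B)\<close>. One part is at most
  \<open>c\<close> times the distance of \<open>A\<close> and \<open>B\<close>, the other at most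
  the norm of \<open>B\<close> times the distance of \<open>P\<close> and \<open>Q\<close>; near
  \<open>A\<close> that norm is at most \<open>a + 1\<close>.\<close>

lemma continuous_extended_pairing:
  "continuous_map (prod_topology (flat_completion_topology k \<alpha> \<beta>) (cochain_topology k \<alpha> \<beta>))
    euclideanreal (\<lambda>(P :: (nat \<Rightarrow> 'a::euclidean_space chain) set, A). extended_pairing P A)"
  unfolding continuous_map_def
proof (intro conjI allI impI)
  let ?X = "flat_completion_topology k \<alpha> \<beta> :: (nat \<Rightarrow> 'a chain) set topology"
    and ?Y = "cochain_topology k \<alpha> \<beta> :: 'a cochain topology"
  let ?d = "flat_dist k \<alpha> \<beta> :: 'a chain \<Rightarrow> 'a chain \<Rightarrow> ennreal"
  fix U :: "real set" assume "openin euclideanreal U"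
  then have U: "open U" by simp
  show "openin (prod_topology ?X ?Y) {x \<in> topspace (prod_topology ?X ?Y). (case x of (P, A) \<Rightarrow> extended_pairing P A) \<in> U}"
    unfolding openin_prod_topology_alt
  proof (intro allI impI)
    fix P :: "(nat \<Rightarrow> 'a chain) set" and A :: "'a cochain"
    assume "(P, A) \<in> {x \<in> topspace (prod_topology ?X ?Y). (case x of (P, A) \<Rightarrow> extended_pairing P A) \<in> U}"
    then have P: "P \<in> flat_completion k \<alpha> \<beta>" and A: "A \<in> bounded_cochains k \<alpha> \<beta>" and PA: "extended_pairing P A \<in> U"
      by (auto simp: flat_completion_topology_def cochain_topology_def)
    obtain e where e: "0 < e" "ball (extended_pairing P A) e \<subseteq> U"
      using U PA by (meson open_contains_ball)
    obtain c where c: "0 \<le> c" "\<And>A B. A \<in> bounded_cochains k \<alpha> \<beta> \<Longrightarrow> B \<in> bounded_cochains k \<alpha> \<beta> \<Longrightarrow> cochain_dist k \<alpha> \<beta> A B < \<infinity> \<Longrightarrow>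
      ennreal \<bar>extended_pairing P A - extended_pairing P B\<bar> \<le> cochain_dist k \<alpha> \<beta> A B * ennreal c"
      using extended_pairing_cochain_bound[OF P] by blast
    define a where "a = enn2real (cochain_norm2 k \<alpha> \<beta> A)"
    have a: "0 \<le> a" "cochain_norm2 k \<alpha> \<beta> A = ennreal a"
      using bounded_cochainsD(2)[OF A] by (simp_all add: a_def less_top)
    \<comment> \<open>Each part of the error receives \<open>e / 2\<close>. In
      \<open>\<delta>2\<close> the minimum with 1 secures the norm bound \<open>a + 1\<close>, and
      the divisor \<open>c + 1\<close> covers \<open>c = 0\<close> and makes its part strictly
      smaller.\<close>
    define \<delta>1 where "\<delta>1 = (e / 2) / (a + 1)"
    define \<delta>2 where "\<delta>2 = min 1 ((e / 2) / (c + 1))"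
    have \<delta>: "0 < \<delta>1" "0 < \<delta>2" "\<delta>2 \<le> 1" using e(1) a(1) c(1) by (simp_all add: \<delta>1_def \<delta>2_def)
    have "(a + 1) * (r / (a + 1)) = r" for r using a(1) by simp
    then have small1: "(a + 1) * \<delta>1 = e / 2" unfolding \<delta>1_def .
    have small2: "\<delta>2 * c < e / 2"
    proof -
      have cancel: "(r / (c + 1)) * (c + 1) = r" for r using c(1) by simp
      have "\<delta>2 * c \<le> ((e / 2) / (c + 1)) * c" using c(1) by (intro mult_right_mono) (simp_all add: \<delta>2_def)
      also have "\<dots> < ((e / 2) / (c + 1)) * (c + 1)" using e(1) c(1) by (intro mult_strict_left_mono) simp_all
      also have "\<dots> = e / 2" by (rule cancel)
      finally show ?thesis .
    qed
    let ?V = "{Q \<in> flat_completion k \<alpha> \<beta>. completion_dist ?d P Q < ennreal \<delta>1}"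
    let ?W = "{B \<in> bounded_cochains k \<alpha> \<beta>. cochain_dist k \<alpha> \<beta> A B < ennreal \<delta>2}"
    have V: "openin ?X ?V"
      unfolding flat_completion_topology_def
      by (rule openin_dist_topology_ball) (rule F.completion_dist_triangle[OF P])
    have W: "openin ?Y ?W"
      unfolding cochain_topology_def by (rule openin_dist_topology_ball) (rule cochain_dist_triangle)
    have PV: "P \<in> ?V" using P \<delta>(1) F.completion_dist_self[OF P] by simp
    have AW: "A \<in> ?W" using A \<delta>(2) cochain_dist_self[of A] by simp
    have "extended_pairing Q B \<in> U" if Q: "Q \<in> ?V" and B: "B \<in> ?W" for Q B
    proof -
      have fin: "cochain_dist k \<alpha> \<beta> A B < \<infinity>" using B order_less_trans[OF _ ennreal_less_top] by auto
      have "cochain_norm2 k \<alpha> \<beta> B \<le> ennreal a + ennreal \<delta>2"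
        using cochain_norm2_le_dist_add[of B A] B unfolding a(2) by (auto intro: order_trans add_left_mono order_less_imp_le)
      also have "\<dots> \<le> ennreal (a + 1)" using a(1) \<delta> by (simp add: ennreal_leI flip: ennreal_plus)
      finally have NB: "cochain_norm2 k \<alpha> \<beta> B \<le> ennreal (a + 1)" .
      have "ennreal \<bar>extended_pairing P B - extended_pairing Q B\<bar> \<le> cochain_norm2 k \<alpha> \<beta> B * completion_dist ?d P Q"
        by (rule extended_pairing_chain_bound) (use P Q B in auto)
      also have "\<dots> \<le> ennreal (a + 1) * ennreal \<delta>1"
        using NB Q by (intro mult_mono) (auto simp: order_less_imp_le)
      also have "\<dots> = ennreal ((a + 1) * \<delta>1)"
        by (rule ennreal_mult[symmetric]) (use a(1) \<delta> in auto)
      also have "\<dots> = ennreal (e / 2)" by (simp only: small1)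
      finally have 1: "\<bar>extended_pairing P B - extended_pairing Q B\<bar> \<le> e / 2"
        using e(1) by (subst (asm) ennreal_le_iff) auto
      have "ennreal \<bar>extended_pairing P A - extended_pairing P B\<bar> \<le> cochain_dist k \<alpha> \<beta> A B * ennreal c"
        by (rule c(2)[OF A _ fin]) (use B in auto)
      also have "\<dots> \<le> ennreal \<delta>2 * ennreal c" using B by (intro mult_right_mono) (auto simp: order_less_imp_le)
      also have "\<dots> = ennreal (\<delta>2 * c)" using c(1) \<delta> by (simp add: ennreal_mult)
      finally have 2: "\<bar>extended_pairing P A - extended_pairing P B\<bar> \<le> \<delta>2 * c"
        using c(1) \<delta> by (subst (asm) ennreal_le_iff) auto
      have "dist (extended_pairing P A) (extended_pairing Q B) < e"
        using 1 2 small2 unfolding dist_real_def by linarith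
      then show ?thesis using e(2) by auto
    qed
    then have "?V \<times> ?W \<subseteq> {x \<in> topspace (prod_topology ?X ?Y). (case x of (P, A) \<Rightarrow> extended_pairing P A) \<in> U}"
      by (auto simp: flat_completion_topology_def cochain_topology_def)
    then show "\<exists>V W. openin ?X V \<and> openin ?Y W \<and> P \<in> V \<and> A \<in> W \<and>
      V \<times> W \<subseteq> {x \<in> topspace (prod_topology ?X ?Y). (case x of (P, A) \<Rightarrow> extended_pairing P A) \<in> U}"
      using V W PV AW by blast
  qed
qed simp

lemma extended_pairing_embed:
  fixes A :: "'a::euclidean_space cochain"
  assumes "X \<in> carrier (chain_group k)" "A \<in> bounded_cochains k \<alpha> \<beta>"
  shows "extended_pairing (completion_embed (carrier (chain_group k)) (flat_dist k \<alpha> \<beta>) X) A = A X"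
  using pairing_tendsto[OF assms(2) F.completion_embed_mem[OF assms(1)]]
  by (simp add: LIMSEQ_const_iff)

end

theorem corollary3p9:
  fixes k :: nat and \<alpha> \<beta> :: ereal
  assumes "k \<ge> 1" and "\<alpha> \<in> {0<..1}" and "\<beta> \<in> {0..1} \<union> {\<infinity>}"
  shows "\<exists>\<Phi> :: (nat \<Rightarrow> 'a::euclidean_space chain) set \<times> 'a cochain \<Rightarrow> real.
    continuous_map
      (prod_topology (flat_completion_topology k \<alpha> \<beta>) (cochain_topology k \<alpha> \<beta>))
      euclideanreal \<Phi> \<and>
    (\<forall>X\<in>carrier (chain_group k). \<forall>A\<in>bounded_cochains k \<alpha> \<beta>.
      \<Phi> (completion_embed (carrier (chain_group k)) (flat_dist k \<alpha> \<beta>) X, A) = A X)"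
proof (intro exI[of _ "\<lambda>(P, A). extended_pairing P A"] conjI ballI)
  have k: "0 < k" using assms(1) by simp
  show "continuous_map (prod_topology (flat_completion_topology k \<alpha> \<beta>) (cochain_topology k \<alpha> \<beta>))
    euclideanreal (\<lambda>(P :: (nat \<Rightarrow> 'a chain) set, A). extended_pairing P A)"
    by (rule continuous_extended_pairing[OF k])
  fix X :: "'a chain" and A :: "'a cochain"
  assume "X \<in> carrier (chain_group k)" "A \<in> bounded_cochains k \<alpha> \<beta>"
  then show "(case (completion_embed (carrier (chain_group k)) (flat_dist k \<alpha> \<beta>) X, A) of
      (P, A) \<Rightarrow> extended_pairing P A) = A X"
    using extended_pairing_embed[OF k] by simp
qed

end
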